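(* For each $c,h\in\mathbb{N}$ and $\epsilon>0$ there exists $\delta>0$ such that the following holds. Let $\frac{1}{\delta}\le k_1,\dots,k_h\le\left(\frac{1}{h}-\epsilon\right)n$, and let $A_i\in\binom{[n]}{k_i}$ ($i=1,\dots,h$) be sets such that the hypergraph $\mathcal{H}=\{A_1,\dots,A_h\}$ has center of size at most $c$. Let $\mathcal{F}_1\subseteq\binom{[n]}{k_1},\dots,\mathcal{F}_h\subseteq\binom{[n]}{k_h}$ be families with $\mu(\mathcal{F}_i)\ge\epsilon$. Suppose that for each $i$ either $\frac{k_i}{n}\le\delta$ or $\mathcal{F}_i$ is $\left(\lceil1/\delta\rceil,\delta\right)$-regular. Let $\pi$ be a uniformly random permutation of $[n]$ and $\mathbf{A}_i=\pi(A_i)$ (a uniformly random copy of $\mathcal{H}$). Then \[\Pr[\mathbf{A}_1\in\mathcal{F}_1,\dots,\mathbf{A}_h\in\mathcal{F}_h]>\delta.\]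
   Context: The center of a hypergraph is the set of vertices lying in at least two of its edges. For $\mathcal{F}\subseteq\binom{[n]}{k}$, $\mu(\mathcal{F})=|\mathcal{F}|/\binom{n}{k}$. For $B\subseteq J\subseteq[n]$, $\mathcal{F}_J^B=\{A\subseteq[n]\setminus J:A\cup B\in\mathcal{F}\}\subseteq\binom{[n]\setminus J}{k-|B|}$ with its uniform measure $\mu(\mathcal{F}_J^B)$. $\mathcal{F}$ is $(r,\epsilon)$-regular if $|\mu(\mathcal{F}_J^B)-\mu(\mathcal{F})|<\epsilon$ for all $J$ with $|J|\le r$ and all $B\subseteq J$. *)

theory Defs
  imports "HOL-Probability.Probability" "HOL-Combinatorics.Combinatorics" "HOL-Library.Ramsey"
begin

definition mu :: "'a set \<Rightarrow> nat \<Rightarrow> 'a set set \<Rightarrow> real" where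
  "mu S k F = real (card F) / real (card S choose k)"

definition slice :: "'a set \<Rightarrow> 'a set set \<Rightarrow> 'a set \<Rightarrow> 'a set \<Rightarrow> 'a set set" where
  "slice S F J B = {A. A \<subseteq> S - J \<and> A \<union> B \<in> F}"

text \<open>
  The two side conditions \<^term>\<open>card B \<le> k\<close> and \<^term>\<open>k - card B \<le> card (S - J)\<close> say precisely
  that there are sets of size \<open>k - card B\<close> in \<open>S - J\<close>, i.e. that the uniform measure of the slice
  is defined. Without them the truncated subtraction and division by zero would impose meaningless
  constraints on \<open>F\<close>.
\<close>

definition regular_family :: "'a set \<Rightarrow> nat \<Rightarrow> 'a set set \<Rightarrow> nat \<Rightarrow> real \<Rightarrow> bool" where
  "regular_family S k F r \<epsilon> \<longleftrightarrow>
     (\<forall>J B. J \<subseteq> S \<longrightarrow> card J \<le> r \<longrightarrow> B \<subseteq> J \<longrightarrow>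
        card B \<le> k \<longrightarrow> k - card B \<le> card (S - J) \<longrightarrow>
        \<bar>mu (S - J) (k - card B) (slice S F J B) - mu S k F\<bar> < \<epsilon>)"

text \<open>
  A hypergraph is given by an indexed family of edges, so that an edge repeated under two
  different indices counts as two edges.
\<close>

definition hypergraph_center :: "'i set \<Rightarrow> ('i \<Rightarrow> 'a set) \<Rightarrow> 'a set" where
  "hypergraph_center I A = {v. \<exists>i\<in>I. \<exists>j\<in>I. i \<noteq> j \<and> v \<in> A i \<and> v \<in> A j}"

end

theory Submission imports Defs begin

text \<open>
  Condition on the images of the centre one vertex at a time. For a sparse family the link of a typical
  vertex has almost the same density as the family (a second moment bound), and for a regular
  family this holds for every vertex, so one may assume that the edges \<open>A\<^sub>i\<close> are pairwise disjoint.
  In both cases the only information kept is that removing any bounded set \<open>J\<close> of vertices leaves a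
  family of density bounded below.

  For disjoint edges colour the ground set at random, each of the \<open>h\<close> colours having
  probability \<open>p\<^sub>1\<close> slightly below \<open>1 / h\<close>, and place a random copy of \<open>A\<^sub>i\<close> inside the \<open>i\<close>-th
  class \<open>P\<^sub>i\<close>. It is enough that the density of \<open>F\<^sub>i\<close> inside \<open>P\<^sub>i\<close> exceeds a constant with
  probability close to one. Let \<open>f\<^sub>p(X)\<close> be the expected density of \<open>F\<^sub>i\<close> inside a random
  subset of \<open>X\<close>, with sampling rate \<open>p\<^sub>0 / p\<close>. Then \<open>E\<^sub>p ln (f\<^sub>p + \<eta>)\<close> is nondecreasing in \<open>p\<close>, and
  its derivative controls the discrete gradient of \<open>ln (f\<^sub>p + \<eta>)\<close>: quadratically where the
  gradient is small, linearly where it is large. As the total increase is at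
  most \<open>\<Lambda> = ln (1 + 1 / \<eta>)\<close>, for some \<open>p\<close> the rescaled function \<open>ln (f\<^sub>p + \<eta>) / \<Lambda>\<close>
  behaves like a Boolean function of bounded total influence. The Falik-Samorodnitsky
  argument (logarithmic Sobolev inequality applied to martingale differences) shows that it is
  close to a function of boundedly many coordinates \<open>J\<close>. If \<open>f\<^sub>p\<close> were tiny with
  noticeable probability, it would thus be tiny on nearly all of some fibre over \<open>J\<close>, contradicting the
  density of \<open>F\<^sub>i\<close> after the removal of \<open>J\<close>.
\<close>

section \<open>The biased cube\<close>

text \<open>The obstacle is the order of the constants. On a fibre over \<open>J\<close> the density
  hypothesis only forces values of size \<open>\<zeta>\<close>, and \<open>\<zeta>\<close> decays
  exponentially in the bound on \<open>card J\<close>. For \<open>\<zeta>\<close> to look far from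
  tiny on the logarithmic scale, \<open>\<Lambda>\<close> must exceed a multiple of
  \<open>ln (1 / \<zeta>)\<close>, so the bound on \<open>card J\<close> must not depend on
  \<open>\<Lambda>\<close>. The logarithm achieves this: the total energy is at most a constant
  times \<open>\<Lambda>\<close>, a coordinate enters \<open>J\<close> when its energy exceeds
  \<open>\<tau> * \<Lambda>\<close>, and \<open>\<Lambda>\<close> cancels in the count. Linear
  control of the large increments suffices because no increment exceeds \<open>\<Lambda>\<close> and
  everything is divided by \<open>\<Lambda>\<close> afterwards. On the rescaled logarithm, values of
  \<open>f\<close> below \<open>\<eta>\<close> and above \<open>\<zeta>\<close> lie at least 1/2
  apart, a gap that an approximation in L2 detects; for \<open>f\<close> itself both may be close to
  0. The sampling rate \<open>p\<^sub>0 / p\<close> is dictated by the wish that \<open>u\<close>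
  always be evaluated at a \<open>p\<^sub>0\<close>-random set: varying \<open>p\<close> changes
  only how much is known about that set.\<close>

definition cube_exp :: "real \<Rightarrow> 'a set \<Rightarrow> ('a set \<Rightarrow> real) \<Rightarrow> real" where
  "cube_exp p S g = (\<Sum>X\<in>Pow S. p ^ card X * (1 - p) ^ card (S - X) * g X)"

text \<open>The difference carries no factor \<open>p * (1 - p)\<close>. Energies built from it are
  unnormalised, which keeps the constants in the functional inequalities independent of
  \<open>p\<close>.\<close>

definition pderiv_at :: "'a \<Rightarrow> ('a set \<Rightarrow> real) \<Rightarrow> 'a set \<Rightarrow> real" where
  "pderiv_at i g X = g (insert i X) - g (X - {i})"

definition avg_at :: "real \<Rightarrow> 'a \<Rightarrow> ('a set \<Rightarrow> real) \<Rightarrow> 'a set \<Rightarrow> real" where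
  "avg_at p i g X = p * g (insert i X) + (1 - p) * g (X - {i})"

lemma cube_exp_empty [simp]: "cube_exp p {} g = g {}"
  by (simp add: cube_exp_def)

lemma cube_exp_cong:
  assumes "\<And>X. X \<subseteq> S \<Longrightarrow> g X = g' X"
  shows "cube_exp p S g = cube_exp p S g'"
  using assms by (auto simp: cube_exp_def intro!: sum.cong)

text \<open>Conditioning on one more coordinate; nearly every identity on the cube follows from this
  recursion by induction on \<open>S\<close>.\<close>

lemma cube_exp_insert:
  assumes "finite S" "i \<notin> S"
  shows "cube_exp p (insert i S) g = cube_exp p S (\<lambda>X. p * g (insert i X) + (1 - p) * g X)"
proof -
  have disj: "Pow S \<inter> insert i ` Pow S = {}" using assms(2) by auto
  have inj: "inj_on (insert i) (Pow S)"
    using assms(2) by (auto simp: inj_on_def)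
  have c1: "card (insert i X) = Suc (card X)" if "X \<subseteq> S" for X
    using that assms finite_subset[OF that assms(1)] by (auto intro!: card_insert_disjoint)
  have c2: "card (insert i S - X) = Suc (card (S - X))" if "X \<subseteq> S" for X
  proof -
    have "insert i S - X = insert i (S - X)" using that assms(2) by auto
    thus ?thesis using assms by (simp add: card_insert_if)
  qed
  have c3: "insert i S - insert i X = S - X" if "X \<subseteq> S" for X
    using that assms(2) by auto
  show ?thesis
    unfolding cube_exp_def Pow_insert
    using assms
    by (subst sum.union_disjoint)
       (auto simp: disj sum.reindex[OF inj] c1 c2 c3 sum.distrib[symmetric] algebra_simps
             intro!: sum.cong)
qed

lemma cube_exp_add: "cube_exp p S (\<lambda>X. f X + g X) = cube_exp p S f + cube_exp p S g"
  by (simp add: cube_exp_def sum.distrib algebra_simps)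

lemma cube_exp_diff: "cube_exp p S (\<lambda>X. f X - g X) = cube_exp p S f - cube_exp p S g"
  by (simp add: cube_exp_def sum_subtractf algebra_simps)

lemma cube_exp_cmult: "cube_exp p S (\<lambda>X. a * g X) = a * cube_exp p S g"
  by (simp add: cube_exp_def sum_distrib_left algebra_simps)

lemma cube_exp_sum: "cube_exp p S (\<lambda>X. \<Sum>i\<in>I. g i X) = (\<Sum>i\<in>I. cube_exp p S (g i))"
  unfolding cube_exp_def by (simp add: sum_distrib_left) (rule sum.swap)

lemma cube_exp_const: "finite S \<Longrightarrow> cube_exp p S (\<lambda>X. a) = a"
proof (induction S rule: finite_induct)
  case (insert x F)
  have "p * a + (1 - p) * a = a" by (simp add: algebra_simps)
  thus ?case using insert by (simp add: cube_exp_insert)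
qed simp

lemma cube_exp_insert_split:
  assumes "finite S" "i \<notin> S"
  shows "cube_exp p (insert i S) g = p * cube_exp p S (\<lambda>X. g (insert i X)) + (1 - p) * cube_exp p S g"
  using assms by (simp add: cube_exp_insert cube_exp_add cube_exp_cmult)

lemma pderiv_at_insert:
  "i \<noteq> x \<Longrightarrow> (\<lambda>X. pderiv_at i g (insert x X)) = pderiv_at i (\<lambda>X. g (insert x X))"
  by (simp add: fun_eq_iff pderiv_at_def insert_commute insert_Diff_if)

lemma cube_exp_mono:
  assumes "0 \<le> p" "p \<le> 1" "\<And>X. X \<subseteq> S \<Longrightarrow> f X \<le> g X"
  shows "cube_exp p S f \<le> cube_exp p S g"
  using assms by (auto simp: cube_exp_def intro!: sum_mono mult_left_mono)

lemma cube_exp_nonneg: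
  assumes "0 \<le> p" "p \<le> 1" "\<And>X. X \<subseteq> S \<Longrightarrow> 0 \<le> g X"
  shows "0 \<le> cube_exp p S g"
  using assms by (auto simp: cube_exp_def intro!: sum_nonneg)

lemma cube_exp_avg_at:
  assumes "finite S" "i \<in> S"
  shows "cube_exp p S (avg_at p i g) = cube_exp p S g"
proof -
  obtain S' where S: "S = insert i S'" "i \<notin> S'" using assms(2) by (meson mk_disjoint_insert)
  have fin: "finite S'" using assms(1) S by simp
  have "cube_exp p S' (\<lambda>X. p * avg_at p i g (insert i X) + (1 - p) * avg_at p i g X) =
        cube_exp p S' (\<lambda>X. p * g (insert i X) + (1 - p) * g X)"
  proof (rule cube_exp_cong)
    fix X assume "X \<subseteq> S'"
    hence "i \<notin> X" using S by auto
    thus "p * avg_at p i g (insert i X) + (1 - p) * avg_at p i g X = p * g (insert i X) + (1 - p) * g X"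
      by (simp add: avg_at_def algebra_simps)
  qed
  thus ?thesis unfolding S(1) by (simp add: cube_exp_insert[OF fin S(2)])
qed

lemma cube_exp_cauchy_schwarz:
  assumes p: "0 \<le> p" "p \<le> 1"
  shows "(cube_exp p S (\<lambda>X. f X * g X))\<^sup>2 \<le>
         cube_exp p S (\<lambda>X. (f X)\<^sup>2) * cube_exp p S (\<lambda>X. (g X)\<^sup>2)"
proof -
  define w where "w X = p ^ card X * (1 - p) ^ card (S - X)" for X
  have w: "w X \<ge> 0" for X using p by (simp add: w_def)
  have "(\<Sum>X\<in>Pow S. (sqrt (w X) * f X) * (sqrt (w X) * g X))\<^sup>2 \<le>
    (\<Sum>X\<in>Pow S. (sqrt (w X) * f X)\<^sup>2) * (\<Sum>X\<in>Pow S. (sqrt (w X) * g X)\<^sup>2)"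
    by (rule Cauchy_Schwarz_ineq_sum)
  moreover have "(sqrt (w X) * f X) * (sqrt (w X) * g X) = w X * (f X * g X)" for X
  proof -
    have "(sqrt (w X) * f X) * (sqrt (w X) * g X) = (sqrt (w X) * sqrt (w X)) * (f X * g X)"
      by (simp only: mult_ac)
    thus ?thesis using w[of X] by simp
  qed
  moreover have "(sqrt (w X) * f X)\<^sup>2 = w X * (f X)\<^sup>2" for X f
    using w[of X] by (simp add: power_mult_distrib)
  ultimately show ?thesis unfolding cube_exp_def w_def[symmetric] by (simp only:)
qed

lemma cube_exp_square_le:
  assumes "0 \<le> p" "p \<le> 1" "finite S"
  shows "(cube_exp p S f)\<^sup>2 \<le> cube_exp p S (\<lambda>X. (f X)\<^sup>2)"
  using cube_exp_cauchy_schwarz[OF assms(1,2), of S f "\<lambda>_. 1"] assms(3)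
  by (simp add: cube_exp_const)

section \<open>Logarithmic Sobolev inequality with a constant uniform in the bias\<close>

text \<open>By \<open>ln x \<le> x - 1\<close> the entropy is at most the variance
  \<open>p * (1 - p) * (a - b)\<^sup>2\<close> divided by the mean \<open>m\<close>. Factor
  \<open>a - b\<close> through square roots; then
  \<open>(sqrt a + sqrt b)\<^sup>2 \<le> 2 * (a + b)\<close> and
  \<open>p * (1 - p) * (a + b) \<le> m\<close> leave the constant 2 for every \<open>p\<close>. With
  a factor \<open>p * (1 - p)\<close> on the right the constant would have to blow up as
  \<open>p\<close> tends to 0 or 1.\<close>

lemma two_point_log_sobolev:
  fixes p a b :: real
  assumes p: "0 < p" "p < 1" and a: "0 \<le> a" and b: "0 \<le> b"
  shows "p * (a * ln a) + (1 - p) * (b * ln b) - (p * a + (1 - p) * b) * ln (p * a + (1 - p) * b)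
         \<le> 2 * (sqrt a - sqrt b)\<^sup>2"
proof (cases "a = 0 \<and> b = 0")
  case False
  define m where "m = p * a + (1 - p) * b"
  have m: "m > 0"
  proof (cases "a = 0")
    case True
    thus ?thesis using False b p by (simp add: m_def)
  next
    case False
    hence "p * a > 0" using a p by simp
    moreover have "(1 - p) * b \<ge> 0" using b p by simp
    ultimately show ?thesis by (simp add: m_def)
  qed
  have 1: "x * ln x - x * ln m \<le> x * (x / m - 1)" if "x \<ge> 0" for x
  proof (cases "x = 0")
    case False
    hence x: "x > 0" using that by simp
    have "ln x - ln m = ln (x / m)" using x m by (simp add: ln_div)
    also have "\<dots> \<le> x / m - 1" using x m by (intro ln_le_minus_one) simp
    finally have "x * (ln x - ln m) \<le> x * (x / m - 1)" using x by simp
    thus ?thesis by (simp add: algebra_simps)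
  qed simp
  have "p * (a * ln a) + (1 - p) * (b * ln b) - m * ln m
      = p * (a * ln a - a * ln m) + (1 - p) * (b * ln b - b * ln m)"
    by (simp add: m_def algebra_simps)
  also have "\<dots> \<le> p * (a * (a / m - 1)) + (1 - p) * (b * (b / m - 1))"
    using 1[OF a] 1[OF b] p by (intro add_mono mult_left_mono) auto
  also have "\<dots> = (p * a\<^sup>2 + (1 - p) * b\<^sup>2 - m\<^sup>2) / m"
    using m by (simp add: field_simps power2_eq_square) (simp add: m_def algebra_simps)
  also have "p * a\<^sup>2 + (1 - p) * b\<^sup>2 - m\<^sup>2 = p * (1 - p) * (a - b)\<^sup>2"
    by (simp add: m_def power2_eq_square algebra_simps)
  also have "(a - b)\<^sup>2 = (sqrt a - sqrt b)\<^sup>2 * (sqrt a + sqrt b)\<^sup>2"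
  proof -
    have "a - b = (sqrt a - sqrt b) * (sqrt a + sqrt b)"
      using a b by (simp add: algebra_simps)
    thus ?thesis by (simp add: power_mult_distrib)
  qed
  also have "p * (1 - p) * ((sqrt a - sqrt b)\<^sup>2 * (sqrt a + sqrt b)\<^sup>2) / m
      = (sqrt a - sqrt b)\<^sup>2 * (p * (1 - p) * (sqrt a + sqrt b)\<^sup>2 / m)"
    by simp
  also have "\<dots> \<le> (sqrt a - sqrt b)\<^sup>2 * 2"
  proof (intro mult_left_mono)
    have "(sqrt a + sqrt b)\<^sup>2 \<le> 2 * (a + b)"
      using sum_squares_ge_zero[of "sqrt a - sqrt b" 0] a b
      by (simp add: power2_eq_square algebra_simps)
    hence "p * (1 - p) * (sqrt a + sqrt b)\<^sup>2 \<le> p * (1 - p) * (2 * (a + b))"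
      using p by (intro mult_left_mono) auto
    also have "\<dots> = 2 * (p * a * (1 - p) + (1 - p) * b * p)" by (simp add: algebra_simps)
    also have "\<dots> \<le> 2 * (p * a * 1 + (1 - p) * b * 1)"
      using p a b by (intro mult_left_mono add_mono) auto
    finally show "p * (1 - p) * (sqrt a + sqrt b)\<^sup>2 / m \<le> 2"
      using m by (simp add: m_def field_simps)
  qed simp
  finally show ?thesis by (simp add: m_def mult.commute)
qed auto

text \<open>Tensorisation: the entropy on the larger cube is the average of the entropies on its two
  halves plus the two-point entropy of their second moments \<open>a\<close> and
  \<open>b\<close>.\<close>

lemma cube_log_sobolev:
  assumes "finite S" and p: "0 < p" "p < 1"
  shows "cube_exp p S (\<lambda>X. (g X)\<^sup>2 * ln ((g X)\<^sup>2)) -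
         cube_exp p S (\<lambda>X. (g X)\<^sup>2) * ln (cube_exp p S (\<lambda>X. (g X)\<^sup>2))
         \<le> 2 * (\<Sum>i\<in>S. cube_exp p S (\<lambda>X. (pderiv_at i g X)\<^sup>2))"
  using assms(1)
proof (induction S arbitrary: g rule: finite_induct)
  case (insert x S)
  have p': "0 \<le> p" "p \<le> 1" using p by auto
  let ?E = "cube_exp p S"
  define g1 where "g1 X = g (insert x X)" for X
  define a b where "a = ?E (\<lambda>X. (g1 X)\<^sup>2)" and "b = ?E (\<lambda>X. (g X)\<^sup>2)"
  have ab: "a \<ge> 0" "b \<ge> 0"
    using p' by (auto simp: a_def b_def intro!: cube_exp_nonneg)
  have split: "cube_exp p (insert x S) k = p * ?E (\<lambda>X. k (insert x X)) + (1 - p) * ?E k" for k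
    using insert by (simp add: cube_exp_insert_split)
  have IH1: "?E (\<lambda>X. (g1 X)\<^sup>2 * ln ((g1 X)\<^sup>2)) - a * ln a \<le> 2 * (\<Sum>i\<in>S. ?E (\<lambda>X. (pderiv_at i g1 X)\<^sup>2))"
    unfolding a_def by (rule insert.IH)
  have IH0: "?E (\<lambda>X. (g X)\<^sup>2 * ln ((g X)\<^sup>2)) - b * ln b \<le> 2 * (\<Sum>i\<in>S. ?E (\<lambda>X. (pderiv_at i g X)\<^sup>2))"
    unfolding b_def by (rule insert.IH)
  have two: "p * (a * ln a) + (1 - p) * (b * ln b) - (p * a + (1 - p) * b) * ln (p * a + (1 - p) * b)
         \<le> 2 * (sqrt a - sqrt b)\<^sup>2" by (rule two_point_log_sobolev[OF p ab])
  \<comment> \<open>Reverse triangle inequality in L2; it turns the two-point term into energy in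
    direction \<open>x\<close>.\<close>
  have tri: "(sqrt a - sqrt b)\<^sup>2 \<le> ?E (\<lambda>X. (g1 X - g X)\<^sup>2)"
  proof -
    have "?E (\<lambda>X. g1 X * g X) \<le> sqrt (a * b)"
      by (rule real_le_rsqrt) (use cube_exp_cauchy_schwarz[OF p', of S g1 g] in \<open>simp add: a_def b_def\<close>)
    moreover have "?E (\<lambda>X. (g1 X - g X)\<^sup>2) = a + b - 2 * ?E (\<lambda>X. g1 X * g X)"
      by (simp add: power2_diff cube_exp_add cube_exp_diff a_def b_def cube_exp_cmult mult.assoc)
    ultimately show ?thesis
      using ab by (simp add: power2_diff real_sqrt_mult)
  qed
  have dx: "cube_exp p (insert x S) (\<lambda>X. (pderiv_at x g X)\<^sup>2) = ?E (\<lambda>X. (g1 X - g X)\<^sup>2)"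
  proof -
    have "cube_exp p (insert x S) (\<lambda>X. (pderiv_at x g X)\<^sup>2) = ?E (\<lambda>X. p * (pderiv_at x g (insert x X))\<^sup>2 + (1 - p) * (pderiv_at x g X)\<^sup>2)"
      using insert by (simp add: cube_exp_insert)
    also have "\<dots> = ?E (\<lambda>X. (g1 X - g X)\<^sup>2)"
    proof (rule cube_exp_cong)
      fix X assume "X \<subseteq> S"
      hence "x \<notin> X" using insert by auto
      thus "p * (pderiv_at x g (insert x X))\<^sup>2 + (1 - p) * (pderiv_at x g X)\<^sup>2 = (g1 X - g X)\<^sup>2"
        by (simp add: pderiv_at_def g1_def algebra_simps)
    qed
    finally show ?thesis .
  qed
  have di: "cube_exp p (insert x S) (\<lambda>X. (pderiv_at i g X)\<^sup>2) =
      p * ?E (\<lambda>X. (pderiv_at i g1 X)\<^sup>2) + (1 - p) * ?E (\<lambda>X. (pderiv_at i g X)\<^sup>2)" if "i \<in> S" for i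
  proof -
    have "i \<noteq> x" using that insert by auto
    hence "pderiv_at i g (insert x X) = pderiv_at i g1 X" for X
      using pderiv_at_insert[of i x g] by (simp add: g1_def[abs_def] fun_eq_iff)
    thus ?thesis by (simp add: split)
  qed
  have "p * (?E (\<lambda>X. (g1 X)\<^sup>2 * ln ((g1 X)\<^sup>2)) - a * ln a) \<le> p * (2 * (\<Sum>i\<in>S. ?E (\<lambda>X. (pderiv_at i g1 X)\<^sup>2)))"
    using IH1 p by simp
  moreover have "(1 - p) * (?E (\<lambda>X. (g X)\<^sup>2 * ln ((g X)\<^sup>2)) - b * ln b) \<le> (1 - p) * (2 * (\<Sum>i\<in>S. ?E (\<lambda>X. (pderiv_at i g X)\<^sup>2)))"
    using IH0 p by simp
  moreover have "(\<Sum>i\<in>insert x S. cube_exp p (insert x S) (\<lambda>X. (pderiv_at i g X)\<^sup>2)) =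
     ?E (\<lambda>X. (g1 X - g X)\<^sup>2) + (p * (\<Sum>i\<in>S. ?E (\<lambda>X. (pderiv_at i g1 X)\<^sup>2)) + (1 - p) * (\<Sum>i\<in>S. ?E (\<lambda>X. (pderiv_at i g X)\<^sup>2)))"
    using insert by (simp add: dx di sum.distrib sum_distrib_left)
  moreover have "cube_exp p (insert x S) (\<lambda>X. (g X)\<^sup>2) = p * a + (1 - p) * b"
    by (simp add: split a_def b_def g1_def)
  moreover have "cube_exp p (insert x S) (\<lambda>X. (g X)\<^sup>2 * ln ((g X)\<^sup>2)) =
     p * ?E (\<lambda>X. (g1 X)\<^sup>2 * ln ((g1 X)\<^sup>2)) + (1 - p) * ?E (\<lambda>X. (g X)\<^sup>2 * ln ((g X)\<^sup>2))"
    by (simp add: split g1_def)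
  ultimately show ?case using two tri
    by (simp only:) (simp only: right_diff_distrib distrib_left mult.left_commute[of p 2] mult.left_commute[of "1 - p" 2])
qed simp

text \<open>The inequality \<open>ln y \<le> y - 1\<close> at
  \<open>y = exp M * s / \<bar>g X\<bar>\<close>, with \<open>s\<close> the L2 norm, bounds the
  entropy from below. Thus a function whose L1 norm is far smaller than its L2 norm has energy of at
  least about \<open>M\<close> times its second moment. \<open>M\<close> stays free and is taken
  large later.\<close>

lemma cube_L1_L2:
  fixes M :: real
  assumes "finite S" and p: "0 < p" "p < 1"
  shows "(M + 1) * cube_exp p S (\<lambda>X. (g X)\<^sup>2) \<le> (\<Sum>i\<in>S. cube_exp p S (\<lambda>X. (pderiv_at i g X)\<^sup>2))
     + exp M * sqrt (cube_exp p S (\<lambda>X. (g X)\<^sup>2)) * cube_exp p S (\<lambda>X. \<bar>g X\<bar>)"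
proof -
  have p': "0 \<le> p" "p \<le> 1" using p by auto
  define v where "v = cube_exp p S (\<lambda>X. (g X)\<^sup>2)"
  have v0: "v \<ge> 0" unfolding v_def using p' by (intro cube_exp_nonneg) auto
  have rhs: "0 \<le> (\<Sum>i\<in>S. cube_exp p S (\<lambda>X. (pderiv_at i g X)\<^sup>2))"
    using p' by (intro sum_nonneg cube_exp_nonneg) auto
  show ?thesis
  proof (cases "v = 0")
    case True
    thus ?thesis using rhs by (simp add: v_def)
  next
    case False
    hence v: "v > 0" using v0 by simp
    define s where "s = sqrt v"
    have s: "s > 0" "s\<^sup>2 = v" using v by (auto simp: s_def)
    have pt: "2 * (M + 1) * (g X)\<^sup>2 - 2 * exp M * s * \<bar>g X\<bar> \<le> (g X)\<^sup>2 * ln ((g X)\<^sup>2) - ln v * (g X)\<^sup>2" for X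
    proof (cases "g X = 0")
      case False
      define y where "y = \<bar>g X\<bar>"
      have y: "y > 0" "(g X)\<^sup>2 = y\<^sup>2" using False by (auto simp: y_def)
      have "ln (exp M * s / y) \<le> exp M * s / y - 1" using y s by (intro ln_le_minus_one) auto
      moreover have "ln (exp M * s / y) = M + ln s - ln y" using y s by (simp add: ln_div ln_mult)
      ultimately have "M + 1 - exp M * s / y \<le> ln y - ln s" by simp
      hence "2 * y\<^sup>2 * (M + 1 - exp M * s / y) \<le> 2 * y\<^sup>2 * (ln y - ln s)"
        using y by (intro mult_left_mono) auto
      moreover have "2 * y\<^sup>2 * (M + 1 - exp M * s / y) = 2 * (M + 1) * y\<^sup>2 - 2 * exp M * s * y"
        using y by (simp add: field_simps power2_eq_square)
      moreover have "ln (y\<^sup>2) = 2 * ln y" using y by (simp add: ln_realpow)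
      moreover have "ln v = 2 * ln s" using s(1) by (simp add: ln_realpow flip: s(2))
      ultimately show ?thesis unfolding y(2) y_def[symmetric] by (simp add: algebra_simps)
    qed simp
    have "cube_exp p S (\<lambda>X. 2 * (M + 1) * (g X)\<^sup>2 - 2 * exp M * s * \<bar>g X\<bar>) \<le>
          cube_exp p S (\<lambda>X. (g X)\<^sup>2 * ln ((g X)\<^sup>2) - ln v * (g X)\<^sup>2)"
      using p' pt by (intro cube_exp_mono) auto
    hence "2 * (M + 1) * v - 2 * exp M * s * cube_exp p S (\<lambda>X. \<bar>g X\<bar>) \<le>
       cube_exp p S (\<lambda>X. (g X)\<^sup>2 * ln ((g X)\<^sup>2)) - ln v * v"
      by (simp only: cube_exp_diff cube_exp_cmult v_def)
    also have "\<dots> \<le> 2 * (\<Sum>i\<in>S. cube_exp p S (\<lambda>X. (pderiv_at i g X)\<^sup>2))"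
      using cube_log_sobolev[OF assms, of g] by (simp add: v_def mult.commute)
    finally have "2 * ((M + 1) * v) \<le> 2 * ((\<Sum>i\<in>S. cube_exp p S (\<lambda>X. (pderiv_at i g X)\<^sup>2)) +
        exp M * s * cube_exp p S (\<lambda>X. \<bar>g X\<bar>))"
      by (simp only: algebra_simps)
    thus ?thesis by (simp only: v_def[symmetric] s_def mult_le_cancel_left_pos zero_less_numeral)
  qed
qed

section \<open>Approximation by juntas\<close>

text \<open>For \<open>T = S - J\<close> this is the conditional expectation given the coordinates
  in \<open>J\<close>, hence the best approximation in L2 by a function of those
  coordinates.\<close>

definition avg_over :: "real \<Rightarrow> 'a set \<Rightarrow> ('a set \<Rightarrow> real) \<Rightarrow> 'a set \<Rightarrow> real" where
  "avg_over p T g X = cube_exp p T (\<lambda>Y. g ((X - T) \<union> Y))"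

lemma avg_over_empty [simp]: "avg_over p {} g = g"
  by (simp add: avg_over_def fun_eq_iff)

lemma avg_over_insert:
  assumes "finite T" "i \<notin> T"
  shows "avg_over p (insert i T) g = avg_at p i (avg_over p T g)"
proof
  fix X
  have 1: "(X - insert i T) \<union> insert i Y = (insert i X - T) \<union> Y" if "Y \<subseteq> T" for Y
    using that assms(2) by auto
  have 2: "(X - insert i T) \<union> Y = (X - {i} - T) \<union> Y" if "Y \<subseteq> T" for Y
    using that assms(2) by auto
  have "avg_over p (insert i T) g X =
      cube_exp p T (\<lambda>Y. p * g ((insert i X - T) \<union> Y) + (1 - p) * g ((X - {i} - T) \<union> Y))"
    unfolding avg_over_def cube_exp_insert[OF assms]
    by (rule cube_exp_cong) (simp only: 1 2)
  thus "avg_over p (insert i T) g X = avg_at p i (avg_over p T g) X"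
    by (simp add: cube_exp_add cube_exp_cmult avg_at_def avg_over_def)
qed

lemma cube_exp_avg_over:
  assumes "finite S" "T \<subseteq> S"
  shows "cube_exp p S (avg_over p T g) = cube_exp p S g"
proof -
  have "finite T" using assms finite_subset by blast
  thus ?thesis using assms(2)
  proof (induction T rule: finite_induct)
    case (insert x T)
    thus ?case using assms(1) by (simp add: avg_over_insert cube_exp_avg_at)
  qed simp
qed

lemma pderiv_at_avg_at: "i \<noteq> j \<Longrightarrow> pderiv_at i (avg_at p j g) = avg_at p j (pderiv_at i g)"
  by (auto simp: pderiv_at_def avg_at_def fun_eq_iff insert_commute insert_Diff_if
        Diff_insert2[symmetric] algebra_simps Diff_insert[symmetric])

lemma pderiv_at_avg_at_same: "pderiv_at i (avg_at p i g) = (\<lambda>X. 0)"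
  by (auto simp: pderiv_at_def avg_at_def fun_eq_iff)

text \<open>Pythagoras: \<open>avg_at p i\<close> is an orthogonal projection in L2.\<close>

lemma cube_exp_avg_at_residual:
  assumes "finite S" "i \<in> S"
  shows "cube_exp p S (\<lambda>X. (g X - avg_at p i g X)\<^sup>2) =
         cube_exp p S (\<lambda>X. (g X)\<^sup>2) - cube_exp p S (\<lambda>X. (avg_at p i g X)\<^sup>2)"
proof -
  have "cube_exp p S (\<lambda>X. g X * avg_at p i g X) = cube_exp p S (avg_at p i (\<lambda>X. g X * avg_at p i g X))"
    using assms by (simp add: cube_exp_avg_at)
  also have "avg_at p i (\<lambda>X. g X * avg_at p i g X) = (\<lambda>X. (avg_at p i g X)\<^sup>2)"
    by (auto simp: avg_at_def fun_eq_iff power2_eq_square algebra_simps)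
  finally have "cube_exp p S (\<lambda>X. g X * avg_at p i g X) = cube_exp p S (\<lambda>X. (avg_at p i g X)\<^sup>2)" .
  moreover have "cube_exp p S (\<lambda>X. (g X - avg_at p i g X)\<^sup>2) = cube_exp p S (\<lambda>X. (g X)\<^sup>2)
      + cube_exp p S (\<lambda>X. (avg_at p i g X)\<^sup>2) - 2 * cube_exp p S (\<lambda>X. g X * avg_at p i g X)"
    by (simp add: power2_diff cube_exp_add cube_exp_diff cube_exp_cmult mult.assoc)
  ultimately show ?thesis by simp
qed

lemma cube_exp_abs_avg_at_le:
  assumes "finite S" "i \<in> S" "0 \<le> p" "p \<le> 1"
  shows "cube_exp p S (\<lambda>X. \<bar>avg_at p i g X\<bar>) \<le> cube_exp p S (\<lambda>X. \<bar>g X\<bar>)"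
proof -
  have "cube_exp p S (\<lambda>X. \<bar>avg_at p i g X\<bar>) \<le> cube_exp p S (avg_at p i (\<lambda>X. \<bar>g X\<bar>))"
  proof (rule cube_exp_mono)
    fix X
    show "\<bar>avg_at p i g X\<bar> \<le> avg_at p i (\<lambda>X. \<bar>g X\<bar>) X"
      unfolding avg_at_def using assms(3,4)
      by (intro order_trans[OF abs_triangle_ineq]) (simp add: abs_mult)
  qed (use assms in auto)
  thus ?thesis using assms by (simp add: cube_exp_avg_at)
qed

text \<open>Averaging a coordinate other than \<open>i\<close> commutes with the derivative and
  contracts the L1 norm, and averaging \<open>i\<close> itself kills the derivative. So the
  intermediate functions of the martingale have L1 influences no larger than those of
  \<open>g\<close>.\<close>

lemma cube_exp_abs_pderiv_avg_over_le:
  assumes "finite S" "T \<subseteq> S" "i \<in> S" "0 \<le> p" "p \<le> 1"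
  shows "cube_exp p S (\<lambda>X. \<bar>pderiv_at i (avg_over p T g) X\<bar>) \<le> cube_exp p S (\<lambda>X. \<bar>pderiv_at i g X\<bar>)"
proof -
  have "finite T" using assms finite_subset by blast
  thus ?thesis using assms(2)
  proof (induction T rule: finite_induct)
    case (insert x T)
    have xS: "x \<in> S" using insert by auto
    show ?case
    proof (cases "x = i")
      case True
      thus ?thesis using insert assms
        by (simp add: avg_over_insert pderiv_at_avg_at_same cube_exp_const)
           (intro cube_exp_nonneg, auto)
    next
      case False
      hence "cube_exp p S (\<lambda>X. \<bar>pderiv_at i (avg_over p (insert x T) g) X\<bar>) =
             cube_exp p S (\<lambda>X. \<bar>avg_at p x (pderiv_at i (avg_over p T g)) X\<bar>)"
        using insert by (simp add: avg_over_insert pderiv_at_avg_at)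
      also have "\<dots> \<le> cube_exp p S (\<lambda>X. \<bar>pderiv_at i (avg_over p T g) X\<bar>)"
        using assms xS by (intro cube_exp_abs_avg_at_le) auto
      also have "\<dots> \<le> cube_exp p S (\<lambda>X. \<bar>pderiv_at i g X\<bar>)" using insert by auto
      finally show ?thesis .
    qed
  qed simp
qed

text \<open>\<open>cube_L1_L2\<close> for the martingale difference
  \<open>d = g - avg_at p x g\<close>. Since the projection commutes with the derivatives in the
  other directions, the energy of \<open>d\<close> is exactly the drop in energy from
  \<open>g\<close> to its average, and \<open>\<bar>d\<bar>\<close> is dominated by the derivative
  in direction \<open>x\<close>.\<close>

lemma falik_samorodnitsky_step:
  fixes M :: real
  assumes S: "finite S" "x \<in> S" and p: "0 < p" "p < 1"
  shows "(M + 1/2) * (cube_exp p S (\<lambda>X. (g X)\<^sup>2) - cube_exp p S (\<lambda>X. (avg_at p x g X)\<^sup>2))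
    \<le> (\<Sum>i\<in>S. cube_exp p S (\<lambda>X. (pderiv_at i g X)\<^sup>2) - cube_exp p S (\<lambda>X. (pderiv_at i (avg_at p x g) X)\<^sup>2))
      + 1/2 * exp (2 * M) * (cube_exp p S (\<lambda>X. \<bar>pderiv_at x g X\<bar>))\<^sup>2"
proof -
  have p': "0 \<le> p" "p \<le> 1" using p by auto
  define d where "d X = g X - avg_at p x g X" for X
  define v where "v = cube_exp p S (\<lambda>X. (d X)\<^sup>2)"
  have v0: "v \<ge> 0" using p' by (auto simp: v_def intro!: cube_exp_nonneg)
  have v: "v = cube_exp p S (\<lambda>X. (g X)\<^sup>2) - cube_exp p S (\<lambda>X. (avg_at p x g X)\<^sup>2)"
    unfolding v_def d_def by (rule cube_exp_avg_at_residual[OF S])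
  have di: "pderiv_at i d X = pderiv_at i g X - pderiv_at i (avg_at p x g) X" for i X
    by (simp add: pderiv_at_def d_def)
  have en: "cube_exp p S (\<lambda>X. (pderiv_at i d X)\<^sup>2) =
     cube_exp p S (\<lambda>X. (pderiv_at i g X)\<^sup>2) - cube_exp p S (\<lambda>X. (pderiv_at i (avg_at p x g) X)\<^sup>2)"
    if "i \<in> S" for i
  proof (cases "i = x")
    case True
    thus ?thesis using S by (simp add: di pderiv_at_avg_at_same cube_exp_const)
  next
    case False
    show ?thesis
      unfolding di pderiv_at_avg_at[OF False] by (rule cube_exp_avg_at_residual[OF S])
  qed
  have l1: "cube_exp p S (\<lambda>X. \<bar>d X\<bar>) \<le> cube_exp p S (\<lambda>X. \<bar>pderiv_at x g X\<bar>)"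
  proof (rule cube_exp_mono[OF p'])
    fix X :: "'a set"
    consider "x \<in> X" "d X = (1 - p) * pderiv_at x g X" | "x \<notin> X" "d X = - p * pderiv_at x g X"
      by (cases "x \<in> X") (auto simp: d_def avg_at_def pderiv_at_def insert_absorb algebra_simps)
    thus "\<bar>d X\<bar> \<le> \<bar>pderiv_at x g X\<bar>"
      by cases (use p' in \<open>auto simp: abs_mult intro!: mult_left_le_one_le\<close>)
  qed
  define l where "l = cube_exp p S (\<lambda>X. \<bar>pderiv_at x g X\<bar>)"
  have "(M + 1) * v \<le> (\<Sum>i\<in>S. cube_exp p S (\<lambda>X. (pderiv_at i d X)\<^sup>2))
     + exp M * sqrt v * cube_exp p S (\<lambda>X. \<bar>d X\<bar>)"
    unfolding v_def by (rule cube_L1_L2[OF S(1) p])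
  also have "exp M * sqrt v * cube_exp p S (\<lambda>X. \<bar>d X\<bar>) \<le> exp M * sqrt v * l"
    using l1 v0 by (intro mult_left_mono) (auto simp: l_def)
  \<comment> \<open>The arithmetic-geometric mean inequality removes the square root at the price of
    \<open>v / 2\<close>, which turns \<open>M + 1\<close> into \<open>M + 1/2\<close>.\<close>
  also have "exp M * sqrt v * l \<le> 1/2 * v + 1/2 * exp (2 * M) * l\<^sup>2"
  proof -
    have "0 \<le> (sqrt v - exp M * l)\<^sup>2" by simp
    also have "(sqrt v - exp M * l)\<^sup>2 = v + exp (2 * M) * l\<^sup>2 - 2 * (exp M * sqrt v * l)"
      using v0 by (simp add: power2_diff power_mult_distrib exp_double)
    finally show ?thesis by simp
  qed
  finally have "(M + 1/2) * v \<le> (\<Sum>i\<in>S. cube_exp p S (\<lambda>X. (pderiv_at i d X)\<^sup>2)) + 1/2 * exp (2 * M) * l\<^sup>2"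
    by (simp add: algebra_simps)
  thus ?thesis unfolding v l_def by (simp add: en)
qed

text \<open>Averaging out the coordinates of \<open>T\<close> one at a time, both the second moments
  and the energies telescope; the energy of the last average is nonnegative and is dropped.\<close>

lemma falik_samorodnitsky:
  fixes M :: real
  assumes S: "finite S" "T \<subseteq> S" and p: "0 < p" "p < 1"
  shows "(M + 1/2) * (cube_exp p S (\<lambda>X. (g X)\<^sup>2) - cube_exp p S (\<lambda>X. (avg_over p T g X)\<^sup>2))
    \<le> (\<Sum>i\<in>S. cube_exp p S (\<lambda>X. (pderiv_at i g X)\<^sup>2))
      + 1/2 * exp (2 * M) * (\<Sum>i\<in>T. (cube_exp p S (\<lambda>X. \<bar>pderiv_at i g X\<bar>))\<^sup>2)"
proof -
  have p': "0 \<le> p" "p \<le> 1" using p by auto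
  have "finite T" using S finite_subset by blast
  hence "T \<subseteq> S \<Longrightarrow> (M + 1/2) * (cube_exp p S (\<lambda>X. (g X)\<^sup>2) - cube_exp p S (\<lambda>X. (avg_over p T g X)\<^sup>2))
    \<le> (\<Sum>i\<in>S. cube_exp p S (\<lambda>X. (pderiv_at i g X)\<^sup>2)) - (\<Sum>i\<in>S. cube_exp p S (\<lambda>X. (pderiv_at i (avg_over p T g) X)\<^sup>2))
      + 1/2 * exp (2 * M) * (\<Sum>i\<in>T. (cube_exp p S (\<lambda>X. \<bar>pderiv_at i g X\<bar>))\<^sup>2)"
  proof (induction T rule: finite_induct)
    case (insert x T)
    define G where "G = avg_over p T g"
    have G': "avg_over p (insert x T) g = avg_at p x G" using insert by (simp add: G_def avg_over_insert)
    have x: "x \<in> S" "T \<subseteq> S" using insert by auto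
    have "(cube_exp p S (\<lambda>X. \<bar>pderiv_at x G X\<bar>))\<^sup>2 \<le> (cube_exp p S (\<lambda>X. \<bar>pderiv_at x g X\<bar>))\<^sup>2"
      unfolding G_def using p' S(1) x
      by (intro power_mono cube_exp_abs_pderiv_avg_over_le cube_exp_nonneg) auto
    moreover define q where "q = 1/2 * exp (2 * M)"
    ultimately have "q * (cube_exp p S (\<lambda>X. \<bar>pderiv_at x G X\<bar>))\<^sup>2 \<le> q * (cube_exp p S (\<lambda>X. \<bar>pderiv_at x g X\<bar>))\<^sup>2"
      by (intro mult_left_mono) (auto simp: q_def)
    moreover define m where "m = M + 1/2"
    moreover note falik_samorodnitsky_step[OF S(1) x(1) p, of M G, folded q_def m_def]
    moreover note insert.IH[OF x(2), folded G_def q_def m_def]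
    ultimately show ?case
      unfolding G' q_def[symmetric] m_def[symmetric] sum.insert[OF insert.hyps(1,2)] sum_subtractf
        right_diff_distrib distrib_left by linarith
  qed simp
  from this[OF S(2)] show ?thesis
    using sum_nonneg[of S "\<lambda>i. cube_exp p S (\<lambda>X. (pderiv_at i (avg_over p T g) X)\<^sup>2)"] p'
    by (smt (verit) cube_exp_nonneg zero_le_power2)
qed

section \<open>The logarithmic potential\<close>

lemma cube_exp_insert_pderiv_same:
  assumes "finite S" "i \<notin> S"
  shows "cube_exp p (insert i S) (pderiv_at i g) = cube_exp p S (\<lambda>X. g (insert i X)) - cube_exp p S g"
proof -
  have "cube_exp p (insert i S) (pderiv_at i g) =
      cube_exp p S (\<lambda>X. p * pderiv_at i g (insert i X) + (1 - p) * pderiv_at i g X)"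
    using assms by (rule cube_exp_insert)
  also have "\<dots> = cube_exp p S (\<lambda>X. g (insert i X) - g X)"
  proof (rule cube_exp_cong)
    fix X assume "X \<subseteq> S"
    hence "i \<notin> X" using assms by auto
    thus "p * pderiv_at i g (insert i X) + (1 - p) * pderiv_at i g X = g (insert i X) - g X"
      by (simp add: pderiv_at_def algebra_simps)
  qed
  finally show ?thesis by (simp add: cube_exp_diff)
qed

text \<open>Russo's formula for an integrand that itself varies with the bias; the second term comes
  from the product rule.\<close>

lemma cube_exp_has_derivative:
  assumes "finite S" "\<And>X. X \<subseteq> S \<Longrightarrow> ((\<lambda>p. k p X) has_real_derivative k' X) (at t)"
  shows "((\<lambda>p. cube_exp p S (k p)) has_real_derivative
           ((\<Sum>i\<in>S. cube_exp t S (pderiv_at i (k t))) + cube_exp t S k')) (at t)"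
  using assms
proof (induction S arbitrary: k k' rule: finite_induct)
  case (insert x S)
  have 1: "((\<lambda>p. cube_exp p S (\<lambda>X. k p (insert x X))) has_real_derivative
           ((\<Sum>i\<in>S. cube_exp t S (pderiv_at i (\<lambda>X. k t (insert x X)))) + cube_exp t S (\<lambda>X. k' (insert x X)))) (at t)"
    by (rule insert.IH) (rule insert.prems, auto)
  have 0: "((\<lambda>p. cube_exp p S (k p)) has_real_derivative
           ((\<Sum>i\<in>S. cube_exp t S (pderiv_at i (k t))) + cube_exp t S k')) (at t)"
    by (rule insert.IH) (rule insert.prems, auto)
  have ix: "i \<noteq> x" if "i \<in> S" for i using that insert by auto
  have D: "cube_exp t (insert x S) (pderiv_at i (k t)) =
      t * cube_exp t S (pderiv_at i (\<lambda>X. k t (insert x X))) + (1 - t) * cube_exp t S (pderiv_at i (k t))"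
    if "i \<in> S" for i
    using insert ix[OF that] by (simp add: cube_exp_insert_split pderiv_at_insert)
  have D': "(\<Sum>i\<in>S. cube_exp t (insert x S) (pderiv_at i (k t))) =
      t * (\<Sum>i\<in>S. cube_exp t S (pderiv_at i (\<lambda>X. k t (insert x X))))
      + (1 - t) * (\<Sum>i\<in>S. cube_exp t S (pderiv_at i (k t)))"
    by (simp add: D sum.distrib sum_distrib_left)
  have eq: "(\<Sum>i\<in>insert x S. cube_exp t (insert x S) (pderiv_at i (k t))) + cube_exp t (insert x S) k' =
      (cube_exp t S (\<lambda>X. k t (insert x X)) - cube_exp t S (k t))
      + (t * (\<Sum>i\<in>S. cube_exp t S (pderiv_at i (\<lambda>X. k t (insert x X))))
      + (1 - t) * (\<Sum>i\<in>S. cube_exp t S (pderiv_at i (k t))))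
      + (t * cube_exp t S (\<lambda>X. k' (insert x X)) + (1 - t) * cube_exp t S k')"
    by (simp only: sum.insert[OF insert.hyps(1,2)] D' cube_exp_insert_pderiv_same[OF insert.hyps(1,2)]
        cube_exp_insert_split[OF insert.hyps(1,2), of _ k'])
  have split: "(\<lambda>p. cube_exp p (insert x S) (k p)) =
      (\<lambda>p. p * cube_exp p S (\<lambda>X. k p (insert x X)) + (1 - p) * cube_exp p S (k p))"
    using insert.hyps by (simp add: cube_exp_insert_split)
  show ?case
    unfolding eq split
    by (rule DERIV_cong[OF DERIV_add[OF DERIV_mult[OF DERIV_ident 1] DERIV_mult[OF DERIV_diff[OF DERIV_const DERIV_ident] 0]]])
       (simp add: algebra_simps)
qed (auto intro: DERIV_cong)

text \<open>A \<open>q\<close>-random subset of a \<open>p\<close>-random set is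
  \<open>p * q\<close>-random. Used with \<open>q = p0 / p\<close>, and with quotients of two biases
  to couple nested random sets.\<close>

lemma cube_exp_compose:
  "finite S \<Longrightarrow> cube_exp p S (\<lambda>X. cube_exp q X u) = cube_exp (p * q) S u"
proof (induction S arbitrary: u rule: finite_induct)
  case (insert x S)
  have "cube_exp p (insert x S) (\<lambda>X. cube_exp q X u) =
     p * cube_exp p S (\<lambda>X. cube_exp q (insert x X) u) + (1 - p) * cube_exp p S (\<lambda>X. cube_exp q X u)"
    using insert by (simp add: cube_exp_insert_split)
  also have "cube_exp p S (\<lambda>X. cube_exp q (insert x X) u) =
      cube_exp p S (\<lambda>X. q * cube_exp q X (\<lambda>X. u (insert x X)) + (1 - q) * cube_exp q X u)"
  proof (rule cube_exp_cong)
    fix X assume "X \<subseteq> S"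
    hence "x \<notin> X" "finite X" using insert finite_subset by auto
    thus "cube_exp q (insert x X) u = q * cube_exp q X (\<lambda>X. u (insert x X)) + (1 - q) * cube_exp q X u"
      by (simp add: cube_exp_insert_split)
  qed
  also have "\<dots> = q * cube_exp (p * q) S (\<lambda>X. u (insert x X)) + (1 - q) * cube_exp (p * q) S u"
    by (simp add: cube_exp_add cube_exp_cmult insert.IH)
  also have "cube_exp p S (\<lambda>X. cube_exp q X u) = cube_exp (p * q) S u" by (rule insert.IH)
  finally show ?case
    using insert by (simp add: cube_exp_insert_split algebra_simps)
qed simp

lemma cube_exp_remove:
  assumes "finite X" "i \<in> X"
  shows "cube_exp q X u - cube_exp q (X - {i}) u = q * cube_exp q X (pderiv_at i u)"
proof -
  define X' where "X' = X - {i}"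
  have X: "X = insert i X'" "i \<notin> X'" "finite X'" using assms by (auto simp: X'_def)
  show ?thesis unfolding X'_def[symmetric] unfolding X(1)
    unfolding cube_exp_insert_pderiv_same[OF X(3,2)]
    using X by (simp add: cube_exp_insert_split algebra_simps)
qed

text \<open>Russo's formula in the rate \<open>p0 / t\<close> and the chain rule;
  \<open>cube_exp_remove\<close> expresses each influence as the change caused by deleting
  \<open>i\<close> from \<open>X\<close>.\<close>

lemma cube_exp_thin_has_derivative:
  assumes "finite X" "t \<noteq> 0"
  shows "((\<lambda>t. cube_exp (p0 / t) X u) has_real_derivative
     (- (1 / t) * (\<Sum>i\<in>X. cube_exp (p0 / t) X u - cube_exp (p0 / t) (X - {i}) u))) (at t)"
proof -
  have "((\<lambda>q. cube_exp q X u) has_real_derivative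
      ((\<Sum>i\<in>X. cube_exp (p0 / t) X (pderiv_at i u)) + cube_exp (p0 / t) X (\<lambda>_. 0))) (at (p0 / t))"
    by (rule cube_exp_has_derivative) (use assms in auto)
  moreover have "((\<lambda>t. p0 / t) has_real_derivative (- (p0 / t\<^sup>2))) (at t)"
    using assms by (auto intro!: derivative_eq_intros simp: power2_eq_square)
  ultimately have "((\<lambda>t. cube_exp (p0 / t) X u) has_real_derivative
     (((\<Sum>i\<in>X. cube_exp (p0 / t) X (pderiv_at i u)) + cube_exp (p0 / t) X (\<lambda>_. 0)) * (- (p0 / t\<^sup>2)))) (at t)"
    by (rule DERIV_chain2)
  moreover have "((\<Sum>i\<in>X. cube_exp (p0 / t) X (pderiv_at i u)) + cube_exp (p0 / t) X (\<lambda>_. 0)) * (- (p0 / t\<^sup>2)) =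
     - (1 / t) * (\<Sum>i\<in>X. cube_exp (p0 / t) X u - cube_exp (p0 / t) (X - {i}) u)"
  proof -
    have "(\<Sum>i\<in>X. cube_exp (p0 / t) X u - cube_exp (p0 / t) (X - {i}) u) =
       p0 / t * (\<Sum>i\<in>X. cube_exp (p0 / t) X (pderiv_at i u))"
      unfolding sum_distrib_left by (rule sum.cong[OF refl]) (rule cube_exp_remove[OF assms(1)])
    thus ?thesis using assms by (simp add: cube_exp_const power2_eq_square)
  qed
  ultimately show ?thesis by (simp only:)
qed

lemma cube_exp_mem:
  assumes "finite S" "i \<in> S"
  shows "cube_exp t S (\<lambda>X. if i \<in> X then h X else 0) = t * cube_exp t S (\<lambda>X. h (insert i X))"
proof -
  have "cube_exp t S (\<lambda>X. if i \<in> X then h X else 0) =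
        cube_exp t S (avg_at t i (\<lambda>X. if i \<in> X then h X else 0))"
    using assms by (simp add: cube_exp_avg_at)
  also have "avg_at t i (\<lambda>X. if i \<in> X then h X else 0) = (\<lambda>X. t * h (insert i X))"
    by (auto simp: avg_at_def)
  finally show ?thesis by (simp add: cube_exp_cmult)
qed

text \<open>The event that \<open>i\<close> lies in \<open>X\<close> has probability
  \<open>t\<close> and is independent of the rest of \<open>X\<close>. This brings the sum over
  \<open>i \<in> X\<close> from the thinning derivative into the shape of Russo's sum over
  \<open>S\<close>.\<close>

lemma cube_exp_sum_mem:
  assumes "finite S"
  shows "cube_exp t S (\<lambda>X. \<Sum>i\<in>X. h i X) = t * (\<Sum>i\<in>S. cube_exp t S (\<lambda>X. h i (insert i X)))"
proof -
  have "cube_exp t S (\<lambda>X. \<Sum>i\<in>X. h i X) = cube_exp t S (\<lambda>X. \<Sum>i\<in>S. if i \<in> X then h i X else 0)"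
  proof (rule cube_exp_cong)
    fix X assume X: "X \<subseteq> S"
    hence "S \<inter> X = X" by auto
    thus "(\<Sum>i\<in>X. h i X) = (\<Sum>i\<in>S. if i \<in> X then h i X else 0)"
      using assms by (simp add: sum.If_cases)
  qed
  thus ?thesis using assms by (simp add: cube_exp_sum cube_exp_mem sum_distrib_left)
qed

text \<open>\<open>cube_exp (p0 / t) X u\<close> is the conditional expectation of \<open>u\<close>
  at a \<open>p0\<close>-random set, given a \<open>t\<close>-random superset \<open>X\<close> of
  it. Raising \<open>t\<close> reveals less, so by Jensen the mean of a concave function of it
  grows. In the derivative, Russo's formula contributes \<open>z\<close> and the falling sampling
  rate contributes \<open>exp (- z) - 1\<close>; their linear terms cancel and a nonnegative
  remainder is left.\<close>

lemma log_potential_has_derivative: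
  fixes u :: "'a set \<Rightarrow> real"
  assumes S: "finite S" and t: "0 < p0" "p0 \<le> t" and u: "\<And>X. 0 \<le> u X" and \<eta>: "\<eta> > 0"
  shows "((\<lambda>t. cube_exp t S (\<lambda>X. ln (cube_exp (p0 / t) X u + \<eta>))) has_real_derivative
    (\<Sum>i\<in>S. cube_exp t S (\<lambda>X. let z = pderiv_at i (\<lambda>X. ln (cube_exp (p0 / t) X u + \<eta>)) X
        in exp (- z) - 1 + z))) (at t)"
proof -
  define f where "f X = cube_exp (p0 / t) X u" for X
  define \<phi> where "\<phi> X = ln (f X + \<eta>)" for X
  have t0: "t > 0" and q: "0 \<le> p0 / t" "p0 / t \<le> 1" using t by auto
  have f0: "f X \<ge> 0" for X unfolding f_def using q u by (intro cube_exp_nonneg) auto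
  have fe: "f X + \<eta> > 0" for X using f0[of X] \<eta> by linarith
  define h where "h i X = - (1 / t) * (f X - f (X - {i})) / (f X + \<eta>)" for i X
  have "((\<lambda>t. cube_exp t S (\<lambda>X. ln (cube_exp (p0 / t) X u + \<eta>))) has_real_derivative
     ((\<Sum>i\<in>S. cube_exp t S (pderiv_at i (\<lambda>X. ln (cube_exp (p0 / t) X u + \<eta>)))) + cube_exp t S (\<lambda>X. \<Sum>i\<in>X. h i X))) (at t)"
  proof (rule cube_exp_has_derivative[OF S])
    fix X assume "X \<subseteq> S"
    hence fin: "finite X" using S finite_subset by blast
    have "((\<lambda>t. cube_exp (p0 / t) X u + \<eta>) has_real_derivative
     (- (1 / t) * (\<Sum>i\<in>X. f X - f (X - {i})))) (at t)"
      using cube_exp_thin_has_derivative[OF fin, of t p0 u] t0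
      by (auto simp: f_def intro!: derivative_eq_intros)
    from DERIV_chain2[OF DERIV_ln_divide this] fe[of X]
    have "((\<lambda>t. ln (cube_exp (p0 / t) X u + \<eta>)) has_real_derivative
       (1 / (f X + \<eta>) * (- (1 / t) * (\<Sum>i\<in>X. f X - f (X - {i}))))) (at t)"
      by (simp add: f_def)
    moreover have "1 / (f X + \<eta>) * (- (1 / t) * (\<Sum>i\<in>X. f X - f (X - {i}))) = (\<Sum>i\<in>X. h i X)"
      unfolding h_def sum_distrib_left by (rule sum.cong[OF refl]) (simp add: mult.commute)
    ultimately show "((\<lambda>t. ln (cube_exp (p0 / t) X u + \<eta>)) has_real_derivative (\<Sum>i\<in>X. h i X)) (at t)"
      by simp
  qed
  moreover have "(\<Sum>i\<in>S. cube_exp t S (pderiv_at i (\<lambda>X. ln (cube_exp (p0 / t) X u + \<eta>)))) + cube_exp t S (\<lambda>X. \<Sum>i\<in>X. h i X)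
     = (\<Sum>i\<in>S. cube_exp t S (\<lambda>X. pderiv_at i \<phi> X + t * h i (insert i X)))"
    unfolding cube_exp_sum_mem[OF S] cube_exp_add sum.distrib
    by (simp add: sum_distrib_left \<phi>_def[abs_def] f_def cube_exp_cmult[symmetric])
  \<comment> \<open>With \<open>a\<close> and \<open>b\<close> the values of
    \<open>f + \<eta>\<close> without and with \<open>i\<close>, the thinning term is
    \<open>a / b - 1\<close>, and \<open>a / b\<close> is \<open>exp (- z)\<close> precisely because
    \<open>\<phi>\<close> is a logarithm.\<close>
  moreover have "pderiv_at i \<phi> X + t * h i (insert i X) = (let z = pderiv_at i \<phi> X in exp (- z) - 1 + z)" for i X
  proof -
    define a b where "a = f (X - {i}) + \<eta>" and "b = f (insert i X) + \<eta>"
    have ab: "a > 0" "b > 0" using fe by (auto simp: a_def b_def)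
    have z: "pderiv_at i \<phi> X = ln b - ln a" by (simp add: pderiv_at_def \<phi>_def a_def b_def)
    have "exp (- (ln b - ln a)) = a / b" using ab by (simp add: exp_diff)
    moreover have "t * h i (insert i X) = (a - b) / b"
      using t0 by (simp add: h_def a_def b_def diff_divide_distrib right_diff_distrib)
    ultimately show ?thesis unfolding z Let_def using ab by (simp add: diff_divide_distrib)
  qed
  ultimately show ?thesis by (simp add: \<phi>_def[abs_def] f_def)
qed

text \<open>Growth is only linear for large positive \<open>z\<close>, which forces the minimum with
  \<open>\<bar>z\<bar>\<close>. The constant 4 comes from the middle range, where squaring
  \<open>1 - z / 2 \<le> exp (- z / 2)\<close> yields \<open>z\<^sup>2 / 4\<close>.\<close>

lemma min_abs_square_le_exp:
  fixes z :: real
  shows "min \<bar>z\<bar> (z\<^sup>2) \<le> 4 * (exp (- z) - 1 + z)"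
proof -
  consider "z \<le> 0" | "0 \<le> z" "z \<le> 2" | "2 \<le> z" by linarith
  thus ?thesis
  proof cases
    case 1
    hence "1 + (- z) + (- z)\<^sup>2 / 2 \<le> exp (- z)" by (intro exp_lower_Taylor_quadratic) auto
    hence "1 - z + z\<^sup>2 / 2 \<le> exp (- z)" by simp
    moreover have "y \<le> 4 * (e - 1 + z)" if "1 - z + y / 2 \<le> e" "0 \<le> y" for y e :: real
      using that by argo
    ultimately have "z\<^sup>2 \<le> 4 * (exp (- z) - 1 + z)" using zero_le_power2 by blast
    thus ?thesis by (rule order_trans[OF min.cobounded2])
  next
    case 2
    have "1 - z / 2 \<le> exp (- z / 2)" using exp_ge_add_one_self[of "- z / 2"] by simp
    hence "(1 - z / 2)\<^sup>2 \<le> (exp (- z / 2))\<^sup>2" using 2 by (intro power_mono) auto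
    also have "(exp (- z / 2))\<^sup>2 = exp (- z)" by (simp add: power2_eq_square flip: exp_add)
    finally show ?thesis by (simp add: power2_eq_square algebra_simps)
  next
    case 3
    have "z \<le> 4 * (e - 1 + z)" if "0 < e" for e :: real using 3 that by argo
    from this[OF exp_gt_zero] have "\<bar>z\<bar> \<le> 4 * (exp (- z) - 1 + z)" using 3 by (simp only: abs_of_nonneg)
    thus ?thesis by (rule order_trans[OF min.cobounded1])
  qed
qed

text \<open>The random subset of \<open>B \<union> Y\<close> misses \<open>B\<close> with
  probability \<open>(1 - q) ^ card B\<close>, and is then a random subset of
  \<open>Y\<close>.\<close>

lemma cube_exp_union_ge:
  assumes "finite B" "finite Y" "B \<inter> Y = {}" "0 \<le> q" "q \<le> 1" "\<And>X. 0 \<le> u X"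
  shows "(1 - q) ^ card B * cube_exp q Y u \<le> cube_exp q (B \<union> Y) u"
  using assms(1,3)
proof (induction B rule: finite_induct)
  case (insert x B)
  have x: "x \<notin> B \<union> Y" "finite (B \<union> Y)" using insert assms(2) by auto
  have "(1 - q) ^ card (insert x B) * cube_exp q Y u = (1 - q) * ((1 - q) ^ card B * cube_exp q Y u)"
    using insert by simp
  also have "\<dots> \<le> (1 - q) * cube_exp q (B \<union> Y) u"
    using insert assms by (intro mult_left_mono) auto
  also have "\<dots> \<le> q * cube_exp q (B \<union> Y) (\<lambda>X. u (insert x X)) + (1 - q) * cube_exp q (B \<union> Y) u"
    using assms by (simp add: cube_exp_nonneg)
  also have "\<dots> = cube_exp q (insert x B \<union> Y) u"
    using x by (simp add: cube_exp_insert_split)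
  finally show ?case .
qed simp

section \<open>Tail and variance estimates on the cube\<close>

lemma cube_exp_markov:
  assumes "0 \<le> p" "p \<le> 1" "a > 0" "\<And>X. X \<subseteq> S \<Longrightarrow> 0 \<le> g X"
  shows "cube_exp p S (\<lambda>X. of_bool (g X \<ge> a)) \<le> cube_exp p S g / a"
proof -
  have "cube_exp p S (\<lambda>X. of_bool (g X \<ge> a)) \<le> cube_exp p S (\<lambda>X. (1 / a) * g X)"
    using assms by (intro cube_exp_mono) (auto simp: of_bool_def)
  thus ?thesis unfolding cube_exp_cmult by simp
qed

lemma cube_exp_of_bool_ge:
  assumes "0 \<le> p" "p \<le> 1" "finite S" "\<And>X. X \<subseteq> S \<Longrightarrow> g X \<le> 1" "0 \<le> a"
  shows "cube_exp p S g - a \<le> cube_exp p S (\<lambda>X. of_bool (g X \<ge> a))"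
proof -
  have "cube_exp p S (\<lambda>X. g X - a) \<le> cube_exp p S (\<lambda>X. of_bool (g X \<ge> a))"
  proof (rule cube_exp_mono[OF assms(1,2)])
    fix X assume "X \<subseteq> S"
    thus "g X - a \<le> of_bool (g X \<ge> a)" using assms(4)[of X] assms(5) by (simp add: of_bool_def)
  qed
  thus ?thesis using assms by (simp add: cube_exp_diff cube_exp_const)
qed

text \<open>The mean is at distance at least 1/4 from one of the two ranges, and the product of the
  two probabilities is at most either of them. The cut-offs suit
  \<open>ln (f + \<eta>) / \<Lambda>\<close>, which is near -1 where \<open>f\<close> is tiny and
  near 0 where \<open>f\<close> is of constant order.\<close>

lemma cube_variance_ge:
  assumes "0 \<le> p" "p \<le> 1" "finite S"
  shows "cube_exp p S (\<lambda>X. of_bool (g X \<le> -3/4)) * cube_exp p S (\<lambda>X. of_bool (g X \<ge> -1/4)) / 16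
     \<le> cube_exp p S (\<lambda>X. (g X)\<^sup>2) - (cube_exp p S g)\<^sup>2"
proof -
  define a b m where "a = cube_exp p S (\<lambda>X. of_bool (g X \<le> -3/4))"
    and "b = cube_exp p S (\<lambda>X. of_bool (g X \<ge> -1/4))" and "m = cube_exp p S g"
  have le1: "cube_exp p S (\<lambda>X. of_bool (P X)) \<le> 1" for P
    using cube_exp_mono[of p S "\<lambda>X. of_bool (P X)" "\<lambda>_. 1"] assms by (simp add: cube_exp_const)
  have ab: "0 \<le> a" "a \<le> 1" "0 \<le> b" "b \<le> 1"
    using assms le1 by (auto simp: a_def b_def intro!: cube_exp_nonneg)
  have var: "cube_exp p S (\<lambda>X. (g X - m)\<^sup>2) = cube_exp p S (\<lambda>X. (g X)\<^sup>2) - m\<^sup>2"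
  proof -
    have "cube_exp p S (\<lambda>X. (g X - m)\<^sup>2) = cube_exp p S (\<lambda>X. (g X)\<^sup>2) + m\<^sup>2 - cube_exp p S (\<lambda>X. 2 * m * g X)"
      using assms by (simp add: power2_diff cube_exp_add cube_exp_diff cube_exp_const mult_ac)
    also have "cube_exp p S (\<lambda>X. 2 * m * g X) = 2 * m * m" by (simp only: cube_exp_cmult m_def)
    finally show ?thesis by (simp add: power2_eq_square)
  qed
  have sq: "1/16 \<le> y\<^sup>2" if "\<bar>y\<bar> \<ge> 1/4" for y :: real
    using power_mono[OF that, of 2] by (simp add: power2_eq_square)
  have "a * b \<le> a" "a * b \<le> b" using ab by (auto intro: mult_left_le mult_left_le_one_le)
  moreover have "a / 16 \<le> cube_exp p S (\<lambda>X. (g X - m)\<^sup>2) \<or> b / 16 \<le> cube_exp p S (\<lambda>X. (g X - m)\<^sup>2)"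
  proof (cases "m \<ge> -1/2")
    case True
    have "cube_exp p S (\<lambda>X. 1/16 * of_bool (g X \<le> -3/4)) \<le> cube_exp p S (\<lambda>X. (g X - m)\<^sup>2)"
      using assms True by (intro cube_exp_mono) (auto simp: of_bool_def intro!: sq[simplified])
    thus ?thesis by (simp only: cube_exp_cmult a_def) simp
  next
    case False
    have "cube_exp p S (\<lambda>X. 1/16 * of_bool (g X \<ge> -1/4)) \<le> cube_exp p S (\<lambda>X. (g X - m)\<^sup>2)"
      using assms False by (intro cube_exp_mono) (auto simp: of_bool_def intro!: sq[simplified])
    thus ?thesis by (simp only: cube_exp_cmult b_def) simp
  qed
  ultimately show ?thesis unfolding var a_def[symmetric] b_def[symmetric] m_def[symmetric] by linarith
qed

text \<open>Mean value theorem: the potential lies between \<open>ln \<eta>\<close> and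
  \<open>ln (1 + \<eta>)\<close>, so at some \<open>t\<close> its slope is at most the average
  slope. Nothing more is known about \<open>t\<close>, so later estimates must be uniform over the
  interval.\<close>

lemma log_potential_energy:
  fixes u :: "'a set \<Rightarrow> real"
  assumes S: "finite S" and p: "0 < p0" "p0 \<le> pm" "pm < p1" "p1 \<le> 1"
    and u: "\<And>X. 0 \<le> u X" "\<And>X. u X \<le> 1" and \<eta>: "\<eta> > 0"
  obtains t where "pm < t" "t < p1"
    "(\<Sum>i\<in>S. cube_exp t S (\<lambda>X. let z = pderiv_at i (\<lambda>X. ln (cube_exp (p0 / t) X u + \<eta>)) X
        in min \<bar>z\<bar> (z\<^sup>2))) \<le> 4 * ln (1 + 1 / \<eta>) / (p1 - pm)"
proof -
  define G where "G t = cube_exp t S (\<lambda>X. ln (cube_exp (p0 / t) X u + \<eta>))" for t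
  define G' where "G' t = (\<Sum>i\<in>S. cube_exp t S (\<lambda>X. let z = pderiv_at i (\<lambda>X. ln (cube_exp (p0 / t) X u + \<eta>)) X
        in exp (- z) - 1 + z))" for t
  have deriv: "(G has_real_derivative G' t) (at t)" if "pm \<le> t" for t
    unfolding G_def G'_def using p that by (intro log_potential_has_derivative S u \<eta>) auto
  obtain t where t: "t > pm" "t < p1" "G p1 - G pm = (p1 - pm) * G' t"
    using MVT2[of pm p1 G G'] deriv p by (metis (no_types, lifting))
  have bd: "ln \<eta> \<le> G s \<and> G s \<le> ln (1 + \<eta>)" if "pm \<le> s" "s \<le> p1" for s
  proof -
    have q: "0 \<le> p0 / s" "p0 / s \<le> 1" using that p by auto
    have s: "0 \<le> s" "s \<le> 1" using that p by auto
    have 1: "ln \<eta> \<le> ln (cube_exp (p0 / s) X u + \<eta>) \<and> ln (cube_exp (p0 / s) X u + \<eta>) \<le> ln (1 + \<eta>)"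
      if "X \<subseteq> S" for X
    proof -
      have "finite X" using that S finite_subset by blast
      hence "0 \<le> cube_exp (p0 / s) X u" "cube_exp (p0 / s) X u \<le> 1"
        using q u cube_exp_mono[OF q, of X u "\<lambda>_. 1"] by (auto intro!: cube_exp_nonneg simp: cube_exp_const)
      thus ?thesis using \<eta> by auto
    qed
    have "cube_exp s S (\<lambda>_. ln \<eta>) \<le> G s" "G s \<le> cube_exp s S (\<lambda>_. ln (1 + \<eta>))"
      unfolding G_def using 1 by (auto intro!: cube_exp_mono s)
    thus ?thesis using S by (simp add: cube_exp_const)
  qed
  have "(p1 - pm) * G' t \<le> ln (1 + \<eta>) - ln \<eta>" using bd[of p1] bd[of pm] p t(3) by linarith
  also have "\<dots> = ln ((1 + \<eta>) / \<eta>)" using \<eta> by (simp add: ln_div)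
  also have "(1 + \<eta>) / \<eta> = 1 + 1 / \<eta>" using \<eta> by (simp add: field_simps)
  finally have Gt: "G' t \<le> ln (1 + 1 / \<eta>) / (p1 - pm)" using p by (simp add: pos_le_divide_eq mult.commute)
  have "(\<Sum>i\<in>S. cube_exp t S (\<lambda>X. let z = pderiv_at i (\<lambda>X. ln (cube_exp (p0 / t) X u + \<eta>)) X
        in min \<bar>z\<bar> (z\<^sup>2))) \<le> (\<Sum>i\<in>S. cube_exp t S (\<lambda>X. 4 * (let z = pderiv_at i (\<lambda>X. ln (cube_exp (p0 / t) X u + \<eta>)) X
        in exp (- z) - 1 + z)))"
    unfolding Let_def using t p by (intro sum_mono cube_exp_mono min_abs_square_le_exp) auto
  also have "\<dots> = 4 * G' t" by (simp only: cube_exp_cmult G'_def sum_distrib_left)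
  also have "\<dots> \<le> 4 * ln (1 + 1 / \<eta>) / (p1 - pm)" using Gt by simp
  finally show ?thesis using t that by blast
qed

text \<open>After division by \<open>\<Lambda>\<close> the total L2 energy is at most
  \<open>K\<close>, and the squared L1 influences outside \<open>J\<close> sum to at most
  \<open>2 * (1 / \<Lambda> + \<tau>) * K\<close>. The factor \<open>exp (2 * M)\<close> is then
  harmless once \<open>\<Lambda>\<close> is large and \<open>\<tau>\<close> small.\<close>

lemma junta_approximation:
  fixes \<phi> :: "'a set \<Rightarrow> real"
  assumes S: "finite S" and t: "0 < t" "t < 1"
    and \<Lambda>: "\<Lambda> \<ge> 1" and D: "\<And>i X. i \<in> S \<Longrightarrow> X \<subseteq> S \<Longrightarrow> \<bar>pderiv_at i \<phi> X\<bar> \<le> \<Lambda>"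
    and m: "\<And>i. m i = cube_exp t S (\<lambda>X. min \<bar>pderiv_at i \<phi> X\<bar> ((pderiv_at i \<phi> X)\<^sup>2))"
    and K: "(\<Sum>i\<in>S. m i) \<le> K * \<Lambda>" and \<tau>: "\<tau> \<ge> 0" and M: "M \<ge> 0"
    and J: "J = {i\<in>S. m i > \<tau> * \<Lambda>}"
  shows "(M + 1/2) * (cube_exp t S (\<lambda>X. (\<phi> X / \<Lambda>)\<^sup>2) - cube_exp t S (\<lambda>X. (avg_over t (S - J) (\<lambda>X. \<phi> X / \<Lambda>) X)\<^sup>2))
     \<le> K + exp (2 * M) * K * (1 / \<Lambda> + \<tau>)"
proof -
  have t': "0 \<le> t" "t \<le> 1" using t by auto
  define \<psi> where "\<psi> X = \<phi> X / \<Lambda>" for X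
  have D\<psi>: "pderiv_at i \<psi> X = pderiv_at i \<phi> X / \<Lambda>" for i X
    by (simp add: pderiv_at_def \<psi>_def diff_divide_distrib)
  have m0: "m i \<ge> 0" for i unfolding m using t' by (intro cube_exp_nonneg) auto
  \<comment> \<open>No increment exceeds \<open>\<Lambda>\<close>, so
    \<open>z\<^sup>2 \<le> \<Lambda> * min \<bar>z\<bar> (z\<^sup>2)\<close>: linear control of the
    large increments is enough.\<close>
  have L2: "cube_exp t S (\<lambda>X. (pderiv_at i \<psi> X)\<^sup>2) \<le> (1 / \<Lambda>) * m i" if i: "i \<in> S" for i
  proof -
    have "cube_exp t S (\<lambda>X. (pderiv_at i \<psi> X)\<^sup>2) \<le>
        cube_exp t S (\<lambda>X. (1 / \<Lambda>) * min \<bar>pderiv_at i \<phi> X\<bar> ((pderiv_at i \<phi> X)\<^sup>2))"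
    proof (rule cube_exp_mono[OF t'])
      fix X assume "X \<subseteq> S"
      define z where "z = pderiv_at i \<phi> X"
      have z: "\<bar>z\<bar> \<le> \<Lambda>" unfolding z_def by (rule D[OF i \<open>X \<subseteq> S\<close>])
      have "z\<^sup>2 \<le> \<Lambda> * \<bar>z\<bar>"
        using mult_right_mono[OF z, of "\<bar>z\<bar>"] by (simp add: power2_eq_square)
      moreover have "z\<^sup>2 \<le> \<Lambda> * z\<^sup>2" using \<Lambda> mult_right_mono[of 1 \<Lambda> "z\<^sup>2"] by simp
      ultimately have "z\<^sup>2 \<le> \<Lambda> * min \<bar>z\<bar> (z\<^sup>2)" by (simp add: min_def)
      hence "z\<^sup>2 / \<Lambda>\<^sup>2 \<le> \<Lambda> * min \<bar>z\<bar> (z\<^sup>2) / \<Lambda>\<^sup>2" by (intro divide_right_mono) auto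
      thus "(pderiv_at i \<psi> X)\<^sup>2 \<le> (1 / \<Lambda>) * min \<bar>pderiv_at i \<phi> X\<bar> ((pderiv_at i \<phi> X)\<^sup>2)"
        using \<Lambda> unfolding D\<psi> z_def[symmetric] by (simp add: power_divide power2_eq_square)
    qed
    thus ?thesis by (simp only: cube_exp_cmult m)
  qed
  \<comment> \<open>Increments up to 1 are bounded through their second moment. The larger ones have
    L1 norm at most \<open>m i\<close>, and one factor of its square is replaced by
    \<open>\<tau> * \<Lambda>\<close>, as \<open>i\<close> is outside \<open>J\<close>.\<close>
  have L1: "(cube_exp t S (\<lambda>X. \<bar>pderiv_at i \<psi> X\<bar>))\<^sup>2 \<le> (2 / \<Lambda>) * (1 / \<Lambda> + \<tau>) * m i" if i: "i \<in> S - J" for i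
  proof -
    define s b where "s X = (if \<bar>pderiv_at i \<phi> X\<bar> \<le> 1 then \<bar>pderiv_at i \<phi> X\<bar> else 0)"
      and "b X = (if \<bar>pderiv_at i \<phi> X\<bar> \<le> 1 then 0 else \<bar>pderiv_at i \<phi> X\<bar>)" for X
    have sq: "y\<^sup>2 \<le> \<bar>y\<bar>" if "\<bar>y\<bar> \<le> 1" for y :: real
      using mult_left_le[OF that, of "\<bar>y\<bar>"] by (simp add: power2_eq_square)
    have sq': "\<bar>y\<bar> \<le> y\<^sup>2" if "\<not> \<bar>y\<bar> \<le> 1" for y :: real
      using mult_left_mono[of 1 "\<bar>y\<bar>" "\<bar>y\<bar>"] that by (simp add: power2_eq_square)
    have s: "(cube_exp t S s)\<^sup>2 \<le> m i"
    proof -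
      have "(cube_exp t S s)\<^sup>2 \<le> cube_exp t S (\<lambda>X. (s X)\<^sup>2)" by (rule cube_exp_square_le[OF t' S])
      also have "\<dots> \<le> m i" unfolding m by (intro cube_exp_mono t') (auto simp: s_def sq)
      finally show ?thesis .
    qed
    have b0: "0 \<le> cube_exp t S b" by (intro cube_exp_nonneg t') (auto simp: b_def)
    have b: "cube_exp t S b \<le> m i" unfolding m by (intro cube_exp_mono t') (auto simp: b_def sq')
    have "(cube_exp t S b)\<^sup>2 \<le> m i * m i" unfolding power2_eq_square by (intro mult_mono b b0 m0)
    also have "\<dots> \<le> \<tau> * \<Lambda> * m i" using i by (intro mult_right_mono m0) (auto simp: J)
    finally have b2: "(cube_exp t S b)\<^sup>2 \<le> \<tau> * \<Lambda> * m i" .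
    have "cube_exp t S (\<lambda>X. \<bar>pderiv_at i \<psi> X\<bar>) = cube_exp t S (\<lambda>X. (1 / \<Lambda>) * (s X + b X))"
      using \<Lambda> by (intro cube_exp_cong) (auto simp: D\<psi> s_def b_def)
    also have "\<dots> = (1 / \<Lambda>) * (cube_exp t S s + cube_exp t S b)"
      by (simp only: cube_exp_cmult cube_exp_add)
    finally have "(cube_exp t S (\<lambda>X. \<bar>pderiv_at i \<psi> X\<bar>))\<^sup>2 = (1 / \<Lambda>\<^sup>2) * (cube_exp t S s + cube_exp t S b)\<^sup>2"
      by (simp add: power_divide)
    also have "\<dots> \<le> (1 / \<Lambda>\<^sup>2) * (2 * (m i + \<tau> * \<Lambda> * m i))"
    proof (intro mult_left_mono)
      have "(cube_exp t S s + cube_exp t S b)\<^sup>2 \<le> 2 * ((cube_exp t S s)\<^sup>2 + (cube_exp t S b)\<^sup>2)"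
        using zero_le_power2[of "cube_exp t S s - cube_exp t S b"]
        by (simp add: power2_eq_square algebra_simps)
      thus "(cube_exp t S s + cube_exp t S b)\<^sup>2 \<le> 2 * (m i + \<tau> * \<Lambda> * m i)"
        by (rule order_trans) (intro mult_left_mono add_mono s b2, simp)
    qed simp
    also have "\<dots> = (2 / \<Lambda>) * (1 / \<Lambda> + \<tau>) * m i"
      using \<Lambda> by (simp add: field_simps power2_eq_square)
    finally show ?thesis .
  qed
  have K': "(1 / \<Lambda>) * (\<Sum>i\<in>S. m i) \<le> K"
    using K \<Lambda> by (simp add: field_simps)
  have "(M + 1/2) * (cube_exp t S (\<lambda>X. (\<psi> X)\<^sup>2) - cube_exp t S (\<lambda>X. (avg_over t (S - J) \<psi> X)\<^sup>2))
    \<le> (\<Sum>i\<in>S. cube_exp t S (\<lambda>X. (pderiv_at i \<psi> X)\<^sup>2))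
      + 1/2 * exp (2 * M) * (\<Sum>i\<in>S - J. (cube_exp t S (\<lambda>X. \<bar>pderiv_at i \<psi> X\<bar>))\<^sup>2)"
    by (rule falik_samorodnitsky) (use S t in auto)
  also have "(\<Sum>i\<in>S. cube_exp t S (\<lambda>X. (pderiv_at i \<psi> X)\<^sup>2)) \<le> (\<Sum>i\<in>S. (1 / \<Lambda>) * m i)"
    by (intro sum_mono L2)
  also have "\<dots> = (1 / \<Lambda>) * (\<Sum>i\<in>S. m i)" by (simp only: sum_distrib_left)
  also have "\<dots> \<le> K" by (rule K')
  also have "(\<Sum>i\<in>S - J. (cube_exp t S (\<lambda>X. \<bar>pderiv_at i \<psi> X\<bar>))\<^sup>2) \<le> (\<Sum>i\<in>S - J. (2 / \<Lambda>) * (1 / \<Lambda> + \<tau>) * m i)"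
    by (intro sum_mono L1)
  also have "\<dots> = (2 * (1 / \<Lambda> + \<tau>)) * ((1 / \<Lambda>) * (\<Sum>i\<in>S - J. m i))"
    unfolding sum_distrib_left by (rule sum.cong[OF refl]) simp
  also have "\<dots> \<le> (2 * (1 / \<Lambda> + \<tau>)) * K"
  proof (intro mult_left_mono)
    have "(\<Sum>i\<in>S - J. m i) \<le> (\<Sum>i\<in>S. m i)" using S m0 by (intro sum_mono2) auto
    thus "(1 / \<Lambda>) * (\<Sum>i\<in>S - J. m i) \<le> K" using K' \<Lambda>
      by (meson mult_left_mono order_trans zero_le_divide_1_iff zero_le_one)
  qed (use \<Lambda> \<tau> in auto)
  finally have "(M + 1/2) * (cube_exp t S (\<lambda>X. (\<psi> X)\<^sup>2) - cube_exp t S (\<lambda>X. (avg_over t (S - J) \<psi> X)\<^sup>2))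
    \<le> K + 1/2 * exp (2 * M) * (2 * (1 / \<Lambda> + \<tau>) * K)" by simp
  also have "\<dots> = K + exp (2 * M) * K * (1 / \<Lambda> + \<tau>)" by (simp add: algebra_simps)
  finally show ?thesis by (simp only: \<psi>_def[abs_def])
qed

section \<open>A sharp threshold theorem\<close>

text \<open>Over \<open>S - J\<close> the mean of the thinned function is that of \<open>u\<close>
  at a \<open>p0\<close>-random subset of \<open>S - J\<close>, so it is at least \<open>e\<close>
  with probability at least \<open>e\<close>. Restoring the part of \<open>X\<close> inside
  \<open>J\<close> costs at most the probability of missing that part, whatever the part is; hence
  one bound for all fibres.\<close>

lemma fiber_lower_bound:
  fixes u :: "'a set \<Rightarrow> real"
  assumes S: "finite S" "J \<subseteq> S" "X \<subseteq> S" and t: "0 < p0" "p0 < t" "t \<le> 1"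
    and u: "\<And>X. 0 \<le> u X" "\<And>X. u X \<le> 1"
    and e: "0 \<le> e" "2 * e \<le> cube_exp p0 (S - J) u"
    and \<zeta>: "\<zeta> \<le> (1 - p0 / t) ^ card J * e"
  shows "e \<le> cube_exp t (S - J) (\<lambda>Y. of_bool (\<zeta> \<le> cube_exp (p0 / t) ((X - (S - J)) \<union> Y) u))"
proof -
  have q: "0 \<le> p0 / t" "p0 / t \<le> 1" and t': "0 \<le> t" "t \<le> 1" using t by auto
  have finT: "finite (S - J)" using S by auto
  have fJ: "finite J" using S finite_subset by blast
  have "2 * e \<le> cube_exp (t * (p0 / t)) (S - J) u" using e t by simp
  also have "\<dots> = cube_exp t (S - J) (\<lambda>Y. cube_exp (p0 / t) Y u)"
    using cube_exp_compose[OF finT] by metis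
  finally have "e \<le> cube_exp t (S - J) (\<lambda>Y. cube_exp (p0 / t) Y u) - e" by simp
  also have "\<dots> \<le> cube_exp t (S - J) (\<lambda>Y. of_bool (cube_exp (p0 / t) Y u \<ge> e))"
  proof (rule cube_exp_of_bool_ge[OF t' finT _ e(1)])
    fix Y assume "Y \<subseteq> S - J"
    hence "finite Y" using finT finite_subset by blast
    thus "cube_exp (p0 / t) Y u \<le> 1"
      using cube_exp_mono[OF q, of Y u "\<lambda>_. 1"] u by (simp add: cube_exp_const)
  qed
  also have "\<dots> \<le> cube_exp t (S - J) (\<lambda>Y. of_bool (\<zeta> \<le> cube_exp (p0 / t) ((X - (S - J)) \<union> Y) u))"
  proof (rule cube_exp_mono[OF t'])
    fix Y assume Y: "Y \<subseteq> S - J"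
    have BJ: "X - (S - J) \<subseteq> J" using S by auto
    have "\<zeta> \<le> cube_exp (p0 / t) ((X - (S - J)) \<union> Y) u" if ge: "cube_exp (p0 / t) Y u \<ge> e"
    proof -
      have "\<zeta> \<le> (1 - p0 / t) ^ card J * e" by (rule \<zeta>)
      also have "\<dots> \<le> (1 - p0 / t) ^ card (X - (S - J)) * cube_exp (p0 / t) Y u"
        using q e ge BJ fJ by (intro mult_mono power_decreasing card_mono) auto
      also have "\<dots> \<le> cube_exp (p0 / t) ((X - (S - J)) \<union> Y) u"
        using finite_subset[OF BJ fJ] finite_subset[OF Y finT] Y q u
        by (intro cube_exp_union_ge) auto
      finally show ?thesis .
    qed
    thus "of_bool (cube_exp (p0 / t) Y u \<ge> e) \<le> (of_bool (\<zeta> \<le> cube_exp (p0 / t) ((X - (S - J)) \<union> Y) u) :: real)"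
      by (simp add: of_bool_def)
  qed
  finally show ?thesis .
qed

text \<open>By contradiction, estimating the variance \<open>V\<close> of \<open>\<psi>\<close> not
  explained by \<open>J\<close> in two ways. The junta approximation gives
  \<open>(M + 1/2) * V \<le> K + 2\<close>. On the other hand \<open>\<psi> \<ge> -1/4\<close> has
  probability at least \<open>e\<close> on every fibre, while \<open>\<psi> \<le> -3/4\<close> has
  total probability at least \<open>\<kappa> / 2\<close>, which gives
  \<open>V \<ge> e * \<kappa> / 32\<close>.\<close>

theorem sharp_threshold:
  fixes p0 pm p1 \<kappa> e :: real
  assumes p: "0 < p0" "p0 < pm" "pm < p1" "p1 < 1" and \<kappa>: "\<kappa> > 0" and e: "e > 0"
  obtains r \<eta>1 where "\<eta>1 > 0"
    "\<And>(S :: 'a set) u. finite S \<Longrightarrow> (\<And>X. 0 \<le> u X) \<Longrightarrow> (\<And>X. u X \<le> 1) \<Longrightarrow>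
       (\<And>J. J \<subseteq> S \<Longrightarrow> card J \<le> r \<Longrightarrow> 2 * e \<le> cube_exp p0 (S - J) u) \<Longrightarrow>
       cube_exp p1 S (\<lambda>X. of_bool (cube_exp (p0 / p1) X u < \<eta>1)) < \<kappa>"
proof -
  define K where "K = 4 / (p1 - pm)"
  have K: "K > 0" using p by (simp add: K_def)
  \<comment> \<open>Chosen so that \<open>M * (e * \<kappa> / 32)\<close> equals
    \<open>4 * (K + 2)\<close>, which exceeds the upper bound \<open>K + 2\<close>.\<close>
  define M where "M = (K + 2) * 128 / (e * \<kappa>)"
  have M: "M > 0" using K e \<kappa> by (simp add: M_def)
  define A where "A = exp (2 * M) * K"
  have A: "A > 0" using K by (simp add: A_def)
  define \<tau> where "\<tau> = 1 / A"
  have \<tau>: "\<tau> > 0" using A by (simp add: \<tau>_def)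
  \<comment> \<open>Total energy \<open>K * \<Lambda>\<close> over the threshold
    \<open>\<tau> * \<Lambda>\<close>: a bound on \<open>card J\<close> fixed before
    \<open>\<Lambda>\<close> is.\<close>
  define r where "r = nat \<lceil>K / \<tau>\<rceil>"
  \<comment> \<open>As \<open>t > pm\<close>, the rate \<open>p0 / t\<close> stays below
    \<open>q < 1\<close>, so a set of \<open>r\<close> points is missed with probability bounded
    below uniformly in \<open>t\<close>.\<close>
  define q where "q = p0 / pm"
  have q: "0 < q" "q < 1" using p by (auto simp: q_def)
  define \<zeta> where "\<zeta> = (1 - q) ^ r * e"
  have \<zeta>: "\<zeta> > 0" using q e by (simp add: \<zeta>_def)
  \<comment> \<open>The 8 makes \<open>exp (\<Lambda> / 4) \<ge> 4\<close>, \<open>A\<close> makes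
    the term \<open>A / \<Lambda>\<close> at most 1, and the last entry puts
    \<open>ln \<zeta>\<close> above \<open>- \<Lambda> / 4\<close>.\<close>
  define \<Lambda> where "\<Lambda> = max 8 (max A (4 * ln (1 / \<zeta>)))"
  have \<Lambda>: "\<Lambda> \<ge> 8" "\<Lambda> \<ge> A" "\<Lambda> \<ge> 4 * ln (1 / \<zeta>)" by (auto simp: \<Lambda>_def)
  \<comment> \<open>The solution of \<open>ln (1 + 1 / \<eta>) = \<Lambda>\<close>.\<close>
  define \<eta> where "\<eta> = 1 / (exp \<Lambda> - 1)"
  have e8: "exp \<Lambda> \<ge> 9" using exp_ge_add_one_self[of \<Lambda>] \<Lambda> by linarith
  have \<eta>: "\<eta> > 0" "\<eta> \<le> 1/2" using e8 unfolding \<eta>_def by (simp_all only: zero_less_divide_1_iff pos_divide_le_eq) argo+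
  have \<Lambda>\<eta>: "ln (1 + 1 / \<eta>) = \<Lambda>" by (simp add: \<eta>_def)
  have ln2\<eta>: "ln (2 * \<eta>) \<le> -3/4 * \<Lambda>"
  proof -
    have "exp (\<Lambda> / 4) \<ge> 4"
    proof -
      have "exp (\<Lambda> / 4) = (exp (\<Lambda> / 8))\<^sup>2" by (simp add: power2_eq_square flip: exp_add)
      moreover have "exp (\<Lambda> / 8) \<ge> 2" using exp_ge_add_one_self[of "\<Lambda> / 8"] \<Lambda> by linarith
      hence "(exp (\<Lambda> / 8))\<^sup>2 \<ge> 2\<^sup>2" by (intro power_mono) auto
      ultimately show ?thesis by simp
    qed
    have "\<eta> \<le> 1 / (exp \<Lambda> / 2)"
      unfolding \<eta>_def using e8 \<Lambda>(1) by (intro divide_left_mono mult_pos_pos) auto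
    hence "2 * \<eta> \<le> 4 / exp \<Lambda>" by simp
    also have "\<dots> \<le> exp (\<Lambda> / 4) / exp \<Lambda>" using \<open>exp (\<Lambda> / 4) \<ge> 4\<close> by (intro divide_right_mono) auto
    also have "\<dots> = exp (-3/4 * \<Lambda>)" by (simp flip: exp_diff)
    finally have "ln (2 * \<eta>) \<le> ln (exp (-3/4 * \<Lambda>))" using \<eta> by (subst ln_le_cancel_iff) auto
    thus ?thesis by simp
  qed
  have main: "cube_exp p1 S (\<lambda>X. of_bool (cube_exp (p0 / p1) X u < \<eta>\<^sup>2)) < \<kappa>"
    if S: "finite S" and u: "\<And>X. 0 \<le> u X" "\<And>X. u X \<le> 1"
      and low: "\<And>J. J \<subseteq> S \<Longrightarrow> card J \<le> r \<Longrightarrow> 2 * e \<le> cube_exp p0 (S - J) u"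
    for S :: "'a set" and u
  proof (rule ccontr)
    assume "\<not> ?thesis"
    hence big: "\<kappa> \<le> cube_exp p1 S (\<lambda>X. of_bool (cube_exp (p0 / p1) X u < \<eta>\<^sup>2))" by simp
    obtain t where t: "pm < t" "t < p1" and energy:
      "(\<Sum>i\<in>S. cube_exp t S (\<lambda>X. let z = pderiv_at i (\<lambda>X. ln (cube_exp (p0 / t) X u + \<eta>)) X
        in min \<bar>z\<bar> (z\<^sup>2))) \<le> 4 * ln (1 + 1 / \<eta>) / (p1 - pm)"
      by (rule log_potential_energy[OF S p(1) less_imp_le[OF p(2)] p(3) less_imp_le[OF p(4)] u \<eta>(1)])
         (rule that)
    have t': "0 \<le> t" "t \<le> 1" "0 < t" "t < 1" using t p by auto
    have qt: "0 \<le> p0 / t" "p0 / t \<le> q"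
      using t p by (auto simp: q_def intro!: divide_left_mono)
    hence qt1: "p0 / t \<le> 1" using q by simp
    define f where "f X = cube_exp (p0 / t) X u" for X
    have f: "0 \<le> f X" "X \<subseteq> S \<Longrightarrow> f X \<le> 1" for X
    proof -
      show "0 \<le> f X" unfolding f_def by (intro cube_exp_nonneg qt(1) qt1 u)
      assume "X \<subseteq> S"
      hence "finite X" using S finite_subset by blast
      thus "f X \<le> 1" unfolding f_def
        using cube_exp_mono[OF qt(1) qt1, of X u "\<lambda>_. 1"] u by (simp add: cube_exp_const)
    qed
    define \<phi> where "\<phi> X = ln (f X + \<eta>)" for X
    have \<phi>: "ln \<eta> \<le> \<phi> X" "X \<subseteq> S \<Longrightarrow> \<phi> X \<le> ln (1 + \<eta>)" for X
    proof -
      show "ln \<eta> \<le> \<phi> X" unfolding \<phi>_def using f(1)[of X] \<eta> by (subst ln_le_cancel_iff) auto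
      assume "X \<subseteq> S"
      thus "\<phi> X \<le> ln (1 + \<eta>)" unfolding \<phi>_def using f[of X] \<eta> by (subst ln_le_cancel_iff) auto
    qed
    have ln_diff: "ln (1 + \<eta>) - ln \<eta> = \<Lambda>"
    proof -
      have "ln (1 + \<eta>) - ln \<eta> = ln ((1 + \<eta>) / \<eta>)" using \<eta> by (simp add: ln_div)
      also have "(1 + \<eta>) / \<eta> = 1 + 1 / \<eta>" using \<eta> by (simp add: field_simps)
      finally show ?thesis using \<Lambda>\<eta> by simp
    qed
    have D: "\<bar>pderiv_at i \<phi> X\<bar> \<le> \<Lambda>" if "i \<in> S" "X \<subseteq> S" for i X
    proof -
      have "insert i X \<subseteq> S" "X - {i} \<subseteq> S" using that by auto
      thus ?thesis unfolding pderiv_at_def ln_diff[symmetric]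
        using \<phi>(1)[of "insert i X"] \<phi>(1)[of "X - {i}"] \<phi>(2)[of "insert i X"] \<phi>(2)[of "X - {i}"] by auto
    qed
    define m where "m i = cube_exp t S (\<lambda>X. min \<bar>pderiv_at i \<phi> X\<bar> ((pderiv_at i \<phi> X)\<^sup>2))" for i
    have m0: "m i \<ge> 0" for i unfolding m_def by (intro cube_exp_nonneg t') auto
    have mK: "(\<Sum>i\<in>S. m i) \<le> K * \<Lambda>"
      using energy unfolding \<Lambda>\<eta> by (simp add: m_def \<phi>_def[abs_def] f_def Let_def K_def)
    define J where "J = {i\<in>S. m i > \<tau> * \<Lambda>}"
    have JS: "J \<subseteq> S" by (auto simp: J_def)
    have cJ: "card J \<le> r"
    proof -
      have "real (card J) * (\<tau> * \<Lambda>) \<le> (\<Sum>i\<in>J. m i)"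
        using sum_bounded_below[of J "\<tau> * \<Lambda>" m] by (auto simp: J_def)
      also have "\<dots> \<le> (\<Sum>i\<in>S. m i)" using S m0 JS by (intro sum_mono2) auto
      also have "\<dots> \<le> K * \<Lambda>" by (rule mK)
      finally have "real (card J) * \<tau> \<le> K" using \<Lambda> by simp
      hence "real (card J) \<le> K / \<tau>" using \<tau> by (simp add: pos_le_divide_eq)
      thus ?thesis unfolding r_def by linarith
    qed
    define \<psi> where "\<psi> X = \<phi> X / \<Lambda>" for X
    define V where "V = cube_exp t S (\<lambda>X. (\<psi> X)\<^sup>2) - cube_exp t S (\<lambda>X. (avg_over t (S - J) \<psi> X)\<^sup>2)"
    have "(M + 1/2) * V \<le> K + exp (2 * M) * K * (1 / \<Lambda> + \<tau>)"
      unfolding V_def \<psi>_def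
      by (rule junta_approximation[OF S t'(3,4) _ D m_def mK _ _ J_def]) (use \<Lambda> \<tau> M in auto)
    also have "exp (2 * M) * K * (1 / \<Lambda> + \<tau>) = A / \<Lambda> + A * \<tau>"
      by (simp add: A_def distrib_left)
    also have "A / \<Lambda> \<le> 1" using \<Lambda> by simp
    also have "A * \<tau> = 1" using A by (simp add: \<tau>_def)
    finally have V1: "(M + 1/2) * V \<le> K + 2" by simp
    define bad where "bad X = (of_bool (\<psi> X \<le> -3/4) :: real)" for X
    \<comment> \<open>Transfer from \<open>p1\<close> to the uncontrolled \<open>t\<close>: thinning
      a \<open>p1\<close>-random \<open>X\<close> at rate \<open>t / p1\<close> preserves the mean
      of \<open>f\<close>. If this mean is below \<open>\<eta>\<^sup>2\<close>, then by Markov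
      \<open>f < \<eta>\<close> with probability at least \<open>1 - \<eta>\<close>. This is why the
      threshold in the conclusion is a square.\<close>
    have badS: "\<kappa> / 2 \<le> cube_exp t S bad"
    proof -
      have r1: "0 \<le> t / p1" "t / p1 \<le> 1" using t p by auto
      have p1': "0 \<le> p1" "p1 \<le> 1" using p by auto
      have "(1 - \<eta>) * \<kappa> \<le> (1 - \<eta>) * cube_exp p1 S (\<lambda>X. of_bool (cube_exp (p0 / p1) X u < \<eta>\<^sup>2))"
        using big \<eta> by (intro mult_left_mono) auto
      also have "\<dots> = cube_exp p1 S (\<lambda>X. (1 - \<eta>) * of_bool (cube_exp (p0 / p1) X u < \<eta>\<^sup>2))"
        by (simp only: cube_exp_cmult)
      also have "\<dots> \<le> cube_exp p1 S (\<lambda>X. cube_exp (t / p1) X bad)"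
      proof (rule cube_exp_mono[OF p1'])
        fix X assume X: "X \<subseteq> S"
        hence fX: "finite X" using S finite_subset by blast
        show "(1 - \<eta>) * of_bool (cube_exp (p0 / p1) X u < \<eta>\<^sup>2) \<le> cube_exp (t / p1) X bad"
        proof (cases "cube_exp (p0 / p1) X u < \<eta>\<^sup>2")
          case False
          thus ?thesis by (auto intro!: cube_exp_nonneg r1 simp: bad_def)
        next
          case True
          have "cube_exp (t / p1) X f = cube_exp (t / p1 * (p0 / t)) X u"
            unfolding f_def by (rule cube_exp_compose[OF fX])
          also have "t / p1 * (p0 / t) = p0 / p1" using t' by simp
          finally have fl: "cube_exp (t / p1) X f < \<eta>\<^sup>2" using True by simp
          have "cube_exp (t / p1) X (\<lambda>Y. of_bool (f Y \<ge> \<eta>)) \<le> cube_exp (t / p1) X f / \<eta>"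
            by (rule cube_exp_markov[OF r1 \<eta>(1) f(1)])
          also have "\<dots> \<le> \<eta>" using fl \<eta> by (simp add: pos_divide_le_eq power2_eq_square)
          finally have "1 - \<eta> \<le> cube_exp (t / p1) X (\<lambda>_. 1) - cube_exp (t / p1) X (\<lambda>Y. of_bool (f Y \<ge> \<eta>))"
            using fX by (simp add: cube_exp_const)
          also have "\<dots> = cube_exp (t / p1) X (\<lambda>Y. 1 - of_bool (f Y \<ge> \<eta>))" by (simp only: cube_exp_diff)
          also have "\<dots> \<le> cube_exp (t / p1) X bad"
          proof (rule cube_exp_mono[OF r1])
            fix Y assume "Y \<subseteq> X"
            have "\<psi> Y \<le> -3/4" if "f Y < \<eta>"
            proof -
              have "\<phi> Y \<le> ln (2 * \<eta>)" unfolding \<phi>_def using that f(1)[of Y] \<eta> by (subst ln_le_cancel_iff) auto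
              also note ln2\<eta>
              finally show ?thesis using \<Lambda> by (simp add: \<psi>_def pos_divide_le_eq)
            qed
            thus "1 - of_bool (f Y \<ge> \<eta>) \<le> bad Y" by (auto simp: bad_def of_bool_def)
          qed
          finally show ?thesis using True by simp
        qed
      qed
      also have "\<dots> = cube_exp t S bad" using cube_exp_compose[OF S, of p1 "t / p1" bad] p by simp
      finally have "(1 - \<eta>) * \<kappa> \<le> cube_exp t S bad" .
      moreover have "1/2 * \<kappa> \<le> (1 - \<eta>) * \<kappa>" using \<eta> \<kappa> by (intro mult_right_mono) auto
      ultimately show ?thesis by simp
    qed
    have TS: "S - J \<subseteq> S" and finT: "finite (S - J)" using S by auto
    \<comment> \<open>\<open>cube_variance_ge\<close> is applied inside each fibre over
      \<open>J\<close> and the results are averaged; the mean conditional variance is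
      \<open>V\<close>.\<close>
    have "e / 16 * (\<kappa> / 2) \<le> e / 16 * cube_exp t S bad" using badS e by (intro mult_left_mono) auto
    also have "\<dots> = e / 16 * cube_exp t S (avg_over t (S - J) bad)"
      using cube_exp_avg_over[OF S TS] by metis
    also have "\<dots> = cube_exp t S (\<lambda>X. e / 16 * avg_over t (S - J) bad X)" by (simp only: cube_exp_cmult)
    also have "\<dots> \<le> cube_exp t S (\<lambda>X. avg_over t (S - J) (\<lambda>X. (\<psi> X)\<^sup>2) X - (avg_over t (S - J) \<psi> X)\<^sup>2)"
    proof (rule cube_exp_mono[OF t'(1,2)])
      fix X assume X: "X \<subseteq> S"
      define g where "g Y = \<psi> ((X - (S - J)) \<union> Y)" for Y
      have b: "e \<le> cube_exp t (S - J) (\<lambda>Y. of_bool (g Y \<ge> -1/4))"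
      proof -
        have "\<zeta> \<le> (1 - p0 / t) ^ card J * e"
        proof -
          have "\<zeta> \<le> (1 - q) ^ card J * e"
            unfolding \<zeta>_def using q e cJ by (intro mult_right_mono power_decreasing) auto
          also have "\<dots> \<le> (1 - p0 / t) ^ card J * e"
            using q e qt by (intro mult_right_mono power_mono) auto
          finally show ?thesis .
        qed
        hence "e \<le> cube_exp t (S - J) (\<lambda>Y. of_bool (\<zeta> \<le> f ((X - (S - J)) \<union> Y)))"
          unfolding f_def
          by (intro fiber_lower_bound[OF S JS X p(1) _ t'(2) u less_imp_le[OF e] low[OF JS cJ]])
             (use p t in auto)
        also have "\<dots> \<le> cube_exp t (S - J) (\<lambda>Y. of_bool (g Y \<ge> -1/4))"
        proof (rule cube_exp_mono[OF t'(1,2)])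
          fix Y
          have "g Y \<ge> -1/4" if "\<zeta> \<le> f ((X - (S - J)) \<union> Y)"
          proof -
            have "- (\<Lambda> / 4) \<le> - ln (1 / \<zeta>)" using \<Lambda>(3) by simp
            also have "- ln (1 / \<zeta>) = ln \<zeta>" using \<zeta> by (simp add: ln_div)
            also have "ln \<zeta> \<le> \<phi> ((X - (S - J)) \<union> Y)"
              unfolding \<phi>_def using that \<zeta> \<eta> by (subst ln_le_cancel_iff) auto
            finally show ?thesis using \<Lambda> by (simp add: g_def \<psi>_def pos_le_divide_eq)
          qed
          thus "of_bool (\<zeta> \<le> f ((X - (S - J)) \<union> Y)) \<le> (of_bool (g Y \<ge> -1/4) :: real)"
            by (simp add: of_bool_def)
        qed
        finally show ?thesis .
      qed
      have a: "0 \<le> avg_over t (S - J) bad X"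
        unfolding avg_over_def by (intro cube_exp_nonneg t') (auto simp: bad_def)
      have eqs: "avg_over t (S - J) bad X = cube_exp t (S - J) (\<lambda>Y. of_bool (g Y \<le> -3/4))"
        "avg_over t (S - J) (\<lambda>X. (\<psi> X)\<^sup>2) X = cube_exp t (S - J) (\<lambda>Y. (g Y)\<^sup>2)"
        "avg_over t (S - J) \<psi> X = cube_exp t (S - J) g"
        by (simp_all add: avg_over_def g_def[abs_def] bad_def)
      have "e / 16 * avg_over t (S - J) bad X \<le>
          avg_over t (S - J) bad X * cube_exp t (S - J) (\<lambda>Y. of_bool (g Y \<ge> -1/4)) / 16"
        using mult_left_mono[OF b a] by (simp add: mult.commute)
      thus "e / 16 * avg_over t (S - J) bad X \<le>
          avg_over t (S - J) (\<lambda>X. (\<psi> X)\<^sup>2) X - (avg_over t (S - J) \<psi> X)\<^sup>2"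
        unfolding eqs by (rule order_trans[OF _ cube_variance_ge[OF t'(1,2) finT]])
    qed
    also have "\<dots> = V" unfolding cube_exp_diff cube_exp_avg_over[OF S TS] V_def ..
    finally have V2: "e * \<kappa> / 32 \<le> V" by simp
    have "M * (e * \<kappa> / 32) \<le> M * V" using V2 M by (intro mult_left_mono) auto
    also have "\<dots> \<le> (M + 1/2) * V"
    proof (rule mult_right_mono)
      have "0 \<le> e * \<kappa> / 32" using e \<kappa> by simp
      thus "0 \<le> V" using V2 by (rule order_trans)
    qed simp
    also have "\<dots> \<le> K + 2" by (rule V1)
    finally have "M * (e * \<kappa> / 32) \<le> K + 2" .
    moreover have "M * (e * \<kappa> / 32) = 4 * (K + 2)" using e \<kappa> by (simp add: M_def)
    ultimately show False using K by simp
  qed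
  show ?thesis
  proof (rule that)
    show "\<eta>\<^sup>2 > 0" using \<eta> by simp
  qed (rule main)
qed

section \<open>Densities of uniform families\<close>

text \<open>For a finite \<open>X\<close> with fewer than \<open>k\<close> elements the binomial
  coefficient vanishes and division by zero returns 0, so sets that are too small count as having
  density 0.\<close>

definition dens :: "nat \<Rightarrow> 'a set set \<Rightarrow> 'a set \<Rightarrow> real" where
  "dens k F X = real (card {A \<in> F. A \<subseteq> X}) / real (card X choose k)"

lemma card_nsets: "finite X \<Longrightarrow> card (nsets X k) = card X choose k"
proof -
  assume "finite X"
  hence "nsets X k = {A. A \<subseteq> X \<and> card A = k}" by (auto simp: nsets_def finite_subset)
  thus ?thesis using \<open>finite X\<close> by (simp add: n_subsets)
qed

lemma dens_nonneg: "0 \<le> dens k F X"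
  by (simp add: dens_def)

text \<open>Infinite \<open>X\<close>, where \<open>card X = 0\<close>, is covered as well because
  \<open>sharp_threshold\<close> asks for the bound on all sets.\<close>

lemma dens_le_1:
  assumes "finite S" "F \<subseteq> nsets S k"
  shows "dens k F X \<le> 1"
proof -
  have sub: "{A \<in> F. A \<subseteq> X} \<subseteq> nsets (X \<inter> S) k" using assms(2) by (auto simp: nsets_def)
  show ?thesis
  proof (cases "finite X")
    case True
    have "{A \<in> F. A \<subseteq> X} \<subseteq> nsets X k" using sub nsets_mono[of "X \<inter> S" X] by auto
    hence "card {A \<in> F. A \<subseteq> X} \<le> card X choose k"
      using card_mono[OF finite_imp_finite_nsets[OF True]] True by (metis card_nsets)
    thus ?thesis by (auto simp: dens_def divide_le_eq)
  next
    case False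
    show ?thesis
    proof (cases k)
      case 0
      have "{A \<in> F. A \<subseteq> X} \<subseteq> {{}}" using sub 0 by (auto simp: nsets_def)
      hence "card {A \<in> F. A \<subseteq> X} \<le> 1" using card_mono[of "{{}}" "{A \<in> F. A \<subseteq> X}"] by simp
      thus ?thesis using False 0 by (simp add: dens_def)
    qed (use False in \<open>simp add: dens_def\<close>)
  qed
qed

lemma sum_Pow_card_cong:
  fixes \<psi> :: "nat \<Rightarrow> real"
  assumes "finite Z" "finite Z'" "card Z = card Z'"
  shows "(\<Sum>Y\<in>Pow Z. \<psi> (card Y)) = (\<Sum>Y\<in>Pow Z'. \<psi> (card Y))"
proof -
  obtain b where b: "bij_betw b Z Z'" using finite_same_card_bij assms by blast
  have "(\<Sum>Y\<in>Pow Z'. \<psi> (card Y)) = (\<Sum>Y\<in>Pow Z. \<psi> (card (b ` Y)))"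
    by (rule sum.reindex_bij_betw[OF bij_betw_Pow[OF b], symmetric])
  also have "\<dots> = (\<Sum>Y\<in>Pow Z. \<psi> (card Y))"
  proof (rule sum.cong[OF refl])
    fix Y assume "Y \<in> Pow Z"
    hence "inj_on b Y" using b by (auto simp: bij_betw_def intro: inj_on_subset)
    thus "\<psi> (card (b ` Y)) = \<psi> (card Y)" by (simp add: card_image)
  qed
  finally show ?thesis ..
qed

lemma sum_supersets:
  fixes \<psi> :: "nat \<Rightarrow> real"
  assumes "finite X" "A \<subseteq> X"
  shows "(\<Sum>W\<in>Pow X. if A \<subseteq> W then \<psi> (card W) else 0) = (\<Sum>Y\<in>Pow (X - A). \<psi> (card A + card Y))"
proof -
  have "(\<Sum>W\<in>Pow X. if A \<subseteq> W then \<psi> (card W) else 0) = (\<Sum>W\<in>{W. A \<subseteq> W \<and> W \<subseteq> X}. \<psi> (card W))"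
    using assms by (simp add: sum.If_cases Int_def conj_commute)
  also have "\<dots> = (\<Sum>Y\<in>Pow (X - A). \<psi> (card A + card Y))"
  proof (rule sum.reindex_bij_witness[of _ "\<lambda>Y. A \<union> Y" "\<lambda>W. W - A"])
    fix W assume "W \<in> {W. A \<subseteq> W \<and> W \<subseteq> X}"
    hence W: "A \<subseteq> W" "finite W" "finite A" using assms by (auto intro: finite_subset)
    show "\<psi> (card A + card (W - A)) = \<psi> (card W)"
      using W card_mono[OF W(2,1)] by (simp add: card_Diff_subset)
  qed (use assms in auto)
  finally show ?thesis .
qed

text \<open>By symmetry every \<open>k\<close>-subset of \<open>X\<close> contributes the same
  amount \<open>?c\<close> to the mean. Taking the family of all \<open>k\<close>-sets, whose
  density is the indicator of \<open>k \<le> card W\<close>, identifies \<open>?c\<close>.\<close>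

lemma cube_exp_dens:
  assumes "finite X" "F \<subseteq> nsets S k"
  shows "cube_exp q X (dens k F) = cube_exp q X (\<lambda>W. of_bool (k \<le> card W)) * dens k F X"
proof -
  define \<psi> where "\<psi> w = q ^ w * (1 - q) ^ (card X - w) / real (w choose k)" for w
  have *: "cube_exp q X (\<lambda>W. real (card {A \<in> G. A \<subseteq> W}) / real (card W choose k)) =
     real (card {A \<in> G. A \<subseteq> X}) * (\<Sum>Y\<in>Pow {..<card X - k}. \<psi> (k + card Y))" if G: "G \<subseteq> {A. finite A \<and> card A = k}" for G
  proof -
    have fin: "finite {A \<in> G. A \<subseteq> X}" by (rule finite_subset[of _ "Pow X"]) (use assms(1) in auto)
    have "cube_exp q X (\<lambda>W. real (card {A \<in> G. A \<subseteq> W}) / real (card W choose k)) =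
       (\<Sum>W\<in>Pow X. \<Sum>A\<in>{A \<in> G. A \<subseteq> X}. if A \<subseteq> W then \<psi> (card W) else 0)"
      unfolding cube_exp_def
    proof (rule sum.cong[OF refl])
      fix W assume "W \<in> Pow X"
      hence W: "W \<subseteq> X" "finite W" using assms(1) finite_subset by auto
      have "{A \<in> G. A \<subseteq> X} \<inter> {A. A \<subseteq> W} = {A \<in> G. A \<subseteq> W}" using W by auto
      moreover have "card (X - W) = card X - card W" using W by (simp add: card_Diff_subset)
      ultimately show "q ^ card W * (1 - q) ^ card (X - W) * (real (card {A \<in> G. A \<subseteq> W}) / real (card W choose k)) =
         (\<Sum>A\<in>{A \<in> G. A \<subseteq> X}. if A \<subseteq> W then \<psi> (card W) else 0)"
        using fin by (simp add: sum.If_cases \<psi>_def)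
    qed
    also have "\<dots> = (\<Sum>A\<in>{A \<in> G. A \<subseteq> X}. \<Sum>W\<in>Pow X. if A \<subseteq> W then \<psi> (card W) else 0)"
      by (rule sum.swap)
    also have "\<dots> = (\<Sum>A\<in>{A \<in> G. A \<subseteq> X}. \<Sum>Y\<in>Pow {..<card X - k}. \<psi> (k + card Y))"
    proof (rule sum.cong[OF refl])
      fix A assume "A \<in> {A \<in> G. A \<subseteq> X}"
      hence A: "A \<subseteq> X" "card A = k" "finite A" using G by auto
      have "(\<Sum>W\<in>Pow X. if A \<subseteq> W then \<psi> (card W) else 0) = (\<Sum>Y\<in>Pow (X - A). \<psi> (k + card Y))"
        using sum_supersets[OF assms(1) A(1), of \<psi>] A(2) by simp
      also have "\<dots> = (\<Sum>Y\<in>Pow {..<card X - k}. \<psi> (k + card Y))"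
        by (rule sum_Pow_card_cong) (use A assms(1) in \<open>auto simp: card_Diff_subset\<close>)
      finally show "(\<Sum>W\<in>Pow X. if A \<subseteq> W then \<psi> (card W) else 0) = (\<Sum>Y\<in>Pow {..<card X - k}. \<psi> (k + card Y))" .
    qed
    finally show ?thesis by simp
  qed
  let ?c = "\<Sum>Y\<in>Pow {..<card X - k}. \<psi> (k + card Y)"
  have FG: "F \<subseteq> {A. finite A \<and> card A = k}" using assms(2) by (auto simp: nsets_def)
  have "cube_exp q X (\<lambda>W. of_bool (k \<le> card W)) =
      cube_exp q X (\<lambda>W. real (card {A \<in> {A. finite A \<and> card A = k}. A \<subseteq> W}) / real (card W choose k))"
  proof (rule cube_exp_cong)
    fix W assume "W \<subseteq> X"
    hence fW: "finite W" using assms(1) finite_subset by blast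
    have "{A \<in> {A. finite A \<and> card A = k}. A \<subseteq> W} = nsets W k" by (auto simp: nsets_def)
    thus "of_bool (k \<le> card W) = real (card {A \<in> {A. finite A \<and> card A = k}. A \<subseteq> W}) / real (card W choose k)"
      using fW by (simp add: card_nsets binomial_eq_0_iff not_le)
  qed
  also have "\<dots> = real (card X choose k) * ?c"
  proof -
    have "{A \<in> {A. finite A \<and> card A = k}. A \<subseteq> X} = nsets X k" by (auto simp: nsets_def)
    thus ?thesis using *[OF order_refl] assms(1) by (simp add: card_nsets)
  qed
  finally have c: "cube_exp q X (\<lambda>W. of_bool (k \<le> card W)) = real (card X choose k) * ?c" .
  have d: "cube_exp q X (dens k F) = real (card {A \<in> F. A \<subseteq> X}) * ?c"
    using *[OF FG] by (simp add: dens_def[abs_def])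
  show ?thesis
  proof (cases "card X choose k = 0")
    case True
    hence "nsets X k = {}"
      using card_nsets[OF assms(1), of k] finite_imp_finite_nsets[OF assms(1), of k] by (metis card_0_eq)
    hence "{A \<in> F. A \<subseteq> X} = {}" using FG by (auto simp: nsets_def)
    hence "card {A \<in> F. A \<subseteq> X} = 0" by (simp only: card.empty)
    thus ?thesis unfolding d by (simp add: dens_def)
  next
    case False
    thus ?thesis unfolding d c by (simp add: dens_def)
  qed
qed

section \<open>Size of a random subset, and the threshold theorem for uniform families\<close>

lemma cube_exp_card_variance:
  assumes "finite S"
  shows "cube_exp p S (\<lambda>X. (real (card X) - p * real (card S))\<^sup>2) = p * (1 - p) * real (card S)"
proof -
  have "cube_exp p S (\<lambda>X. real (card X) - p * real (card S)) = 0 \<and>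
    cube_exp p S (\<lambda>X. (real (card X) - p * real (card S))\<^sup>2) = p * (1 - p) * real (card S)"
    using assms
  proof (induction S rule: finite_induct)
    case (insert x S)
    define Z where "Z X = real (card X) - p * real (card S)" for X :: "'a set"
    have c: "card (insert x X) = Suc (card X)" if "X \<subseteq> S" for X
      using that insert finite_subset[OF that insert(1)] by (intro card_insert_disjoint) auto
    have cS: "card (insert x S) = Suc (card S)" using insert by simp
    have "cube_exp p (insert x S) (\<lambda>X. real (card X) - p * real (card (insert x S))) =
        cube_exp p S Z"
      unfolding cube_exp_insert[OF insert(1,2)]
      by (rule cube_exp_cong) (simp add: c cS Z_def algebra_simps)
    moreover have "cube_exp p (insert x S) (\<lambda>X. (real (card X) - p * real (card (insert x S)))\<^sup>2) =
        cube_exp p S (\<lambda>X. (Z X)\<^sup>2 + p * (1 - p))"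
      unfolding cube_exp_insert[OF insert(1,2)]
      by (rule cube_exp_cong) (simp add: c cS Z_def algebra_simps power2_eq_square)
    moreover have "cube_exp p S Z = 0" "cube_exp p S (\<lambda>X. (Z X)\<^sup>2) = p * (1 - p) * real (card S)"
      using insert.IH by (auto simp: Z_def[abs_def])
    ultimately show ?case using insert.hyps cS
      by (simp add: cube_exp_add cube_exp_const distrib_left)
  qed simp
  thus ?thesis ..
qed

lemma cube_exp_card_ge:
  assumes S: "finite S" and p: "0 \<le> p" "p \<le> 1" and d: "d > 0" "real k + d \<le> p * real (card S)"
  shows "1 - real (card S) / (4 * d\<^sup>2) \<le> cube_exp p S (\<lambda>X. of_bool (k \<le> card X))"
proof -
  have "cube_exp p S (\<lambda>X. 1 - of_bool (k \<le> card X)) \<le> cube_exp p S (\<lambda>X. (1 / d\<^sup>2) * (real (card X) - p * real (card S))\<^sup>2)"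
  proof (rule cube_exp_mono[OF p])
    fix X :: "'a set"
    show "1 - of_bool (k \<le> card X) \<le> (1 / d\<^sup>2) * (real (card X) - p * real (card S))\<^sup>2"
    proof (cases "k \<le> card X")
      case False
      hence "d \<le> \<bar>real (card X) - p * real (card S)\<bar>" using d by linarith
      hence "d\<^sup>2 \<le> (real (card X) - p * real (card S))\<^sup>2"
        using d by (metis abs_le_square_iff abs_of_pos)
      thus ?thesis using d False by simp
    qed simp
  qed
  also have "\<dots> = p * (1 - p) * real (card S) / d\<^sup>2"
    unfolding cube_exp_cmult cube_exp_card_variance[OF S] by simp
  also have "\<dots> \<le> (1/4) * real (card S) / d\<^sup>2"
  proof (intro divide_right_mono mult_right_mono)
    show "p * (1 - p) \<le> 1/4" using zero_le_power2[of "p - 1/2"] by (simp add: power2_eq_square algebra_simps)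
  qed auto
  finally show ?thesis using S by (simp add: cube_exp_diff cube_exp_const)
qed

theorem dens_sharp_threshold:
  fixes a p1 \<kappa> \<epsilon> :: real
  assumes p: "0 \<le> a" "a < p1" "p1 < 1" and \<kappa>: "\<kappa> > 0" and \<epsilon>: "\<epsilon> > 0"
  obtains r N \<eta> where "\<eta> > 0"
    "\<And>(S :: 'a set) F k. finite S \<Longrightarrow> card S \<ge> N \<Longrightarrow> F \<subseteq> nsets S k \<Longrightarrow> real k \<le> a * real (card S) \<Longrightarrow>
       (\<And>J. J \<subseteq> S \<Longrightarrow> card J \<le> r \<Longrightarrow> \<epsilon> \<le> dens k F (S - J)) \<Longrightarrow>
       cube_exp p1 S (\<lambda>X. of_bool (dens k F X < \<eta>)) < \<kappa>"
proof -
  \<comment> \<open>The interval from \<open>a\<close> to \<open>p1\<close> is cut into three. The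
    first third lets a \<open>p0\<close>-random set have room for \<open>k\<close>-sets with
    \<open>g * real (card S)\<close> to spare; the other two separate \<open>p0\<close>,
    \<open>pm\<close> and \<open>p1\<close>.\<close>
  define g where "g = (p1 - a) / 3"
  have g: "g > 0" using p by (simp add: g_def)
  have g3: "p1 = a + 3 * g" by (simp add: g_def field_simps)
  define p0 where "p0 = a + g"
  define pm where "pm = a + 2 * g"
  have p0: "0 < p0" "p0 < pm" "pm < p1" using p g g3 unfolding p0_def pm_def by auto
  have p0': "0 \<le> p0" "p0 \<le> 1" using p0 p by auto
  obtain r \<eta> where \<eta>: "\<eta> > 0" and main:
    "\<And>(S :: 'a set) u. finite S \<Longrightarrow> (\<And>X. 0 \<le> u X) \<Longrightarrow> (\<And>X. u X \<le> 1) \<Longrightarrow>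
       (\<And>J. J \<subseteq> S \<Longrightarrow> card J \<le> r \<Longrightarrow> 2 * (\<epsilon> / 4) \<le> cube_exp p0 (S - J) u) \<Longrightarrow>
       cube_exp p1 S (\<lambda>X. of_bool (cube_exp (p0 / p1) X u < \<eta>)) < \<kappa>"
    using sharp_threshold[OF p0 p(3) \<kappa>, of "\<epsilon> / 4"] \<epsilon> by (metis zero_less_divide_iff zero_less_numeral)
  \<comment> \<open>The first entry makes the loss of \<open>r\<close> points cost at most half of
    the spare room; the second makes the failure probability in Chebyshev's inequality at most
    1/2.\<close>
  define N where "N = nat \<lceil>max (2 * real r / g) (2 / g\<^sup>2)\<rceil>"
  show ?thesis
  proof (rule that[of \<eta> N r])
    show "\<eta> > 0" by (rule \<eta>)
    fix S :: "'a set" and F k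
    assume S: "finite S" and n: "card S \<ge> N" and F: "F \<subseteq> nsets S k" and k: "real k \<le> a * real (card S)"
      and low: "\<And>J. J \<subseteq> S \<Longrightarrow> card J \<le> r \<Longrightarrow> \<epsilon> \<le> dens k F (S - J)"
    have n1: "2 * real r / g \<le> real (card S)" "2 / g\<^sup>2 \<le> real (card S)" using n unfolding N_def by linarith+
    hence n2: "2 * real r \<le> g * real (card S)" "2 \<le> g\<^sup>2 * real (card S)"
      using g by (simp_all add: pos_divide_le_eq mult.commute)
    have n0: "card S > 0" using n2(2) by (cases "card S = 0") auto
    have "cube_exp p1 S (\<lambda>X. of_bool (cube_exp (p0 / p1) X (dens k F) < \<eta>)) < \<kappa>"
    proof (rule main[OF S dens_nonneg dens_le_1[OF S F]])
      fix J assume J: "J \<subseteq> S" "card J \<le> r"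
      define d where "d = g * real (card S) / 2"
      have d: "d > 0" using g n0 by (simp add: d_def)
      have cT: "card (S - J) = card S - card J" using S J by (simp add: card_Diff_subset finite_subset)
      have cJ: "card J \<le> card S" using S J by (simp add: card_mono)
      have "real k + d \<le> p0 * real (card S) - real r"
        using k n2(1) by (simp add: d_def p0_def algebra_simps)
      also have "real r \<ge> p0 * real (card J)" using J(2) p0' mult_mono[of p0 1 "real (card J)" "real r"] by simp
      hence "p0 * real (card S) - real r \<le> p0 * real (card (S - J))"
        using cT cJ by (simp add: of_nat_diff right_diff_distrib)
      finally have kd: "real k + d \<le> p0 * real (card (S - J))" .
      have "real (card (S - J)) / (4 * d\<^sup>2) \<le> 1 / 2"
      proof -
        have "real (card (S - J)) \<le> real (card S)" using cT by simp
        also have "\<dots> * 2 \<le> real (card S) * (g\<^sup>2 * real (card S))" using n2(2) by (intro mult_left_mono) auto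
        also have "\<dots> = 4 * d\<^sup>2" by (simp add: d_def power2_eq_square)
        finally show ?thesis using d by (simp add: pos_divide_le_eq)
      qed
      moreover have "1 - real (card (S - J)) / (4 * d\<^sup>2) \<le> cube_exp p0 (S - J) (\<lambda>X. of_bool (k \<le> card X))"
        by (rule cube_exp_card_ge) (use S p0' d kd in auto)
      ultimately have "1/2 \<le> cube_exp p0 (S - J) (\<lambda>X. of_bool (k \<le> card X))" by linarith
      hence "1/2 * \<epsilon> \<le> cube_exp p0 (S - J) (\<lambda>X. of_bool (k \<le> card X)) * dens k F (S - J)"
        using low[OF J] \<epsilon> by (intro mult_mono) auto
      also have "\<dots> = cube_exp p0 (S - J) (dens k F)"
        by (rule cube_exp_dens[symmetric]) (use S F in auto)
      finally show "2 * (\<epsilon> / 4) \<le> cube_exp p0 (S - J) (dens k F)" by simp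
    qed
    \<comment> \<open>Thinning can only lower the density, by the probability that the sample has at
      least \<open>k\<close> points, so a small density forces a small thinned density.\<close>
    moreover have "cube_exp p1 S (\<lambda>X. of_bool (dens k F X < \<eta>)) \<le>
        cube_exp p1 S (\<lambda>X. of_bool (cube_exp (p0 / p1) X (dens k F) < \<eta>))"
    proof (rule cube_exp_mono)
      fix X assume "X \<subseteq> S"
      hence X: "finite X" using S finite_subset by blast
      have q: "0 \<le> p0 / p1" "p0 / p1 \<le> 1" using p p0 by auto
      have "cube_exp (p0 / p1) X (\<lambda>W. of_bool (k \<le> card W)) \<le> 1"
        using cube_exp_mono[OF q, of X "\<lambda>W. of_bool (k \<le> card W)" "\<lambda>_. 1"] X by (simp add: cube_exp_const)
      hence "cube_exp (p0 / p1) X (dens k F) \<le> dens k F X"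
        unfolding cube_exp_dens[OF X F] using dens_nonneg[of k F X] by (rule mult_left_le_one_le[rotated 2]) (auto intro!: cube_exp_nonneg q simp: dens_nonneg)
      thus "of_bool (dens k F X < \<eta>) \<le> (of_bool (cube_exp (p0 / p1) X (dens k F) < \<eta>) :: real)"
        by (auto simp: of_bool_def)
    qed (use p in auto)
    ultimately show "cube_exp p1 S (\<lambda>X. of_bool (dens k F X < \<eta>)) < \<kappa>" by linarith
  qed
qed

section \<open>Random colourings of the ground set\<close>

definition colourings :: "'i set \<Rightarrow> 'a set \<Rightarrow> ('a \<Rightarrow> 'i option) set" where
  "colourings I S = S \<rightarrow>\<^sub>E insert None (Some ` I)"

text \<open>The colour \<open>None\<close> absorbs the probability left over when each proper colour
  has probability \<open>p\<close> below \<open>1 / card I\<close>.\<close>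

definition colour_weight :: "real \<Rightarrow> 'i set \<Rightarrow> 'a set \<Rightarrow> ('a \<Rightarrow> 'i option) \<Rightarrow> real" where
  "colour_weight p I S \<gamma> = (\<Prod>x\<in>S. (case \<gamma> x of None \<Rightarrow> 1 - p * real (card I) | Some i \<Rightarrow> p))"

definition colour_class :: "'a set \<Rightarrow> ('a \<Rightarrow> 'i option) \<Rightarrow> 'i \<Rightarrow> 'a set" where
  "colour_class S \<gamma> i = {x\<in>S. \<gamma> x = Some i}"

lemma finite_colourings: "finite I \<Longrightarrow> finite S \<Longrightarrow> finite (colourings I S)"
  by (auto simp: colourings_def intro!: finite_PiE)

lemma colour_weight_nonneg:
  assumes "0 \<le> p" "p * real (card I) \<le> 1"
  shows "0 \<le> colour_weight p I S \<gamma>"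
  unfolding colour_weight_def using assms by (intro prod_nonneg) (auto split: option.splits)

text \<open>Each class by itself is a \<open>p\<close>-random subset, so the cube estimates apply to
  it. The classes depend on each other, but a union bound needs only these marginals.\<close>

lemma sum_colour_weight_class:
  assumes fin: "finite I" "finite S" and i: "i \<in> I"
  shows "(\<Sum>\<gamma>\<in>colourings I S. colour_weight p I S \<gamma> * g (colour_class S \<gamma> i)) = cube_exp p S g"
proof -
  define q where "q c = (case c of None \<Rightarrow> 1 - p * real (card I) | Some i \<Rightarrow> p)" for c :: "'a option"
  define C where "C = insert None (Some ` I)"
  have finC: "finite C" using fin by (simp add: C_def)
  have qi: "(\<Sum>c\<in>C - {Some i}. q c) = 1 - p"
  proof -
    have "C - {Some i} = insert None (Some ` (I - {i}))" by (auto simp: C_def)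
    moreover have "card I \<ge> 1" using fin i by (metis One_nat_def Suc_leI card_gt_0_iff empty_iff)
    ultimately show ?thesis using fin i
      by (simp add: q_def sum.reindex card_Diff_singleton of_nat_diff algebra_simps)
  qed
  have "(\<Sum>\<gamma>\<in>colourings I S. colour_weight p I S \<gamma> * g (colour_class S \<gamma> i)) =
     (\<Sum>X\<in>Pow S. \<Sum>\<gamma>\<in>{\<gamma>\<in>colourings I S. colour_class S \<gamma> i = X}. colour_weight p I S \<gamma> * g (colour_class S \<gamma> i))"
    by (rule sum.group[symmetric]) (use fin in \<open>auto simp: finite_colourings colour_class_def\<close>)
  also have "\<dots> = (\<Sum>X\<in>Pow S. p ^ card X * (1 - p) ^ card (S - X) * g X)"
  proof (rule sum.cong[OF refl])
    fix X assume "X \<in> Pow S"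
    hence X: "X \<subseteq> S" by simp
    have set_eq: "{\<gamma>\<in>colourings I S. colour_class S \<gamma> i = X} = PiE S (\<lambda>x. if x \<in> X then {Some i} else C - {Some i})"
      (is "?L = ?R")
    proof (rule set_eqI)
      fix \<gamma>
      have "\<gamma> \<in> ?L \<longleftrightarrow> \<gamma> \<in> extensional S \<and> (\<forall>x\<in>S. \<gamma> x \<in> C \<and> (\<gamma> x = Some i \<longleftrightarrow> x \<in> X))"
        using X by (auto simp: colourings_def C_def[symmetric] colour_class_def PiE_iff)
      also have "\<dots> \<longleftrightarrow> \<gamma> \<in> ?R"
        using i by (auto simp: PiE_iff C_def split: if_splits)
      finally show "\<gamma> \<in> ?L \<longleftrightarrow> \<gamma> \<in> ?R" .
    qed
    have "(\<Sum>\<gamma>\<in>{\<gamma>\<in>colourings I S. colour_class S \<gamma> i = X}. colour_weight p I S \<gamma> * g (colour_class S \<gamma> i)) =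
        (\<Sum>\<gamma>\<in>{\<gamma>\<in>colourings I S. colour_class S \<gamma> i = X}. \<Prod>x\<in>S. q (\<gamma> x)) * g X"
      unfolding sum_distrib_right by (rule sum.cong[OF refl]) (auto simp: colour_weight_def q_def)
    also have "(\<Sum>\<gamma>\<in>{\<gamma>\<in>colourings I S. colour_class S \<gamma> i = X}. \<Prod>x\<in>S. q (\<gamma> x)) =
        (\<Prod>x\<in>S. \<Sum>c\<in>(if x \<in> X then {Some i} else C - {Some i}). q c)"
      unfolding set_eq by (rule prod_sum_PiE[symmetric]) (use fin finC in auto)
    also have "\<dots> = (\<Prod>x\<in>S. if x \<in> X then p else 1 - p)"
      by (rule prod.cong[OF refl]) (simp add: qi, simp add: q_def)
    also have "\<dots> = p ^ card X * (1 - p) ^ card (S - X)"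
      using X fin by (simp add: prod.If_cases Int_absorb1 Diff_eq[symmetric])
    finally show "(\<Sum>\<gamma>\<in>{\<gamma>\<in>colourings I S. colour_class S \<gamma> i = X}. colour_weight p I S \<gamma> * g (colour_class S \<gamma> i)) =
      p ^ card X * (1 - p) ^ card (S - X) * g X" .
  qed
  finally show ?thesis by (simp add: cube_exp_def)
qed

lemma sum_colour_weight:
  assumes fin: "finite I" "finite S"
  shows "(\<Sum>\<gamma>\<in>colourings I S. colour_weight p I S \<gamma>) = 1"
proof -
  define q where "q c = (case c of None \<Rightarrow> 1 - p * real (card I) | Some i \<Rightarrow> p)" for c :: "'a option"
  have "(\<Sum>\<gamma>\<in>colourings I S. \<Prod>x\<in>S. q (\<gamma> x)) = (\<Prod>x\<in>S. \<Sum>c\<in>insert None (Some ` I). q c)"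
    unfolding colourings_def by (rule prod_sum_PiE[symmetric]) (use fin in auto)
  also have "\<dots> = 1" using fin by (intro prod.neutral) (auto simp: q_def sum.reindex)
  finally show ?thesis by (simp add: colour_weight_def q_def)
qed

section \<open>Disjoint edges\<close>

lemma exists_permutes_image:
  assumes "finite S" "X \<subseteq> S" "Y \<subseteq> S" "card X = card Y"
  obtains \<tau> where "\<tau> permutes S" "\<tau> ` X = Y"
proof -
  have fin: "finite X" "finite Y" using assms finite_subset by blast+
  obtain f where f: "bij_betw f X Y" using finite_same_card_bij[OF fin assms(4)] by blast
  have "card (S - X) = card (S - Y)" using assms fin by (simp add: card_Diff_subset)
  then obtain g where g: "bij_betw g (S - X) (S - Y)"
    using finite_same_card_bij[of "S - X" "S - Y"] assms(1) by auto
  define h where "h x = (if x \<in> S then (if x \<in> X then f x else g x) else x)" for x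
  have "bij_betw (\<lambda>x. if x \<in> X then f x else g x) (X \<union> (S - X)) (Y \<union> (S - Y))"
    by (rule bij_betw_disjoint_Un[OF f g]) auto
  hence "bij_betw (\<lambda>x. if x \<in> X then f x else g x) S S"
    using assms by (simp add: Un_absorb1)
  hence "bij_betw h S S" by (subst bij_betw_cong[of S h]) (auto simp: h_def)
  hence "h permutes S" by (rule bij_imp_permutes) (simp add: h_def)
  moreover have "h ` X = Y"
  proof -
    have "h ` X = f ` X" using assms(2) by (intro image_cong) (auto simp: h_def)
    thus ?thesis using f by (simp add: bij_betw_def)
  qed
  ultimately show ?thesis by (rule that)
qed

text \<open>Edges are moved one at a time; the permutation that places a new edge moves only points
  outside the targets already reached.\<close>

lemma exists_permutes_family:
  assumes "finite I" "finite S"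
    and "\<And>i. i \<in> I \<Longrightarrow> A i \<subseteq> S" "\<And>i. i \<in> I \<Longrightarrow> D i \<subseteq> S" "\<And>i. i \<in> I \<Longrightarrow> card (A i) = card (D i)"
    and "disjoint_family_on A I" "disjoint_family_on D I"
  obtains \<rho> where "\<rho> permutes S" "\<And>i. i \<in> I \<Longrightarrow> \<rho> ` A i = D i"
proof -
  have "\<exists>\<rho>. \<rho> permutes S \<and> (\<forall>i\<in>I. \<rho> ` A i = D i)"
    using assms(1,3-)
  proof (induction I rule: finite_induct)
    case empty
    show ?case using permutes_id[of S] by blast
  next
    case (insert j I)
    have "disjoint_family_on A I" "disjoint_family_on D I"
      using insert.prems(4,5) by (auto simp: disjoint_family_on_def)
    with insert.prems(1-3) have "\<exists>\<rho>. \<rho> permutes S \<and> (\<forall>i\<in>I. \<rho> ` A i = D i)"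
      by (intro insert.IH) simp_all
    then obtain \<rho> where \<rho>: "\<rho> permutes S" "\<forall>i\<in>I. \<rho> ` A i = D i" by blast
    define S' where "S' = S - (\<Union>i\<in>I. D i)"
    have dA: "A j \<inter> A i = {}" and dD: "D j \<inter> D i = {}" if "i \<in> I" for i
      using that insert.hyps(2) disjoint_family_onD[OF insert.prems(4), of j i]
        disjoint_family_onD[OF insert.prems(5), of j i] by auto
    have inj: "inj \<rho>" using \<rho>(1) by (rule permutes_inj)
    have 1: "\<rho> ` A j \<subseteq> S'"
    proof -
      have "\<rho> ` A j \<subseteq> S" using insert.prems(1) permutes_image[OF \<rho>(1)] by blast
      moreover have "\<rho> ` A j \<inter> D i = {}" if "i \<in> I" for i
        using \<rho>(2) dA[OF that] that image_Int[OF inj, of "A j" "A i"] by auto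
      ultimately show ?thesis unfolding S'_def by blast
    qed
    have 2: "D j \<subseteq> S'" using insert.prems(2) dD unfolding S'_def by blast
    have "card (\<rho> ` A j) = card (D j)"
      using insert.prems(3)[of j] inj by (simp add: card_image inj_on_subset)
    then obtain \<tau> where \<tau>: "\<tau> permutes S'" "\<tau> ` (\<rho> ` A j) = D j"
      using exists_permutes_image[of S' "\<rho> ` A j" "D j"] 1 2 assms(2) by (auto simp: S'_def)
    have "\<tau> permutes S" using \<tau>(1) by (rule permutes_subset) (auto simp: S'_def)
    hence "\<tau> \<circ> \<rho> permutes S" using \<rho>(1) by (intro permutes_compose)
    moreover have "(\<tau> \<circ> \<rho>) ` A i = D i" if "i \<in> insert j I" for i
    proof (cases "i = j")
      case True
      thus ?thesis using \<tau>(2) by (simp add: image_comp)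
    next
      case False
      hence i: "i \<in> I" using that by simp
      have "\<tau> x = x" if "x \<in> D i" for x
        using that i permutes_not_in[OF \<tau>(1), of x] by (auto simp: S'_def)
      hence "\<tau> ` D i = D i" by simp
      thus ?thesis using \<rho>(2) i by (metis image_comp)
    qed
    ultimately show ?case by blast
  qed
  thus ?thesis using that by blast
qed

definition copies :: "'a set \<Rightarrow> 'i set \<Rightarrow> ('i \<Rightarrow> 'a set) \<Rightarrow> ('i \<Rightarrow> 'a set set) \<Rightarrow> ('a \<Rightarrow> 'a) set" where
  "copies S I A F = {\<sigma>. \<sigma> permutes S \<and> (\<forall>i\<in>I. \<sigma> ` A i \<in> F i)}"

lemma finite_copies: "finite S \<Longrightarrow> finite (copies S I A F)"
  using finite_permutations[of S] by (rule finite_subset[rotated]) (auto simp: copies_def)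

lemma card_copies_permute:
  assumes "\<rho> permutes S" "\<And>i. i \<in> I \<Longrightarrow> \<rho> ` A i = D i"
  shows "card (copies S I D F) = card (copies S I A F)"
proof (rule bij_betw_same_card)
  show "bij_betw (\<lambda>\<sigma>. \<sigma> \<circ> \<rho>) (copies S I D F) (copies S I A F)"
  proof (rule bij_betw_byWitness[of _ "\<lambda>\<sigma>. \<sigma> \<circ> inv \<rho>"])
    show "\<forall>\<sigma>\<in>copies S I D F. \<sigma> \<circ> \<rho> \<circ> inv \<rho> = \<sigma>"
      using permutes_inv_o(1)[OF assms(1)] by (simp add: comp_assoc)
    show "\<forall>\<sigma>\<in>copies S I A F. \<sigma> \<circ> inv \<rho> \<circ> \<rho> = \<sigma>"
      using permutes_inv_o(2)[OF assms(1)] by (simp add: comp_assoc)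
    show "(\<lambda>\<sigma>. \<sigma> \<circ> \<rho>) ` copies S I D F \<subseteq> copies S I A F"
    proof (clarsimp simp: copies_def)
      fix \<sigma> assume \<sigma>: "\<sigma> permutes S" "\<forall>i\<in>I. \<sigma> ` D i \<in> F i"
      have "(\<sigma> \<circ> \<rho>) ` A i = \<sigma> ` D i" if "i \<in> I" for i using assms(2)[OF that] by (metis image_comp)
      thus "\<sigma> \<circ> \<rho> permutes S \<and> (\<forall>i\<in>I. (\<lambda>x. \<sigma> (\<rho> x)) ` A i \<in> F i)"
        using \<sigma> permutes_compose[OF assms(1)] by (simp add: comp_def)
    qed
    show "(\<lambda>\<sigma>. \<sigma> \<circ> inv \<rho>) ` copies S I A F \<subseteq> copies S I D F"
    proof (clarsimp simp: copies_def)
      fix \<sigma> assume \<sigma>: "\<sigma> permutes S" "\<forall>i\<in>I. \<sigma> ` A i \<in> F i"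
      have "inv \<rho> ` D i = A i" if "i \<in> I" for i
        using assms(2)[OF that] permutes_inj[OF assms(1)] by (metis image_inv_f_f)
      hence "(\<sigma> \<circ> inv \<rho>) ` D i = \<sigma> ` A i" if "i \<in> I" for i using that by (metis image_comp)
      thus "\<sigma> \<circ> inv \<rho> permutes S \<and> (\<forall>i\<in>I. (\<lambda>x. \<sigma> (inv \<rho> x)) ` D i \<in> F i)"
        using \<sigma> permutes_compose[OF permutes_inv[OF assms(1)]] by (simp add: comp_def)
    qed
  qed
qed

lemma dens_image:
  assumes "inj \<sigma>" "finite P" "F \<subseteq> nsets S k"
  shows "dens k F (\<sigma> ` P) = real (card {D \<in> nsets P k. \<sigma> ` D \<in> F}) / real (card P choose k)"
proof -
  have "{A \<in> F. A \<subseteq> \<sigma> ` P} = image \<sigma> ` {D \<in> nsets P k. \<sigma> ` D \<in> F}"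
  proof (intro equalityI subsetI)
    fix A assume "A \<in> {A \<in> F. A \<subseteq> \<sigma> ` P}"
    hence A: "A \<in> F" "A \<subseteq> \<sigma> ` P" by auto
    then obtain D where D: "D \<subseteq> P" "A = \<sigma> ` D" by (auto simp: subset_image_iff)
    have "card D = k" using A D assms(1,3) by (auto simp: nsets_def card_image inj_on_subset)
    hence "D \<in> {D \<in> nsets P k. \<sigma> ` D \<in> F}" using A D assms(2) by (auto simp: nsets_def finite_subset)
    thus "A \<in> image \<sigma> ` {D \<in> nsets P k. \<sigma> ` D \<in> F}" using D by blast
  qed (auto simp: nsets_def)
  moreover have "inj_on (image \<sigma>) T" for T using assms(1) by (simp add: inj_on_def inj_image_eq_iff)
  ultimately have "card {A \<in> F. A \<subseteq> \<sigma> ` P} = card {D \<in> nsets P k. \<sigma> ` D \<in> F}"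
    by (simp add: card_image)
  moreover have "card (\<sigma> ` P) = card P" using assms(1) by (simp add: card_image inj_on_subset)
  ultimately show ?thesis by (simp add: dens_def)
qed

text \<open>The weight depends only on how often each colour occurs, so relabelling the ground set
  preserves the distribution of the classes.\<close>

lemma sum_colouring_permute:
  assumes \<sigma>: "\<sigma> permutes S"
  shows "(\<Sum>\<gamma>\<in>colourings I S. colour_weight p I S \<gamma> * H (\<lambda>i. \<sigma> ` colour_class S \<gamma> i)) =
         (\<Sum>\<gamma>\<in>colourings I S. colour_weight p I S \<gamma> * H (colour_class S \<gamma>))"
proof (rule sum.reindex_bij_witness[of _ "\<lambda>\<gamma>. restrict (\<gamma> \<circ> \<sigma>) S" "\<lambda>\<gamma>. restrict (\<gamma> \<circ> inv \<sigma>) S"])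
  have inv: "inv \<sigma> permutes S" using \<sigma> by (rule permutes_inv)
  have mem: "\<sigma> x \<in> S \<longleftrightarrow> x \<in> S" "inv \<sigma> x \<in> S \<longleftrightarrow> x \<in> S" for x
    using permutes_in_image[OF \<sigma>] permutes_in_image[OF inv] by auto
  have id: "\<sigma> (inv \<sigma> x) = x" "inv \<sigma> (\<sigma> x) = x" for x
    using permutes_inverses[OF \<sigma>] by auto
  fix \<gamma> assume \<gamma>: "\<gamma> \<in> colourings I S"
  hence ext: "\<gamma> x = undefined" if "x \<notin> S" for x using that by (auto simp: colourings_def PiE_iff extensional_def)
  show "restrict (restrict (\<gamma> \<circ> inv \<sigma>) S \<circ> \<sigma>) S = \<gamma>" "restrict (restrict (\<gamma> \<circ> \<sigma>) S \<circ> inv \<sigma>) S = \<gamma>"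
    using ext by (auto simp: fun_eq_iff mem id)
  show "restrict (\<gamma> \<circ> inv \<sigma>) S \<in> colourings I S" "restrict (\<gamma> \<circ> \<sigma>) S \<in> colourings I S"
    using \<gamma> mem by (auto simp: colourings_def PiE_iff)
  have "colour_class S (restrict (\<gamma> \<circ> inv \<sigma>) S) i = \<sigma> ` colour_class S \<gamma> i" for i
  proof (intro equalityI subsetI)
    fix x assume "x \<in> colour_class S (restrict (\<gamma> \<circ> inv \<sigma>) S) i"
    hence "inv \<sigma> x \<in> colour_class S \<gamma> i" by (auto simp: colour_class_def mem)
    thus "x \<in> \<sigma> ` colour_class S \<gamma> i" using id(1)[of x] by (metis image_eqI)
  qed (auto simp: colour_class_def mem id)
  moreover have "colour_weight p I S (restrict (\<gamma> \<circ> inv \<sigma>) S) = colour_weight p I S \<gamma>"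
  proof -
    have "colour_weight p I S (restrict (\<gamma> \<circ> inv \<sigma>) S) =
       (\<Prod>x\<in>S. (case \<gamma> (inv \<sigma> x) of None \<Rightarrow> 1 - p * real (card I) | Some i \<Rightarrow> p))"
      unfolding colour_weight_def by (rule prod.cong) auto
    also have "\<dots> = colour_weight p I S \<gamma>"
      unfolding colour_weight_def
      by (rule prod.reindex_bij_betw[OF permutes_imp_bij[OF inv], of "\<lambda>x. case \<gamma> x of None \<Rightarrow> 1 - p * real (card I) | Some i \<Rightarrow> p"])
    finally show ?thesis .
  qed
  ultimately show "colour_weight p I S (restrict (\<gamma> \<circ> inv \<sigma>) S) * H (colour_class S (restrict (\<gamma> \<circ> inv \<sigma>) S)) =
     colour_weight p I S \<gamma> * H (\<lambda>i. \<sigma> ` colour_class S \<gamma> i)"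
    by presburger
qed

text \<open>Double counting. By invariance the classes may be moved by a random permutation. For a
  fixed colouring the product of densities counts tuples \<open>D\<close> with \<open>D i\<close> a
  \<open>k i\<close>-subset of class \<open>i\<close>. Such tuples are disjoint, hence images of
  \<open>A\<close> under a permutation, so each of them is favourable for exactly \<open>N\<close>
  permutations.\<close>

lemma colouring_dens_le_copies:
  assumes fin: "finite I" "finite S" and p: "0 \<le> p" "p * real (card I) \<le> 1"
    and A: "\<And>i. i \<in> I \<Longrightarrow> A i \<in> nsets S (k i)" "disjoint_family_on A I"
    and F: "\<And>i. i \<in> I \<Longrightarrow> F i \<subseteq> nsets S (k i)"
  shows "(\<Sum>\<gamma>\<in>colourings I S. colour_weight p I S \<gamma> * (\<Prod>i\<in>I. dens (k i) (F i) (colour_class S \<gamma> i)))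
     \<le> real (card (copies S I A F)) / fact (card S)"
proof -
  define N where "N = real (card (copies S I A F))"
  define W where "W = colour_weight p I S"
  define Perms where "Perms = {\<sigma>. \<sigma> permutes S}"
  have finP: "finite Perms" unfolding Perms_def by (rule finite_permutations[OF fin(2)])
  have cP: "card Perms = fact (card S)" unfolding Perms_def by (rule card_permutations[OF refl fin(2)])
  let ?E = "\<Sum>\<gamma>\<in>colourings I S. W \<gamma> * (\<Prod>i\<in>I. dens (k i) (F i) (colour_class S \<gamma> i))"
  have fC: "finite (colour_class S \<gamma> i)" for \<gamma> :: "'b \<Rightarrow> 'a option" and i using fin by (simp add: colour_class_def)
  have key: "(\<Sum>\<sigma>\<in>Perms. \<Prod>i\<in>I. dens (k i) (F i) (\<sigma> ` colour_class S \<gamma> i)) \<le> N" for \<gamma> :: "'b \<Rightarrow> 'a option"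
  proof -
    define P where "P i = colour_class S \<gamma> i" for i
    define b where "b = (\<Prod>i\<in>I. real (card (P i) choose k i))"
    define T where "T = PiE I (\<lambda>i. nsets (P i) (k i))"
    have finN: "finite (nsets (P i) (k i))" for i unfolding P_def by (rule finite_imp_finite_nsets[OF fC])
    have finT: "finite T" unfolding T_def using fin finN by (intro finite_PiE) auto
    have cT: "real (card T) = b"
      unfolding T_def b_def using fin fC by (simp add: card_PiE card_nsets P_def)
    have 1: "(\<Prod>i\<in>I. dens (k i) (F i) (\<sigma> ` P i)) = (\<Sum>D\<in>T. of_bool (\<forall>i\<in>I. \<sigma> ` D i \<in> F i)) / b"
      if "\<sigma> \<in> Perms" for \<sigma>
    proof -
      have inj: "inj \<sigma>" using that permutes_inj by (auto simp: Perms_def)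
      have "(\<Prod>i\<in>I. dens (k i) (F i) (\<sigma> ` P i)) =
          (\<Prod>i\<in>I. real (card {D \<in> nsets (P i) (k i). \<sigma> ` D \<in> F i}) / real (card (P i) choose k i))"
        by (rule prod.cong[OF refl]) (rule dens_image[OF inj _ F], auto simp: P_def fC)
      also have "\<dots> = real (card (PiE I (\<lambda>i. {D \<in> nsets (P i) (k i). \<sigma> ` D \<in> F i}))) / b"
        using fin by (simp add: prod_dividef b_def card_PiE)
      also have "PiE I (\<lambda>i. {D \<in> nsets (P i) (k i). \<sigma> ` D \<in> F i}) = {D\<in>T. \<forall>i\<in>I. \<sigma> ` D i \<in> F i}"
        unfolding T_def by (rule set_eqI) (simp only: PiE_iff mem_Collect_eq, blast)
      also have "real (card {D\<in>T. \<forall>i\<in>I. \<sigma> ` D i \<in> F i}) = (\<Sum>D\<in>T. of_bool (\<forall>i\<in>I. \<sigma> ` D i \<in> F i))"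
        using finT by (simp add: Collect_conj_eq)
      finally show ?thesis .
    qed
    have 2: "(\<Sum>\<sigma>\<in>Perms. of_bool (\<forall>i\<in>I. \<sigma> ` D i \<in> F i)) = N" if D: "D \<in> T" for D
    proof -
      have DP: "D i \<subseteq> P i" "card (D i) = k i" if "i \<in> I" for i
        using D that by (auto simp: T_def PiE_iff nsets_def)
      have disj: "disjoint_family_on D I"
        unfolding disjoint_family_on_def
      proof (intro ballI impI)
        fix i j assume "i \<in> I" "j \<in> I" "i \<noteq> j"
        moreover from this have "P i \<inter> P j = {}" by (auto simp: P_def colour_class_def)
        ultimately show "D i \<inter> D j = {}" using DP by blast
      qed
      have PS: "P i \<subseteq> S" for i by (auto simp: P_def colour_class_def)
      obtain \<rho> where \<rho>: "\<rho> permutes S" "\<And>i. i \<in> I \<Longrightarrow> \<rho> ` A i = D i"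
      proof (rule exists_permutes_family[OF fin, of A D])
        show "A i \<subseteq> S" "D i \<subseteq> S" "card (A i) = card (D i)" if "i \<in> I" for i
          using A(1)[OF that] DP[OF that] PS[of i] by (auto simp: nsets_def)
      qed (use A(2) disj in auto)
      have "(\<Sum>\<sigma>\<in>Perms. of_bool (\<forall>i\<in>I. \<sigma> ` D i \<in> F i)) = real (card {\<sigma>\<in>Perms. \<forall>i\<in>I. \<sigma> ` D i \<in> F i})"
        using finP by (simp add: Collect_conj_eq)
      also have "{\<sigma>\<in>Perms. \<forall>i\<in>I. \<sigma> ` D i \<in> F i} = copies S I D F" by (auto simp: Perms_def copies_def)
      also have "card (copies S I D F) = card (copies S I A F)" by (rule card_copies_permute[OF \<rho>])
      finally show ?thesis by (simp add: N_def)
    qed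
    have "(\<Sum>\<sigma>\<in>Perms. \<Prod>i\<in>I. dens (k i) (F i) (\<sigma> ` P i)) =
        (\<Sum>\<sigma>\<in>Perms. (\<Sum>D\<in>T. of_bool (\<forall>i\<in>I. \<sigma> ` D i \<in> F i)) / b)"
      by (rule sum.cong[OF refl]) (rule 1)
    also have "\<dots> = (\<Sum>\<sigma>\<in>Perms. \<Sum>D\<in>T. of_bool (\<forall>i\<in>I. \<sigma> ` D i \<in> F i)) / b"
      by (rule sum_divide_distrib[symmetric])
    also have "(\<Sum>\<sigma>\<in>Perms. \<Sum>D\<in>T. of_bool (\<forall>i\<in>I. \<sigma> ` D i \<in> F i)) =
        (\<Sum>D\<in>T. \<Sum>\<sigma>\<in>Perms. of_bool (\<forall>i\<in>I. \<sigma> ` D i \<in> F i))" by (rule sum.swap)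
    also have "\<dots> = (\<Sum>D\<in>T. N)" by (rule sum.cong[OF refl]) (rule 2)
    also have "\<dots> = b * N" by (simp add: cT)
    \<comment> \<open>Equality unless some class is too small: then \<open>b = 0\<close>, and the
      left side is 0.\<close>
    also have "b * N / b \<le> N" by (cases "b = 0") (simp_all add: N_def)
    finally show ?thesis by (simp add: P_def)
  qed
  have "fact (card S) * ?E = (\<Sum>\<sigma>\<in>Perms. ?E)" by (simp add: cP)
  also have "\<dots> = (\<Sum>\<sigma>\<in>Perms. \<Sum>\<gamma>\<in>colourings I S. W \<gamma> * (\<Prod>i\<in>I. dens (k i) (F i) (\<sigma> ` colour_class S \<gamma> i)))"
  proof (rule sum.cong[OF refl])
    fix \<sigma> assume "\<sigma> \<in> Perms"
    thus "?E = (\<Sum>\<gamma>\<in>colourings I S. W \<gamma> * (\<Prod>i\<in>I. dens (k i) (F i) (\<sigma> ` colour_class S \<gamma> i)))"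
      unfolding W_def Perms_def
      by (intro sum_colouring_permute[symmetric, where H = "\<lambda>Q. \<Prod>i\<in>I. dens (k i) (F i) (Q i)"]) simp
  qed
  also have "\<dots> = (\<Sum>\<gamma>\<in>colourings I S. W \<gamma> * (\<Sum>\<sigma>\<in>Perms. \<Prod>i\<in>I. dens (k i) (F i) (\<sigma> ` colour_class S \<gamma> i)))"
    unfolding sum_distrib_left by (rule sum.swap)
  also have "\<dots> \<le> (\<Sum>\<gamma>\<in>colourings I S. W \<gamma> * N)"
    using p by (intro sum_mono mult_left_mono key) (auto simp: W_def intro: colour_weight_nonneg)
  also have "\<dots> = N" using sum_colour_weight[OF fin, of p] by (simp add: W_def flip: sum_distrib_right)
  finally show ?thesis by (simp add: N_def W_def pos_le_divide_eq mult.commute)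
qed

text \<open>If no class is bad, the product of densities is at least \<open>\<eta> ^ card I\<close>.
  Subtracting the number of bad classes gives a pointwise lower bound that is linear in indicators,
  so its mean needs only the law of each single class.\<close>

theorem disjoint_copies_lower_bound:
  assumes fin: "finite I" "finite S" and p: "0 \<le> p" "p * real (card I) \<le> 1"
    and A: "\<And>i. i \<in> I \<Longrightarrow> A i \<in> nsets S (k i)" "disjoint_family_on A I"
    and F: "\<And>i. i \<in> I \<Longrightarrow> F i \<subseteq> nsets S (k i)"
    and \<eta>: "0 \<le> \<eta>"
    and bad: "\<And>i. i \<in> I \<Longrightarrow> cube_exp p S (\<lambda>X. of_bool (dens (k i) (F i) X < \<eta>)) \<le> \<kappa>"
  shows "\<eta> ^ card I * (1 - real (card I) * \<kappa>) \<le> real (card (copies S I A F)) / fact (card S)"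
proof -
  let ?C = "colourings I S" and ?W = "colour_weight p I S"
  have W0: "0 \<le> ?W \<gamma>" for \<gamma> :: "'b \<Rightarrow> 'a option" using p by (rule colour_weight_nonneg)
  have pt: "\<eta> ^ card I * (1 - (\<Sum>i\<in>I. of_bool (dens (k i) (F i) (colour_class S \<gamma> i) < \<eta>))) \<le>
      (\<Prod>i\<in>I. dens (k i) (F i) (colour_class S \<gamma> i))" for \<gamma>
  proof (cases "\<exists>i\<in>I. dens (k i) (F i) (colour_class S \<gamma> i) < \<eta>")
    case True
    then obtain j where j: "j \<in> I" "dens (k j) (F j) (colour_class S \<gamma> j) < \<eta>" by blast
    have "(of_bool (dens (k j) (F j) (colour_class S \<gamma> j) < \<eta>) :: real) \<le>
        (\<Sum>i\<in>I. of_bool (dens (k i) (F i) (colour_class S \<gamma> i) < \<eta>))"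
      using j fin by (intro member_le_sum) auto
    hence "1 - (\<Sum>i\<in>I. of_bool (dens (k i) (F i) (colour_class S \<gamma> i) < \<eta>)) \<le> (0::real)" using j by simp
    hence "\<eta> ^ card I * (1 - (\<Sum>i\<in>I. of_bool (dens (k i) (F i) (colour_class S \<gamma> i) < \<eta>))) \<le> 0"
      using \<eta> by (intro mult_nonneg_nonpos) auto
    also have "0 \<le> (\<Prod>i\<in>I. dens (k i) (F i) (colour_class S \<gamma> i))" by (intro prod_nonneg ballI dens_nonneg)
    finally show ?thesis .
  next
    case False
    have "\<eta> ^ card I = (\<Prod>i\<in>I. \<eta>)" by simp
    also have "\<dots> \<le> (\<Prod>i\<in>I. dens (k i) (F i) (colour_class S \<gamma> i))"
      using False \<eta> by (intro prod_mono) auto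
    finally show ?thesis using False by simp
  qed
  have "(\<Sum>i\<in>I. cube_exp p S (\<lambda>X. of_bool (dens (k i) (F i) X < \<eta>))) \<le> (\<Sum>i\<in>I. \<kappa>)"
    by (intro sum_mono bad)
  hence s: "(\<Sum>i\<in>I. cube_exp p S (\<lambda>X. of_bool (dens (k i) (F i) X < \<eta>))) \<le> real (card I) * \<kappa>" by simp
  have "\<eta> ^ card I * (1 - real (card I) * \<kappa>) \<le>
      \<eta> ^ card I * (1 - (\<Sum>i\<in>I. cube_exp p S (\<lambda>X. of_bool (dens (k i) (F i) X < \<eta>))))"
    using s \<eta> by (intro mult_left_mono) auto
  also have "(\<Sum>i\<in>I. cube_exp p S (\<lambda>X. of_bool (dens (k i) (F i) X < \<eta>))) =
      (\<Sum>i\<in>I. \<Sum>\<gamma>\<in>?C. ?W \<gamma> * of_bool (dens (k i) (F i) (colour_class S \<gamma> i) < \<eta>))"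
    by (rule sum.cong[OF refl]) (rule sum_colour_weight_class[OF fin, symmetric])
  also have "\<dots> = (\<Sum>\<gamma>\<in>?C. ?W \<gamma> * (\<Sum>i\<in>I. of_bool (dens (k i) (F i) (colour_class S \<gamma> i) < \<eta>)))"
    unfolding sum_distrib_left by (rule sum.swap)
  also have "1 - (\<Sum>\<gamma>\<in>?C. ?W \<gamma> * (\<Sum>i\<in>I. of_bool (dens (k i) (F i) (colour_class S \<gamma> i) < \<eta>))) =
     (\<Sum>\<gamma>\<in>?C. ?W \<gamma> * (1 - (\<Sum>i\<in>I. of_bool (dens (k i) (F i) (colour_class S \<gamma> i) < \<eta>))))"
    using sum_colour_weight[OF fin, of p] by (simp only: right_diff_distrib sum_subtractf mult_1_right)
  also have "\<eta> ^ card I * \<dots> = (\<Sum>\<gamma>\<in>?C. ?W \<gamma> * (\<eta> ^ card I * (1 - (\<Sum>i\<in>I. of_bool (dens (k i) (F i) (colour_class S \<gamma> i) < \<eta>)))))"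
    unfolding sum_distrib_left by (rule sum.cong[OF refl]) (rule mult.left_commute)
  also have "\<dots> \<le> (\<Sum>\<gamma>\<in>?C. ?W \<gamma> * (\<Prod>i\<in>I. dens (k i) (F i) (colour_class S \<gamma> i)))"
    by (intro sum_mono mult_left_mono pt W0)
  also have "\<dots> \<le> real (card (copies S I A F)) / fact (card S)"
    by (rule colouring_dens_le_copies[OF fin p A F])
  finally show ?thesis .
qed

section \<open>Fairness\<close>

lemma card_nsets_superset:
  assumes "finite S" "T \<subseteq> S" "card T \<le> k"
  shows "card {A \<in> nsets S k. T \<subseteq> A} = (card S - card T) choose (k - card T)"
proof -
  have fT: "finite T" using assms finite_subset by blast
  have "bij_betw (\<lambda>A. A - T) {A \<in> nsets S k. T \<subseteq> A} (nsets (S - T) (k - card T))"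
  proof (rule bij_betw_byWitness[of _ "\<lambda>A. A \<union> T"])
    show "(\<lambda>A. A \<union> T) ` nsets (S - T) (k - card T) \<subseteq> {A \<in> nsets S k. T \<subseteq> A}"
    proof
      fix Y assume "Y \<in> (\<lambda>A. A \<union> T) ` nsets (S - T) (k - card T)"
      then obtain A where A: "Y = A \<union> T" "A \<subseteq> S - T" "finite A" "card A = k - card T"
        by (auto simp: nsets_def)
      have "card (A \<union> T) = card A + card T" using A fT by (intro card_Un_disjoint) auto
      thus "Y \<in> {A \<in> nsets S k. T \<subseteq> A}" using A fT assms by (auto simp: nsets_def)
    qed
  qed (use fT in \<open>auto simp: nsets_def card_Diff_subset\<close>)
  hence "card {A \<in> nsets S k. T \<subseteq> A} = card (nsets (S - T) (k - card T))" by (rule bij_betw_same_card)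
  also have "\<dots> = (card S - card T) choose (k - card T)"
    using assms fT by (simp add: card_nsets card_Diff_subset)
  finally show ?thesis .
qed

lemma card_nsets_containing:
  assumes "finite S" "u \<in> S"
  shows "real (card {A \<in> nsets S k. u \<in> A}) = real k / real (card S) * real (card S choose k)"
proof (cases k)
  case 0
  have "{A \<in> nsets S k. u \<in> A} = {}" using 0 by (auto simp: nsets_def)
  thus ?thesis using 0 by simp
next
  case (Suc k')
  have n: "card S > 0" using assms by (auto simp: card_gt_0_iff)
  have "card {A \<in> nsets S k. u \<in> A} = (card S - 1) choose (k - 1)"
    using card_nsets_superset[OF assms(1), of "{u}" k] assms(2) Suc by simp
  moreover have "k * (card S choose k) = card S * ((card S - 1) choose (k - 1))"
    by (rule times_binomial_minus1_eq) (simp add: Suc)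
  hence "real k * real (card S choose k) = real (card S) * real ((card S - 1) choose (k - 1))"
    by (metis of_nat_mult)
  ultimately show ?thesis using n by (simp add: field_simps)
qed

text \<open>Memberships of two points are negatively correlated, since
  \<open>k * (k - 1) / (n * (n - 1))\<close> is at most \<open>(k / n)\<^sup>2\<close>; thus the
  variance in \<open>fairness\<close> is at most the mean.\<close>

lemma card_nsets_containing_two:
  assumes "finite S" "u \<in> S" "v \<in> S" "u \<noteq> v" "k \<ge> 2" "k \<le> card S"
  shows "real (card {A \<in> nsets S k. u \<in> A \<and> v \<in> A}) \<le> (real k / real (card S))\<^sup>2 * real (card S choose k)"
proof -
  define n where "n = card S"
  have n2: "n \<ge> 2" using assms unfolding n_def by linarith
  have "card {A \<in> nsets S k. u \<in> A \<and> v \<in> A} = (n - 2) choose (k - 2)"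
    using card_nsets_superset[OF assms(1), of "{u, v}" k] assms unfolding n_def by (simp add: numeral_2_eq_2)
  moreover have "k * (n choose k) = n * ((n - 1) choose (k - 1))"
    by (rule times_binomial_minus1_eq) (use assms in simp)
  moreover have "(k - 1) * ((n - 1) choose (k - 1)) = (n - 1) * ((n - 2) choose (k - 2))"
    using times_binomial_minus1_eq[of "k - 1" "n - 1"] assms by (simp add: numeral_2_eq_2)
  ultimately have eq: "real (k - 1) * (real k * real (n choose k)) =
      real n * (real (n - 1) * real (card {A \<in> nsets S k. u \<in> A \<and> v \<in> A}))"
    by (metis (no_types, lifting) mult.left_commute of_nat_mult)
  define x where "x = real (card {A \<in> nsets S k. u \<in> A \<and> v \<in> A})"
  define b where "b = real (n choose k)"
  have "real n * (real (n - 1) * x) * real n = real n * real (k - 1) * (real k * b)"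
    using eq unfolding x_def b_def by simp
  also have "\<dots> \<le> (real (n - 1) * real k) * (real k * b)"
  proof (rule mult_right_mono)
    have "real n * real (k - 1) = real n * real k - real n" using assms by (simp add: of_nat_diff right_diff_distrib)
    also have "\<dots> \<le> real n * real k - real k" using assms by (simp add: n_def)
    also have "\<dots> = real (n - 1) * real k" using n2 by (simp add: of_nat_diff left_diff_distrib)
    finally show "real n * real (k - 1) \<le> real (n - 1) * real k" .
  qed (simp add: b_def)
  finally have "real (n - 1) * (real n * real n * x) \<le> real (n - 1) * (real k * real k * b)"
    by (simp add: mult_ac)
  hence "real n * real n * x \<le> real k * real k * b" using n2 by simp
  hence "x \<le> real k * real k * b / (real n * real n)" using n2 by (simp add: pos_le_divide_eq mult.commute)
  thus ?thesis by (simp add: x_def b_def n_def power2_eq_square)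
qed

text \<open>A fraction \<open>k / n\<close> of all \<open>k\<close>-sets contains a given point, so
  a union bound counts the lost members, and the smaller binomial coefficient of
  \<open>S - J\<close> only helps. For \<open>k\<close> small against \<open>n\<close> removing
  boundedly many points is thus harmless.\<close>

lemma dens_remove:
  assumes S: "finite S" "J \<subseteq> S" and F: "F \<subseteq> nsets S k" and k: "k \<le> card (S - J)"
  shows "dens k F S - real (card J) * (real k / real (card S)) \<le> dens k F (S - J)"
proof -
  define n where "n = card S"
  define b where "b = real (n choose k)"
  have FJ: "finite J" using S finite_subset by blast
  have finF: "finite F" using F finite_imp_finite_nsets[OF S(1)] finite_subset by blast
  have "card (S - J) \<le> n" unfolding n_def using S by (intro card_mono) auto
  hence kn: "k \<le> n" using k by simp
  hence b: "b > 0" by (simp add: b_def)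
  have F1: "{A \<in> F. A \<subseteq> S} = F" using F by (auto simp: nsets_def)
  have "F \<subseteq> {A \<in> F. A \<subseteq> S - J} \<union> (\<Union>j\<in>J. {A \<in> nsets S k. j \<in> A})" using F by (auto simp: nsets_def)
  hence "card F \<le> card ({A \<in> F. A \<subseteq> S - J} \<union> (\<Union>j\<in>J. {A \<in> nsets S k. j \<in> A}))"
    using finF FJ finite_imp_finite_nsets[OF S(1)] by (intro card_mono) auto
  also have "\<dots> \<le> card {A \<in> F. A \<subseteq> S - J} + card (\<Union>j\<in>J. {A \<in> nsets S k. j \<in> A})" by (rule card_Un_le)
  also have "card (\<Union>j\<in>J. {A \<in> nsets S k. j \<in> A}) \<le> (\<Sum>j\<in>J. card {A \<in> nsets S k. j \<in> A})"
    using FJ by (rule card_UN_le)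
  finally have "real (card F) \<le> real (card {A \<in> F. A \<subseteq> S - J}) + (\<Sum>j\<in>J. real (card {A \<in> nsets S k. j \<in> A}))"
    by (simp flip: of_nat_sum of_nat_add)
  also have "(\<Sum>j\<in>J. real (card {A \<in> nsets S k. j \<in> A})) = (\<Sum>j\<in>J. real k / real n * b)"
    unfolding n_def b_def using S by (intro sum.cong refl card_nsets_containing) auto
  also have "\<dots> = real (card J) * (real k / real n) * b" by simp
  finally have "real (card F) - real (card J) * (real k / real n) * b \<le> real (card {A \<in> F. A \<subseteq> S - J})" by simp
  hence "(real (card F) - real (card J) * (real k / real n) * b) / b \<le> real (card {A \<in> F. A \<subseteq> S - J}) / b"
    using b by (intro divide_right_mono) auto
  also have "\<dots> \<le> real (card {A \<in> F. A \<subseteq> S - J}) / real (card (S - J) choose k)"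
    using k \<open>card (S - J) \<le> n\<close> unfolding b_def
    by (intro divide_left_mono mult_pos_pos) (auto intro: binomial_right_mono)
  finally show ?thesis using b by (simp add: dens_def F1 diff_divide_distrib flip: n_def b_def)
qed

lemma mu_eq_dens:
  assumes "F \<subseteq> nsets S k"
  shows "mu S k F = dens k F S"
proof -
  have "{A \<in> F. A \<subseteq> S} = F" using assms by (auto simp: nsets_def)
  thus ?thesis by (simp add: mu_def dens_def)
qed

lemma mu_slice_empty: "mu (S - J) k (slice S F J {}) = dens k F (S - J)"
proof -
  have "slice S F J {} = {A \<in> F. A \<subseteq> S - J}" by (auto simp: slice_def)
  thus ?thesis by (simp add: mu_def dens_def)
qed

lemma card_slice_singleton:
  assumes "u \<in> S" "F \<subseteq> nsets S k"
  shows "card (slice S F {u} {u}) = card {A \<in> F. u \<in> A}"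
proof (rule bij_betw_same_card)
  have sub: "A \<subseteq> S" if "A \<in> F" for A using that assms(2) by (auto simp: nsets_def)
  show "bij_betw (insert u) (slice S F {u} {u}) {A \<in> F. u \<in> A}"
  proof (rule bij_betw_byWitness[of _ "\<lambda>A. A - {u}"])
    show "(\<lambda>A. A - {u}) ` {A \<in> F. u \<in> A} \<subseteq> slice S F {u} {u}"
      using sub by (auto simp: slice_def insert_absorb)
  qed (auto simp: slice_def)
qed

text \<open>Chebyshev's inequality for \<open>card (A \<inter> U)\<close>, where \<open>A\<close> is a uniform \<open>k\<close>-set and \<open>U\<close> the exceptional set.\<close>

lemma fairness:
  assumes S: "finite S" and F: "F \<subseteq> nsets S k" and k: "k \<le> card S" "2 \<le> k" and \<gamma>: "0 < \<gamma>" "1 / \<gamma> ^ 3 < real k"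
  shows "real (card {u\<in>S. mu (S - {u}) (k - 1) (slice S F {u} {u}) < mu S k F - \<gamma>}) \<le> \<gamma> * real (card S)"
proof (rule ccontr)
  define U where "U = {u\<in>S. mu (S - {u}) (k - 1) (slice S F {u} {u}) < mu S k F - \<gamma>}"
  assume "\<not> ?thesis"
  hence big: "\<gamma> * real (card S) < real (card U)" by (simp add: U_def)
  define n where "n = card S"
  define b where "b = real (n choose k)"
  define \<mu> where "\<mu> = mu S k F"
  define q where "q = real k / real n"
  define m where "m = real (card U) * q"
  define Z where "Z A = real (card (A \<inter> U))" for A
  have n: "n > 0" "k \<le> n" using k by (simp_all add: n_def)
  have b: "b > 0" using n by (simp add: b_def)
  have US: "U \<subseteq> S" by (auto simp: U_def)
  have fU: "finite U" using US S finite_subset by blast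
  let ?N = "nsets S k"
  have fN: "finite ?N" by (rule finite_imp_finite_nsets[OF S])
  have fF: "finite F" using F fN finite_subset by blast
  have cN: "real (card ?N) = b" using S by (simp add: card_nsets b_def n_def)
  have q: "0 < q" "q \<le> 1" using n k by (auto simp: q_def)
  have cont: "real (card {A \<in> ?N. u \<in> A}) = q * b" if "u \<in> S" for u
    using card_nsets_containing[OF S that, of k] by (simp add: q_def b_def n_def)
  have Zsum: "Z A = (\<Sum>u\<in>U. of_bool (u \<in> A))" for A
    using fU by (simp add: Z_def Int_commute Int_def)
  have sumZ: "(\<Sum>A\<in>G. Z A) = (\<Sum>u\<in>U. real (card {A\<in>G. u \<in> A}))" if "finite G" for G
  proof -
    have "(\<Sum>A\<in>G. Z A) = (\<Sum>u\<in>U. \<Sum>A\<in>G. of_bool (u \<in> A))" unfolding Zsum by (rule sum.swap)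
    also have "\<dots> = (\<Sum>u\<in>U. real (card {A\<in>G. u \<in> A}))" using that by (simp add: Int_def)
    finally show ?thesis .
  qed
  have EZ: "(\<Sum>A\<in>?N. Z A) = m * b"
  proof -
    have "(\<Sum>A\<in>?N. Z A) = (\<Sum>u\<in>U. q * b)"
      unfolding sumZ[OF fN] using US by (intro sum.cong refl cont) auto
    thus ?thesis by (simp add: m_def)
  qed
  have EZ2: "(\<Sum>A\<in>?N. (Z A)\<^sup>2) \<le> m * b + m\<^sup>2 * b"
  proof -
    have "(\<Sum>A\<in>?N. (Z A)\<^sup>2) = (\<Sum>A\<in>?N. \<Sum>u\<in>U. \<Sum>v\<in>U. of_bool (u \<in> A \<and> v \<in> A))"
      unfolding Zsum power2_eq_square sum_product by (simp only: of_bool_conj)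
    also have "\<dots> = (\<Sum>u\<in>U. \<Sum>A\<in>?N. \<Sum>v\<in>U. of_bool (u \<in> A \<and> v \<in> A))" by (rule sum.swap)
    also have "\<dots> = (\<Sum>u\<in>U. \<Sum>v\<in>U. \<Sum>A\<in>?N. of_bool (u \<in> A \<and> v \<in> A))"
      by (rule sum.cong[OF refl]) (rule sum.swap)
    also have "\<dots> \<le> (\<Sum>u\<in>U. \<Sum>v\<in>U. (if u = v then q * b else 0) + q\<^sup>2 * b)"
    proof (intro sum_mono)
      fix u v assume uv: "u \<in> U" "v \<in> U"
      have "(\<Sum>A\<in>?N. of_bool (u \<in> A \<and> v \<in> A)) = real (card {A\<in>?N. u \<in> A \<and> v \<in> A})"
        using fN by (simp add: Int_def)
      also have "\<dots> \<le> (if u = v then q * b else 0) + q\<^sup>2 * b"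
      proof (cases "u = v")
        case True
        have "real (card {A\<in>?N. u \<in> A \<and> v \<in> A}) = q * b" using cont[of u] uv US True by auto
        also have "0 \<le> q\<^sup>2 * b" using b by simp
        hence "q * b \<le> q * b + q\<^sup>2 * b" by simp
        finally show ?thesis using True by simp
      next
        case False
        thus ?thesis using card_nsets_containing_two[OF S, of u v k] uv US k
          by (auto simp: q_def b_def n_def)
      qed
      finally show "(\<Sum>A\<in>?N. of_bool (u \<in> A \<and> v \<in> A)) \<le> (if u = v then q * b else 0) + q\<^sup>2 * b" .
    qed
    also have "\<dots> = m * b + m\<^sup>2 * b"
      using fU by (simp add: sum.distrib m_def power2_eq_square algebra_simps)
    finally show ?thesis .
  qed
  have var: "(\<Sum>A\<in>?N. (m - Z A)\<^sup>2) \<le> m * b"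
  proof -
    have "(\<Sum>A\<in>?N. (m - Z A)\<^sup>2) = m\<^sup>2 * b + (\<Sum>A\<in>?N. (Z A)\<^sup>2) - 2 * m * (\<Sum>A\<in>?N. Z A)"
      using cN by (simp add: power2_diff sum.distrib sum_subtractf sum_distrib_left mult_ac)
    also have "\<dots> \<le> m\<^sup>2 * b + (m * b + m\<^sup>2 * b) - 2 * m * (m * b)"
      unfolding EZ by (intro diff_right_mono add_left_mono EZ2)
    also have "\<dots> = m * b" by (simp add: power2_eq_square)
    finally show ?thesis .
  qed
  have cF: "real (card F) = \<mu> * b" using b by (simp add: \<mu>_def mu_def b_def n_def)
  \<comment> \<open>A point of \<open>U\<close> lies in at most
    \<open>(\<mu> - \<gamma>) * q * b\<close> members of \<open>F\<close> instead of
    \<open>\<mu> * q * b\<close>; summed over \<open>U\<close>, the intersections with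
    \<open>U\<close> fall short of their mean \<open>m\<close> by this total.\<close>
  have "\<gamma> * m * b \<le> (\<Sum>A\<in>F. m - Z A)"
  proof -
    have "real (card {A\<in>F. u \<in> A}) \<le> (\<mu> - \<gamma>) * (q * b)" if "u \<in> U" for u
    proof -
      have u: "u \<in> S" using that US by auto
      have "card {A \<in> nsets S k. {u} \<subseteq> A} = (card S - card {u}) choose (k - card {u})"
        by (rule card_nsets_superset) (use S u k in auto)
      hence bin: "real ((n - 1) choose (k - 1)) = q * b" using cont[OF u] by (simp add: n_def)
      have "mu (S - {u}) (k - 1) (slice S F {u} {u}) < \<mu> - \<gamma>" using that by (simp add: U_def \<mu>_def)
      hence "real (card {A\<in>F. u \<in> A}) / (q * b) < \<mu> - \<gamma>"
        using u S by (simp add: mu_def card_slice_singleton[OF u F] n_def[symmetric] flip: bin)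
      thus ?thesis using q b by (simp add: pos_divide_less_eq)
    qed
    hence "(\<Sum>u\<in>U. real (card {A\<in>F. u \<in> A})) \<le> (\<Sum>u\<in>U. (\<mu> - \<gamma>) * (q * b))" by (intro sum_mono)
    also have "\<dots> = (\<mu> - \<gamma>) * (m * b)" by (simp add: m_def)
    finally have "(\<Sum>A\<in>F. Z A) \<le> (\<mu> - \<gamma>) * (m * b)" unfolding sumZ[OF fF] .
    moreover have "(\<Sum>A\<in>F. m - Z A) = \<mu> * b * m - (\<Sum>A\<in>F. Z A)" by (simp add: sum_subtractf cF)
    ultimately show ?thesis by (simp add: algebra_simps)
  qed
  moreover have m: "m > 0"
  proof -
    have "0 < \<gamma> * real (card S)" using \<gamma> n by (simp add: n_def)
    hence "0 < real (card U)" using big by linarith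
    thus ?thesis using q by (simp add: m_def)
  qed
  \<comment> \<open>Cauchy-Schwarz on \<open>F\<close>, with the variance taken over all
    \<open>k\<close>-sets, gives \<open>\<gamma>\<^sup>2 * m \<le> 1\<close>. A large
    \<open>U\<close> makes \<open>m > \<gamma> * real k\<close>, against the lower bound on
    \<open>k\<close>.\<close>
  ultimately have "(\<gamma> * m * b)\<^sup>2 \<le> (\<Sum>A\<in>F. m - Z A)\<^sup>2"
    using \<gamma> b by (intro power_mono) auto
  also have "\<dots> = (\<Sum>A\<in>F. 1 * (m - Z A))\<^sup>2" by simp
  also have "\<dots> \<le> (\<Sum>A\<in>F. 1\<^sup>2) * (\<Sum>A\<in>F. (m - Z A)\<^sup>2)" by (rule Cauchy_Schwarz_ineq_sum)
  also have "\<dots> \<le> b * (m * b)"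
  proof (intro mult_mono)
    show "(\<Sum>A\<in>F. 1\<^sup>2) \<le> b" using card_mono[OF fN F] cN by simp
    have "(\<Sum>A\<in>F. (m - Z A)\<^sup>2) \<le> (\<Sum>A\<in>?N. (m - Z A)\<^sup>2)" using F fN by (intro sum_mono2) auto
    thus "(\<Sum>A\<in>F. (m - Z A)\<^sup>2) \<le> m * b" using var by linarith
  qed (use b in \<open>auto intro: sum_nonneg\<close>)
  finally have "(m * b\<^sup>2) * (\<gamma>\<^sup>2 * m) \<le> (m * b\<^sup>2) * 1" by (simp add: power2_eq_square mult_ac)
  hence gm: "\<gamma>\<^sup>2 * m \<le> 1" using m b by (subst (asm) mult_le_cancel_left_pos) auto
  have "\<gamma> * real k < m"
  proof -
    have "\<gamma> * real k = \<gamma> * real n * q" using n by (simp add: q_def)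
    also have "\<dots> < real (card U) * q" using big q by (simp add: n_def)
    finally show ?thesis by (simp add: m_def)
  qed
  hence "\<gamma>\<^sup>2 * (\<gamma> * real k) < \<gamma>\<^sup>2 * m" using \<gamma> by (intro mult_strict_left_mono) auto
  hence "\<gamma> ^ 3 * real k < 1" using gm by (simp add: power2_eq_square power3_eq_cube mult_ac)
  moreover have "1 < \<gamma> ^ 3 * real k" using \<gamma> by (simp add: pos_divide_less_eq mult.commute)
  ultimately show False by simp
qed

section \<open>Exposing the centre\<close>

text \<open>The one-sided part of regularity that the argument keeps. Unlike closeness to the
  density of the family, a fixed lower bound passes to slices unchanged, at the cost of one unit of
  \<open>r\<close>.\<close>

definition lower_regular :: "nat \<Rightarrow> real \<Rightarrow> 'a set \<Rightarrow> nat \<Rightarrow> 'a set set \<Rightarrow> bool" where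
  "lower_regular r \<epsilon> S k F \<longleftrightarrow>
     (\<forall>J B. J \<subseteq> S \<longrightarrow> card J \<le> r \<longrightarrow> B \<subseteq> J \<longrightarrow> card B \<le> k \<longrightarrow> k - card B \<le> card (S - J) \<longrightarrow>
        \<epsilon> \<le> mu (S - J) (k - card B) (slice S F J B))"

lemma slice_slice:
  assumes "u \<in> S" "J \<subseteq> S - {u}" "B \<subseteq> J" "B0 \<subseteq> {u}"
  shows "slice (S - {u}) (slice S F {u} B0) J B = slice S F (insert u J) (B \<union> B0)"
  using assms by (auto simp: slice_def Un_assoc)

lemma slice_nsets:
  assumes S: "finite S" and F: "F \<subseteq> nsets S k" and B: "B \<subseteq> J" "finite J"
  shows "slice S F J B \<subseteq> nsets (S - J) (k - card B)"
proof
  fix A assume "A \<in> slice S F J B"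
  hence A: "A \<subseteq> S - J" "A \<union> B \<in> F" by (auto simp: slice_def)
  have fin: "finite A" "finite B" using A S B finite_subset[of A "S - J"] finite_subset by auto
  have "card (A \<union> B) = card A + card B" using A B fin by (intro card_Un_disjoint) auto
  moreover have "card (A \<union> B) = k" using A F by (auto simp: nsets_def)
  ultimately show "A \<in> nsets (S - J) (k - card B)" using A fin by (auto simp: nsets_def)
qed

lemma lower_regular_slice:
  assumes reg: "lower_regular (Suc r) \<epsilon> S k F" and S: "finite S" and u: "u \<in> S"
    and B0: "B0 \<subseteq> {u}" "card B0 \<le> k"
  shows "lower_regular r \<epsilon> (S - {u}) (k - card B0) (slice S F {u} B0)"
  unfolding lower_regular_def
proof (intro allI impI)
  fix J B assume J: "J \<subseteq> S - {u}" "card J \<le> r" and B: "B \<subseteq> J" "card B \<le> k - card B0"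
    "k - card B0 - card B \<le> card (S - {u} - J)"
  have fJ: "finite J" using J S finite_subset by blast
  have fB: "finite B" "finite B0" using B fJ B0 finite_subset by blast+
  have c: "card (B \<union> B0) = card B + card B0" using B B0 J fB by (intro card_Un_disjoint) auto
  have S': "S - {u} - J = S - insert u J" by auto
  have "\<epsilon> \<le> mu (S - insert u J) (k - card (B \<union> B0)) (slice S F (insert u J) (B \<union> B0))"
  proof (rule reg[unfolded lower_regular_def, rule_format])
    show "card (insert u J) \<le> Suc r" using J fJ by (simp add: card_insert_if)
    show "k - card (B \<union> B0) \<le> card (S - insert u J)" using B(3) unfolding S' c by (simp add: add.commute)
  qed (use u J B B0 c in auto)
  thus "\<epsilon> \<le> mu (S - {u} - J) (k - card B0 - card B) (slice (S - {u}) (slice S F {u} B0) J B)"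
    unfolding S' slice_slice[OF u J(1) B(1) B0(1)] c by (simp add: add.commute)
qed

text \<open>Composition with the transposition of \<open>v\<close> and \<open>u\<close> makes
  \<open>u\<close> a fixed point, so the permutations sending \<open>v\<close> to \<open>u\<close>
  become permutations of \<open>S - {u}\<close>. The edges lose \<open>v\<close>, and
  \<open>u\<close> is built into the slice exactly for the edges that contained it.\<close>

lemma card_copies_fibre:
  fixes A :: "'i \<Rightarrow> 'a set"
  assumes v: "v \<in> S" and u: "u \<in> S" and A: "\<And>i. i \<in> I \<Longrightarrow> A i \<subseteq> S"
  shows "card {\<sigma> \<in> copies S I A F. \<sigma> v = u} =
    card (copies (S - {u}) I (\<lambda>i. Transposition.transpose v u ` (A i - {v}))
       (\<lambda>i. slice S (F i) {u} (if v \<in> A i then {u} else {})))"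
proof (rule bij_betw_same_card)
  let ?t = "Transposition.transpose v u"
  let ?A = "\<lambda>i. ?t ` (A i - {v})"
  let ?B = "\<lambda>i. if v \<in> A i then {u} else {}"
  have t: "?t permutes S" using v u by (rule permutes_swap_id)
  have tt: "?t \<circ> ?t = id" by (simp add: fun_eq_iff)
  have iff: "(\<sigma> \<circ> ?t) ` ?A i \<in> slice S (F i) {u} (?B i) \<longleftrightarrow> \<sigma> ` A i \<in> F i"
    if "\<sigma> permutes S" "\<sigma> v = u" "i \<in> I" for \<sigma> i
  proof -
    have "(\<sigma> \<circ> ?t) ` ?A i = \<sigma> ` (A i - {v})" by (simp add: image_comp comp_assoc tt)
    moreover have "\<sigma> ` (A i - {v}) \<subseteq> S - {u}"
      using permutes_inj[OF that(1)] permutes_image[OF that(1)] A[OF that(3)] that(2) by (auto dest: injD)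
    moreover have "\<sigma> ` (A i - {v}) \<union> ?B i = \<sigma> ` A i" using that(2) by auto
    ultimately show ?thesis by (simp add: slice_def)
  qed
  show "bij_betw (\<lambda>\<sigma>. \<sigma> \<circ> ?t) {\<sigma> \<in> copies S I A F. \<sigma> v = u}
     (copies (S - {u}) I ?A (\<lambda>i. slice S (F i) {u} (?B i)))"
  proof (rule bij_betw_byWitness[of _ "\<lambda>\<sigma>. \<sigma> \<circ> ?t"])
    show "(\<lambda>\<sigma>. \<sigma> \<circ> ?t) ` {\<sigma> \<in> copies S I A F. \<sigma> v = u} \<subseteq> copies (S - {u}) I ?A (\<lambda>i. slice S (F i) {u} (?B i))"
    proof
      fix \<tau> assume "\<tau> \<in> (\<lambda>\<sigma>. \<sigma> \<circ> ?t) ` {\<sigma> \<in> copies S I A F. \<sigma> v = u}"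
      then obtain \<sigma> where \<sigma>: "\<tau> = \<sigma> \<circ> ?t" "\<sigma> permutes S" "\<forall>i\<in>I. \<sigma> ` A i \<in> F i" "\<sigma> v = u"
        by (auto simp: copies_def)
      have "\<tau> permutes S" unfolding \<sigma>(1) by (rule permutes_compose[OF t \<sigma>(2)])
      hence "\<tau> permutes S - {u}" by (rule permutes_superset) (use \<sigma> in auto)
      thus "\<tau> \<in> copies (S - {u}) I ?A (\<lambda>i. slice S (F i) {u} (?B i))"
        using \<sigma>(3) iff[OF \<sigma>(2,4)] unfolding \<sigma>(1) copies_def by blast
    qed
    show "(\<lambda>\<sigma>. \<sigma> \<circ> ?t) ` copies (S - {u}) I ?A (\<lambda>i. slice S (F i) {u} (?B i)) \<subseteq> {\<sigma> \<in> copies S I A F. \<sigma> v = u}"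
    proof
      fix \<sigma> assume "\<sigma> \<in> (\<lambda>\<sigma>. \<sigma> \<circ> ?t) ` copies (S - {u}) I ?A (\<lambda>i. slice S (F i) {u} (?B i))"
      then obtain \<tau> where \<tau>: "\<sigma> = \<tau> \<circ> ?t" "\<tau> permutes S - {u}"
        "\<forall>i\<in>I. \<tau> ` ?A i \<in> slice S (F i) {u} (?B i)"
        by (auto simp: copies_def)
      have "\<tau> permutes S" using \<tau>(2) by (rule permutes_subset) auto
      hence \<sigma>S: "\<sigma> permutes S" unfolding \<tau>(1) by (intro permutes_compose[OF t])
      have \<sigma>v: "\<sigma> v = u" using \<tau> permutes_not_in[OF \<tau>(2), of u] by simp
      have "\<sigma> \<circ> ?t = \<tau>" unfolding \<tau>(1) by (simp add: comp_assoc tt)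
      thus "\<sigma> \<in> {\<sigma> \<in> copies S I A F. \<sigma> v = u}"
        using \<tau>(3) iff[OF \<sigma>S \<sigma>v] \<sigma>S \<sigma>v unfolding copies_def by simp
    qed
  qed (simp_all add: comp_assoc tt)
qed

text \<open>Total probability over the image of \<open>v\<close>; only the images in
  \<open>G\<close>, at least half of all, are kept.\<close>

lemma copies_lower_bound_step:
  assumes S: "finite S" and v: "v \<in> S" and A: "\<And>i. i \<in> I \<Longrightarrow> A i \<subseteq> S"
    and G: "G \<subseteq> S" "real (card S) / 2 \<le> real (card G)" and \<zeta>: "0 \<le> \<zeta>"
    and good: "\<And>u. u \<in> G \<Longrightarrow> \<zeta> \<le> real (card (copies (S - {u}) I (\<lambda>i. Transposition.transpose v u ` (A i - {v}))
       (\<lambda>i. slice S (F i) {u} (if v \<in> A i then {u} else {})))) / fact (card (S - {u}))"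
  shows "\<zeta> / 2 \<le> real (card (copies S I A F)) / fact (card S)"
proof -
  define n where "n = card S"
  have n: "n > 0" using S v by (auto simp: n_def card_gt_0_iff)
  have fc: "finite (copies S I A F)" using S by (rule finite_copies)
  have "real (card (copies S I A F)) = (\<Sum>\<sigma>\<in>copies S I A F. 1)" by simp
  also have "\<dots> = (\<Sum>u\<in>S. \<Sum>\<sigma>\<in>{\<sigma> \<in> copies S I A F. \<sigma> v = u}. 1)"
  proof (rule sum.group[symmetric])
    show "(\<lambda>\<sigma>. \<sigma> v) ` copies S I A F \<subseteq> S"
    proof
      fix x assume "x \<in> (\<lambda>\<sigma>. \<sigma> v) ` copies S I A F"
      then obtain \<sigma> where "\<sigma> permutes S" "x = \<sigma> v" by (auto simp: copies_def)
      thus "x \<in> S" using v permutes_in_image[of \<sigma> S v] by simp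
    qed
  qed (use S fc in auto)
  also have "\<dots> = (\<Sum>u\<in>S. real (card {\<sigma> \<in> copies S I A F. \<sigma> v = u}))" by simp
  finally have cs: "real (card (copies S I A F)) = (\<Sum>u\<in>S. real (card {\<sigma> \<in> copies S I A F. \<sigma> v = u}))" .
  have "real n / 2 * (\<zeta> * fact (n - 1)) \<le> real (card G) * (\<zeta> * fact (n - 1))"
    using G \<zeta> by (intro mult_right_mono) (auto simp: n_def)
  also have "\<dots> = (\<Sum>u\<in>G. \<zeta> * fact (n - 1))" by simp
  also have "\<dots> \<le> (\<Sum>u\<in>G. real (card {\<sigma> \<in> copies S I A F. \<sigma> v = u}))"
  proof (rule sum_mono)
    fix u assume u: "u \<in> G"
    hence uS: "u \<in> S" using G by auto
    have "\<zeta> \<le> real (card {\<sigma> \<in> copies S I A F. \<sigma> v = u}) / fact (n - 1)"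
      using good[OF u] card_copies_fibre[OF v uS A, where F = F] S uS by (simp add: n_def)
    thus "\<zeta> * fact (n - 1) \<le> real (card {\<sigma> \<in> copies S I A F. \<sigma> v = u})" by (simp add: pos_le_divide_eq)
  qed
  also have "\<dots> \<le> (\<Sum>u\<in>S. real (card {\<sigma> \<in> copies S I A F. \<sigma> v = u}))"
    using S G by (intro sum_mono2) auto
  also have "\<dots> = real (card (copies S I A F))" by (rule cs[symmetric])
  finally have "\<zeta> / 2 * (real n * fact (n - 1)) \<le> real (card (copies S I A F))" by (simp add: mult_ac)
  moreover have "real n * fact (n - 1) = fact n" using n by (simp add: fact_reduce)
  ultimately show ?thesis by (simp add: pos_le_divide_eq n_def)
qed

text \<open>Every parameter holds \<open>c\<close> units in reserve. Exposing one vertex consumes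
  one point of \<open>S\<close>, at most one point of each edge, one unit of regularity, density
  \<open>\<gamma>\<close> in the sparse case, and a factor 2. The difference
  \<open>card S - c\<close> is invariant, which passes the size bounds on unchanged.
  \<open>base\<close> is the bound for disjoint edges.\<close>

lemma copies_lower_bound_center:
  fixes \<zeta> \<beta> \<epsilon> a d \<gamma> :: real and N r K :: nat
    and S :: "'a set" and A :: "'i \<Rightarrow> 'a set"
  assumes I: "finite I" and \<zeta>: "0 \<le> \<zeta>" and a: "0 \<le> a" "a < 1" "real r \<le> (1 - a) * real N"
    and d: "0 \<le> d" "d \<le> \<gamma>" "\<beta> \<le> \<epsilon>" "\<beta> + real r * d \<le> \<epsilon>"
    and \<gamma>: "0 < \<gamma>" "\<gamma> * real (card I) \<le> 1/2" "1 / \<gamma> ^ 3 < real K" "2 \<le> K"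
    and base: "\<And>(S :: 'a set) (A :: 'i \<Rightarrow> 'a set) k F. finite S \<Longrightarrow> N \<le> card S \<Longrightarrow>
      (\<And>i. i \<in> I \<Longrightarrow> A i \<in> nsets S (k i)) \<Longrightarrow> disjoint_family_on A I \<Longrightarrow>
      (\<And>i. i \<in> I \<Longrightarrow> F i \<subseteq> nsets S (k i)) \<Longrightarrow> (\<And>i. i \<in> I \<Longrightarrow> real (k i) \<le> a * real (card S)) \<Longrightarrow>
      (\<And>i J. i \<in> I \<Longrightarrow> J \<subseteq> S \<Longrightarrow> card J \<le> r \<Longrightarrow> \<beta> \<le> dens (k i) (F i) (S - J)) \<Longrightarrow>
      \<zeta> \<le> real (card (copies S I A F)) / fact (card S)"
    and S: "finite S" "N + c \<le> card S"
    and A: "\<And>i. i \<in> I \<Longrightarrow> A i \<in> nsets S (k i)" "card (hypergraph_center I A) \<le> c"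
    and F: "\<And>i. i \<in> I \<Longrightarrow> F i \<subseteq> nsets S (k i)"
    and k: "\<And>i. i \<in> I \<Longrightarrow> real (k i) \<le> a * (real (card S) - real c)"
    and reg: "\<And>i. i \<in> I \<Longrightarrow> lower_regular (r + c) \<epsilon> S (k i) (F i) \<or>
      (K + c \<le> k i \<and> real (k i) \<le> d * (real (card S) - real c) \<and> \<epsilon> + real c * \<gamma> \<le> mu S (k i) (F i))"
  shows "\<zeta> / 2 ^ c \<le> real (card (copies S I A F)) / fact (card S)"
  using S A F k reg
proof (induction c arbitrary: S A F k)
  \<comment> \<open>Stated for every \<open>c\<close>, because the centre may become empty before
    its bound \<open>c\<close> reaches 0.\<close>
  have disjoint_case: "\<zeta> \<le> real (card (copies S I A F)) / fact (card S)"
    if S: "finite S" "N + c \<le> card S"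
    and A: "\<And>i. i \<in> I \<Longrightarrow> A i \<in> nsets S (k i)" "hypergraph_center I A = {}"
    and F: "\<And>i. i \<in> I \<Longrightarrow> F i \<subseteq> nsets S (k i)"
    and k: "\<And>i. i \<in> I \<Longrightarrow> real (k i) \<le> a * (real (card S) - real c)"
    and reg: "\<And>i. i \<in> I \<Longrightarrow> lower_regular (r + c) \<epsilon> S (k i) (F i) \<or>
      (K + c \<le> k i \<and> real (k i) \<le> d * (real (card S) - real c) \<and> \<epsilon> + real c * \<gamma> \<le> mu S (k i) (F i))"
    for c and S :: "'a set" and A :: "'i \<Rightarrow> 'a set" and F k
  proof (rule base[OF S(1) _ A(1) _ F])
    show "N \<le> card S" using S by simp
    show "disjoint_family_on A I"
      using A(2) unfolding disjoint_family_on_def hypergraph_center_def by blast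
    have ka: "real (k i) \<le> a * real (card S)" if "i \<in> I" for i
    proof -
      have "a * (real (card S) - real c) \<le> a * real (card S)" using a by (intro mult_left_mono) auto
      thus ?thesis using k[OF that] by linarith
    qed
    thus "real (k i) \<le> a * real (card S)" if "i \<in> I" for i using that .
    fix i J assume i: "i \<in> I" and J: "J \<subseteq> S" "card J \<le> r"
    have fJ: "finite J" using J S finite_subset by blast
    have "card J \<le> card S" using J S by (intro card_mono)
    hence cT: "real (card (S - J)) = real (card S) - real (card J)"
      using J fJ by (simp add: card_Diff_subset of_nat_diff)
    have "(1 - a) * real N \<le> (1 - a) * real (card S)" using S a by (intro mult_left_mono) auto
    hence "real r \<le> real (card S) - a * real (card S)" using a(3) by (simp add: left_diff_distrib)
    hence "real (k i) \<le> real (card (S - J))" using ka[OF i] cT J(2) by linarith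
    hence kT: "k i \<le> card (S - J)" by simp
    show "\<beta> \<le> dens (k i) (F i) (S - J)"
      using reg[OF i]
    proof
      assume "lower_regular (r + c) \<epsilon> S (k i) (F i)"
      hence "\<epsilon> \<le> mu (S - J) (k i - card {}) (slice S (F i) J {})"
        unfolding lower_regular_def using J kT by (metis card.empty diff_zero empty_subsetI trans_le_add1 zero_le)
      thus ?thesis using d by (simp add: mu_slice_empty)
    next
      assume sp: "K + c \<le> k i \<and> real (k i) \<le> d * (real (card S) - real c) \<and> \<epsilon> + real c * \<gamma> \<le> mu S (k i) (F i)"
      have n: "0 < real (card S)" using sp \<gamma>(4) kT cT by linarith
      have "d * (real (card S) - real c) \<le> d * real (card S)" using d by (intro mult_left_mono) auto
      hence "real (k i) \<le> d * real (card S)" using sp by linarith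
      hence "real (k i) / real (card S) \<le> d" using n by (simp add: pos_divide_le_eq)
      hence "real (card J) * (real (k i) / real (card S)) \<le> real r * d"
        using J d by (intro mult_mono) auto
      moreover have "dens (k i) (F i) S - real (card J) * (real (k i) / real (card S)) \<le> dens (k i) (F i) (S - J)"
        by (rule dens_remove[OF S(1) J(1) F[OF i] kT])
      moreover have "\<epsilon> \<le> dens (k i) (F i) S"
      proof -
        have "0 \<le> real c * \<gamma>" using \<gamma> by simp
        thus ?thesis using sp mu_eq_dens[OF F[OF i]] by linarith
      qed
      ultimately show ?thesis using d(4) by linarith
    qed
  qed
  {
    case (0 S A F k)
    have "finite (hypergraph_center I A)"
    proof (rule finite_subset)
      show "hypergraph_center I A \<subseteq> S"
        using 0(3) by (fastforce simp: hypergraph_center_def nsets_def)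
    qed (rule 0(1))
    hence "hypergraph_center I A = {}" using 0(4) by simp
    have "\<zeta> \<le> real (card (copies S I A F)) / fact (card S)"
    proof (rule disjoint_case[of S 0 A k F])
      show "hypergraph_center I A = {}" by fact
    qed (fact 0)+
    thus ?case by simp
  next
    case (Suc c S A F k)
    note S = Suc.prems(1,2) and A = Suc.prems(3,4) and F = Suc.prems(5) and k = Suc.prems(6) and reg = Suc.prems(7)
    have AS: "A i \<subseteq> S" "card (A i) = k i" "finite (A i)" if "i \<in> I" for i
      using A(1)[OF that] by (auto simp: nsets_def)
    show ?case
    proof (cases "hypergraph_center I A = {}")
      case True
      have "\<zeta> \<le> real (card (copies S I A F)) / fact (card S)"
        by (rule disjoint_case[OF S A(1) True F k reg])
      moreover have "\<zeta> / 2 ^ Suc c \<le> \<zeta>"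
      proof -
        have "(1::real) \<le> 2 ^ Suc c" by (rule one_le_power) simp
        hence "\<zeta> * 1 \<le> \<zeta> * 2 ^ Suc c" using \<zeta> by (intro mult_left_mono) auto
        thus ?thesis by (simp add: pos_divide_le_eq)
      qed
      ultimately show ?thesis by linarith
    next
      case False
      then obtain v where v: "v \<in> hypergraph_center I A" by blast
      have cS: "hypergraph_center I A \<subseteq> S"
        using AS(1) by (fastforce simp: hypergraph_center_def)
      have vS: "v \<in> S" using v cS by blast
      have finC: "finite (hypergraph_center I A)" using cS S(1) by (rule finite_subset)
      define n where "n = card S"
      have nc: "N + Suc c \<le> n" using S by (simp add: n_def)
      have kn: "k i + Suc c \<le> n" if "i \<in> I" for i
      proof -
        have "a * (real n - real (Suc c)) \<le> 1 * (real n - real (Suc c))"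
          using a nc by (intro mult_right_mono) auto
        from order_trans[OF k[OF that, folded n_def] this] have "real (k i) + real (Suc c) \<le> real n" by simp
        thus ?thesis by (simp only: of_nat_add[symmetric] of_nat_le_iff)
      qed
      define sparse where "sparse i \<longleftrightarrow> K + Suc c \<le> k i \<and> real (k i) \<le> d * (real n - real (Suc c)) \<and>
         \<epsilon> + real (Suc c) * \<gamma> \<le> mu S (k i) (F i)" for i
      \<comment> \<open>Images of \<open>v\<close> with too thin a link; they are excluded for
        sparse families only, as a lower regular family admits every image.\<close>
      define U where "U i = {u\<in>S. mu (S - {u}) (k i - 1) (slice S (F i) {u} {u}) < mu S (k i) (F i) - \<gamma>}" for i
      define I' where "I' = {i\<in>I. sparse i}"
      have cU: "real (card (U i)) \<le> \<gamma> * real n" if "i \<in> I'" for i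
        unfolding U_def n_def
      proof (rule fairness[OF S(1) F _ _ \<gamma>(1)])
        show i: "i \<in> I" using that by (simp add: I'_def)
        show "k i \<le> card S" using kn[OF i] by (simp add: n_def)
        have K: "K \<le> k i" using that by (simp add: I'_def sparse_def)
        show "2 \<le> k i" using K \<gamma> by simp
        show "1 / \<gamma> ^ 3 < real (k i)" using K \<gamma>(3) by linarith
      qed
      define G where "G = S - (\<Union>i\<in>I'. U i)"
      have G: "real n / 2 \<le> real (card G)"
      proof -
        have fI': "finite I'" using I by (simp add: I'_def)
        have fU: "finite (U i)" for i using S by (simp add: U_def)
        have US: "(\<Union>i\<in>I'. U i) \<subseteq> S" by (auto simp: U_def)
        have "real (card (\<Union>i\<in>I'. U i)) \<le> real (\<Sum>i\<in>I'. card (U i))"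
          using card_UN_le[OF fI', of U] by (simp only: of_nat_le_iff)
        also have "\<dots> \<le> (\<Sum>i\<in>I'. \<gamma> * real n)" unfolding of_nat_sum by (intro sum_mono cU)
        also have "\<dots> = real (card I') * (\<gamma> * real n)" by simp
        also have "\<dots> \<le> real (card I) * (\<gamma> * real n)"
          using \<gamma> I by (intro mult_right_mono) (auto simp: I'_def intro!: card_mono)
        also have "\<dots> = (\<gamma> * real (card I)) * real n" by simp
        also have "\<dots> \<le> 1/2 * real n" using \<gamma> by (intro mult_right_mono) auto
        finally have "real (card (\<Union>i\<in>I'. U i)) \<le> real n / 2" by simp
        moreover have "card G + card (\<Union>i\<in>I'. U i) = n"
        proof -
          have "card G = n - card (\<Union>i\<in>I'. U i)"
            unfolding G_def n_def using US S(1) by (intro card_Diff_subset) (auto intro: finite_subset)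
          moreover have "card (\<Union>i\<in>I'. U i) \<le> n" unfolding n_def using US S(1) by (intro card_mono)
          ultimately show ?thesis by simp
        qed
        hence "real (card G) + real (card (\<Union>i\<in>I'. U i)) = real n" by (simp flip: of_nat_add)
        ultimately show ?thesis by linarith
      qed
      have "\<zeta> / 2 ^ c / 2 \<le> real (card (copies S I A F)) / fact (card S)"
      proof (rule copies_lower_bound_step[OF S(1) vS AS(1)])
        show "G \<subseteq> S" by (auto simp: G_def)
        show "real (card S) / 2 \<le> real (card G)" using G by (simp add: n_def)
        show "0 \<le> \<zeta> / 2 ^ c" using \<zeta> by simp
        fix u assume u: "u \<in> G"
        hence uS: "u \<in> S" by (simp add: G_def)
        let ?t = "Transposition.transpose v u"
        let ?B = "\<lambda>i. if v \<in> A i then {u} else {}"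
        let ?A = "\<lambda>i. ?t ` (A i - {v})" and ?F = "\<lambda>i. slice S (F i) {u} (?B i)" and ?k = "\<lambda>i. k i - card (?B i)"
        have inj: "inj ?t" by (rule inj_transpose)
        have cS': "card (S - {u}) = n - 1" using uS S(1) by (simp add: n_def)
        have rS': "real (card (S - {u})) - real c = real n - real (Suc c)"
          unfolding cS' using nc by (simp add: of_nat_diff)
        show "\<zeta> / 2 ^ c \<le> real (card (copies (S - {u}) I ?A ?F)) / fact (card (S - {u}))"
        proof (rule Suc.IH)
          show "finite (S - {u})" "N + c \<le> card (S - {u})" using S(1) nc cS' by auto
          show "card (hypergraph_center I ?A) \<le> c"
          proof -
            have "hypergraph_center I ?A \<subseteq> ?t ` (hypergraph_center I A - {v})"
            proof
              fix y assume "y \<in> hypergraph_center I ?A"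
              then obtain i j x x' where ij: "i \<in> I" "j \<in> I" "i \<noteq> j"
                and x: "x \<in> A i - {v}" "y = ?t x" "x' \<in> A j - {v}" "y = ?t x'"
                unfolding hypergraph_center_def by blast
              have "x = x'" using x inj by (metis injD)
              hence "x \<in> hypergraph_center I A - {v}" using ij x unfolding hypergraph_center_def by blast
              thus "y \<in> ?t ` (hypergraph_center I A - {v})" using x(2) by blast
            qed
            hence "card (hypergraph_center I ?A) \<le> card (hypergraph_center I A - {v})"
              using finC by (meson card_image_le card_mono finite_Diff finite_imageI le_trans)
            thus ?thesis using A(2) v finC by (simp add: card_Diff_singleton)
          qed
          fix i assume i: "i \<in> I"
          have cA: "card (?A i) = ?k i"
            using AS(2,3)[OF i] inj by (simp add: card_image inj_on_subset[OF inj])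
          have "?t x \<in> S - {u}" if "x \<in> A i - {v}" for x
            using that AS(1)[OF i] vS uS by (auto simp: Transposition.transpose_def)
          thus "?A i \<in> nsets (S - {u}) (?k i)" using cA AS(3)[OF i] by (auto simp: nsets_def)
          show "?F i \<subseteq> nsets (S - {u}) (?k i)" by (rule slice_nsets[OF S(1) F[OF i]]) auto
          have "real (?k i) \<le> real (k i)" by simp
          also have "\<dots> \<le> a * (real (card (S - {u})) - real c)"
            using k[OF i] unfolding rS' n_def[symmetric] .
          finally show "real (?k i) \<le> a * (real (card (S - {u})) - real c)" .
          show "lower_regular (r + c) \<epsilon> (S - {u}) (?k i) (?F i) \<or>
            (K + c \<le> ?k i \<and> real (?k i) \<le> d * (real (card (S - {u})) - real c) \<and>
             \<epsilon> + real c * \<gamma> \<le> mu (S - {u}) (?k i) (?F i))"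
          proof (cases "lower_regular (r + Suc c) \<epsilon> S (k i) (F i)")
            case True
            have "card (?B i) \<le> k i" using card_gt_0_iff[of "A i"] AS(2,3)[OF i] by auto
            hence "lower_regular (r + c) \<epsilon> (S - {u}) (?k i) (?F i)"
              using True S(1) uS by (intro lower_regular_slice) auto
            thus ?thesis ..
          next
            case False
            hence sp: "sparse i" using reg[OF i] by (simp add: sparse_def n_def)
            hence iI': "i \<in> I'" using i by (simp add: I'_def)
            have uU: "u \<notin> U i" using u iI' by (auto simp: G_def)
            have "K + Suc c \<le> k i" using sp unfolding sparse_def by (rule conjunct1)
            hence k1: "K + c \<le> ?k i" by simp linarith
            have "real (?k i) \<le> real (k i)" by simp
            also have "\<dots> \<le> d * (real (card (S - {u})) - real c)"
              using sp unfolding rS' sparse_def by simp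
            finally have k2: "real (?k i) \<le> d * (real (card (S - {u})) - real c)" .
            \<comment> \<open>An edge through \<open>v\<close> passes to the link of
              \<open>u\<close>, which is dense enough because \<open>u\<close> avoids
              \<open>U i\<close>. An edge missing \<open>v\<close> merely has \<open>u\<close>
              deleted, which costs at most \<open>k i / n \<le> d \<le> \<gamma>\<close>.\<close>
            have "mu S (k i) (F i) - \<gamma> \<le> mu (S - {u}) (?k i) (?F i)"
            proof (cases "v \<in> A i")
              case True
              thus ?thesis using uU uS by (simp add: U_def not_less)
            next
              case vA: False
              have n0: "0 < real n" using nc by simp
              have "d * (real n - real (Suc c)) \<le> d * real n" using d by (intro mult_left_mono) auto
              hence "real (k i) \<le> d * real n" using sp unfolding sparse_def by linarith
              hence "real (k i) / real n \<le> d" using n0 by (simp add: pos_divide_le_eq)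
              moreover have "dens (k i) (F i) S - real (card {u}) * (real (k i) / real (card S)) \<le> dens (k i) (F i) (S - {u})"
                by (rule dens_remove[OF S(1) _ F[OF i]]) (use uS cS' kn[OF i] in auto)
              ultimately have "dens (k i) (F i) S - \<gamma> \<le> dens (k i) (F i) (S - {u})"
                using d(2) by (simp add: n_def)
              thus ?thesis using vA by (simp add: mu_slice_empty mu_eq_dens[OF F[OF i]])
            qed
            moreover have "\<epsilon> + real c * \<gamma> \<le> mu S (k i) (F i) - \<gamma>"
              using sp by (simp add: sparse_def distrib_right)
            ultimately have "\<epsilon> + real c * \<gamma> \<le> mu (S - {u}) (?k i) (?F i)" by linarith
            thus ?thesis using k1 k2 by blast
          qed
        qed
      qed
      thus ?thesis by (simp add: mult.commute)
    qed
  }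
qed

section \<open>From counts to probabilities, and the choice of constants\<close>

lemma prob_permutes_eq_copies:
  assumes "finite S"
  shows "measure_pmf.prob (pmf_of_set {\<pi>. \<pi> permutes S}) {\<pi>. \<forall>i\<in>I. \<pi> ` A i \<in> F i} =
     real (card (copies S I A F)) / fact (card S)"
proof -
  have "{\<pi>. \<pi> permutes S} \<inter> {\<pi>. \<forall>i\<in>I. \<pi> ` A i \<in> F i} = copies S I A F"
    by (auto simp: copies_def)
  moreover have "{\<pi>. \<pi> permutes S} \<noteq> {}" using permutes_id[of S] by blast
  ultimately show ?thesis
    using finite_permutations[OF assms] card_permutations[OF refl assms]
    by (simp add: measure_pmf_of_set)
qed

lemma lower_regular_of_regular_family:
  assumes "regular_family S k F R \<delta>" "r \<le> R" "\<epsilon> + \<delta> \<le> mu S k F"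
  shows "lower_regular r \<epsilon> S k F"
  unfolding lower_regular_def
proof (intro allI impI)
  fix J B assume "J \<subseteq> S" "card J \<le> r" "B \<subseteq> J" "card B \<le> k" "k - card B \<le> card (S - J)"
  hence "\<bar>mu (S - J) (k - card B) (slice S F J B) - mu S k F\<bar> < \<delta>"
    using assms(1,2) unfolding regular_family_def by (meson order_trans)
  thus "\<epsilon> \<le> mu (S - J) (k - card B) (slice S F J B)" using assms(3) by linarith
qed

theorem theorem7p1:
  fixes c h :: nat and \<epsilon> :: real
  assumes "\<epsilon> > 0"
  shows "\<exists>\<delta>::real. \<delta> > 0 \<and>
    (\<forall>(n::nat) (k :: nat \<Rightarrow> nat) (A :: nat \<Rightarrow> nat set) (F :: nat \<Rightarrow> nat set set).
       (\<forall>i\<in>{1..h}. 1 / \<delta> \<le> real (k i) \<and> real (k i) \<le> (1 / real h - \<epsilon>) * real n) \<longrightarrow>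
       (\<forall>i\<in>{1..h}. A i \<in> nsets {1..n} (k i)) \<longrightarrow>
       card (hypergraph_center {1..h} A) \<le> c \<longrightarrow>
       (\<forall>i\<in>{1..h}. F i \<subseteq> nsets {1..n} (k i)) \<longrightarrow>
       (\<forall>i\<in>{1..h}. mu {1..n} (k i) (F i) \<ge> \<epsilon>) \<longrightarrow>
       (\<forall>i\<in>{1..h}. real (k i) / real n \<le> \<delta> \<or>
          regular_family {1..n} (k i) (F i) (nat \<lceil>1 / \<delta>\<rceil>) \<delta>) \<longrightarrow>
       measure_pmf.prob (pmf_of_set {\<pi>. \<pi> permutes {1..n}})
         {\<pi>. \<forall>i\<in>{1..h}. \<pi> ` A i \<in> F i} > \<delta>)"
proof (cases "h = 0 \<or> 1 / real h \<le> \<epsilon>")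
  \<comment> \<open>For \<open>h > 0\<close> the bounds on \<open>k 1\<close> contradict each other,
    since \<open>1 / \<delta> = 2\<close> while the upper bound is not positive. For
    \<open>h = 0\<close> the event is certain.\<close>
  case True
  show ?thesis
  proof (intro exI[of _ "1/2"] conjI allI impI)
    fix n :: nat and k :: "nat \<Rightarrow> nat" and A F
    assume k: "\<forall>i\<in>{1..h}. 1 / (1/2) \<le> real (k i) \<and> real (k i) \<le> (1 / real h - \<epsilon>) * real n"
    have "h = 0"
    proof (rule ccontr)
      assume "h \<noteq> 0"
      hence "1 \<in> {1..h}" by simp
      hence "2 \<le> real (k 1)" "real (k 1) \<le> (1 / real h - \<epsilon>) * real n" using k by auto
      moreover have "(1 / real h - \<epsilon>) * real n \<le> 0"
        using True \<open>h \<noteq> 0\<close> by (intro mult_nonpos_nonneg) auto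
      ultimately show False by linarith
    qed
    thus "1/2 < measure_pmf.prob (pmf_of_set {\<pi>. \<pi> permutes {1..n}}) {\<pi>. \<forall>i\<in>{1..h}. \<pi> ` A i \<in> F i}"
      by simp
  qed simp
next
  case False
  hence h: "real h \<ge> 1" and \<epsilon>: "\<epsilon> < 1 / real h" by auto
  have h1: "1 / real h \<le> 1" using h by simp
  \<comment> \<open>Between \<open>1 / h - \<epsilon>\<close> and \<open>a\<close> lies the room for
    replacing \<open>n\<close> by \<open>n - c\<close>; \<open>p1\<close> is strictly between
    \<open>a\<close> and \<open>1 / h\<close>.\<close>
  define a p1 where "a = 1 / real h - \<epsilon> / 2" and "p1 = 1 / real h - \<epsilon> / 4"
  have a: "0 \<le> a" "a < p1" "p1 < 1" "a < 1" using \<epsilon> h1 assms by (auto simp: a_def p1_def)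
  have p1: "0 \<le> p1" "p1 * real (card {1..h}) \<le> 1"
    using a(1,2) h assms by (simp_all add: p1_def left_diff_distrib)
  obtain r N \<eta> where \<eta>: "\<eta> > 0" and sharp:
    "\<And>(S :: nat set) F k. finite S \<Longrightarrow> card S \<ge> N \<Longrightarrow> F \<subseteq> nsets S k \<Longrightarrow> real k \<le> a * real (card S) \<Longrightarrow>
       (\<And>J. J \<subseteq> S \<Longrightarrow> card J \<le> r \<Longrightarrow> \<epsilon> / 4 \<le> dens k F (S - J)) \<Longrightarrow>
       cube_exp p1 S (\<lambda>X. of_bool (dens k F X < \<eta>)) < 1 / (2 * real h)"
  proof (rule dens_sharp_threshold[OF a(1-3), of "1 / (2 * real h)" "\<epsilon> / 4"])
    show "0 < 1 / (2 * real h)" "0 < \<epsilon> / 4" using h assms by auto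
    fix r N \<eta>
    assume "\<eta> > 0" and "\<And>(S :: nat set) F k. finite S \<Longrightarrow> card S \<ge> N \<Longrightarrow> F \<subseteq> nsets S k \<Longrightarrow>
       real k \<le> a * real (card S) \<Longrightarrow> (\<And>J. J \<subseteq> S \<Longrightarrow> card J \<le> r \<Longrightarrow> \<epsilon> / 4 \<le> dens k F (S - J)) \<Longrightarrow>
       cube_exp p1 S (\<lambda>X. of_bool (dens k F X < \<eta>)) < 1 / (2 * real h)"
    thus thesis by (rule that)
  qed
  \<comment> \<open>The union bound over \<open>h\<close> classes with failure probability
    \<open>1 / (2 * h)\<close> each leaves the factor 1/2.\<close>
  define \<zeta> where "\<zeta> = \<eta> ^ h / 2"
  have \<zeta>: "\<zeta> > 0" using \<eta> by (simp add: \<zeta>_def)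
  \<comment> \<open>The exceptional sets of \<open>h\<close> families then cover at most half of the
    vertices, and \<open>c\<close> exposures cost at most density
    \<open>\<epsilon> / 2\<close>.\<close>
  define \<gamma> where "\<gamma> = min (1 / (2 * real h)) (\<epsilon> / (2 * (real c + 1)))"
  have \<gamma>: "\<gamma> > 0" "\<gamma> \<le> 1 / (2 * real h)" "\<gamma> \<le> \<epsilon> / (2 * (real c + 1))"
    using h assms by (auto simp: \<gamma>_def)
  \<comment> \<open>Removing \<open>r\<close> vertices from a sparse family costs at most
    \<open>\<epsilon> / 4\<close> of the remaining \<open>\<epsilon> / 2\<close>.\<close>
  define d where "d = min \<gamma> (\<epsilon> / (4 * (real r + 1)))"
  have d: "d > 0" "d \<le> \<gamma>" "d \<le> \<epsilon> / (4 * (real r + 1))" using \<gamma> assms by (auto simp: d_def)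
  define K where "K = nat \<lceil>1 / \<gamma> ^ 3\<rceil> + 2"
  have K: "1 / \<gamma> ^ 3 < real K" "2 \<le> K" unfolding K_def by linarith+
  define N' where "N' = N + nat \<lceil>real r / (1 - a)\<rceil>"
  have N': "N \<le> N'" "real r \<le> (1 - a) * real N'"
  proof -
    have "real r / (1 - a) \<le> real N'" unfolding N'_def by linarith
    thus "real r \<le> (1 - a) * real N'" using a by (simp add: pos_divide_le_eq mult.commute)
  qed (simp add: N'_def)
  have rd: "\<epsilon> / 4 + real r * d \<le> \<epsilon> / 2"
  proof -
    have "real r * d \<le> (real r + 1) * (\<epsilon> / (4 * (real r + 1)))" using d by (intro mult_mono) auto
    also have "\<dots> = \<epsilon> / 4" by (simp add: field_simps)
    finally show ?thesis by simp
  qed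
  have c\<gamma>: "\<epsilon> / 2 + real c * \<gamma> \<le> \<epsilon>"
  proof -
    have "real c * \<gamma> \<le> (real c + 1) * (\<epsilon> / (2 * (real c + 1)))" using \<gamma> by (intro mult_mono) auto
    also have "\<dots> = \<epsilon> / 2" by (simp add: field_simps)
    finally show ?thesis by simp
  qed
  have lower: "\<zeta> / 2 ^ c \<le> real (card (copies S {1..h} A F)) / fact (card S)"
    if "finite S" "N' + c \<le> card S"
    "\<And>i. i \<in> {1..h} \<Longrightarrow> A i \<in> nsets S (k i)" "card (hypergraph_center {1..h} A) \<le> c"
    "\<And>i. i \<in> {1..h} \<Longrightarrow> F i \<subseteq> nsets S (k i)"
    "\<And>i. i \<in> {1..h} \<Longrightarrow> real (k i) \<le> a * (real (card S) - real c)"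
    "\<And>i. i \<in> {1..h} \<Longrightarrow> lower_regular (r + c) (\<epsilon> / 2) S (k i) (F i) \<or>
      (K + c \<le> k i \<and> real (k i) \<le> d * (real (card S) - real c) \<and> \<epsilon> / 2 + real c * \<gamma> \<le> mu S (k i) (F i))"
    for S :: "nat set" and A k F
  proof (rule copies_lower_bound_center[where N = N' and r = r and K = K and \<beta> = "\<epsilon> / 4" and \<epsilon> = "\<epsilon> / 2"
        and a = a and d = d and \<gamma> = \<gamma>, OF _ less_imp_le[OF \<zeta>] a(1,4) N'(2) less_imp_le[OF d(1)] d(2) _ rd \<gamma>(1) _ K _ that])
    show "finite {1..h}" by simp
    show "\<epsilon> / 4 \<le> \<epsilon> / 2" using assms by simp
    have "\<gamma> * real h \<le> 1 / (2 * real h) * real h" using \<gamma> by (intro mult_right_mono) auto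
    also have "\<dots> = 1/2" using h by simp
    finally show "\<gamma> * real (card {1..h}) \<le> 1/2" by simp
  next
    fix S :: "nat set" and A :: "nat \<Rightarrow> nat set" and k :: "nat \<Rightarrow> nat" and F
    assume S: "finite S" "N' \<le> card S" and A: "\<And>i. i \<in> {1..h} \<Longrightarrow> A i \<in> nsets S (k i)" "disjoint_family_on A {1..h}"
      and F: "\<And>i. i \<in> {1..h} \<Longrightarrow> F i \<subseteq> nsets S (k i)"
      and k: "\<And>i. i \<in> {1..h} \<Longrightarrow> real (k i) \<le> a * real (card S)"
      and low: "\<And>i J. i \<in> {1..h} \<Longrightarrow> J \<subseteq> S \<Longrightarrow> card J \<le> r \<Longrightarrow> \<epsilon> / 4 \<le> dens (k i) (F i) (S - J)"
    have "\<eta> ^ card {1..h} * (1 - real (card {1..h}) * (1 / (2 * real h))) \<le> real (card (copies S {1..h} A F)) / fact (card S)"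
    proof (rule disjoint_copies_lower_bound[OF _ S(1) p1 A F less_imp_le[OF \<eta>]])
      fix i assume i: "i \<in> {1..h}"
      show "cube_exp p1 S (\<lambda>X. of_bool (dens (k i) (F i) X < \<eta>)) \<le> 1 / (2 * real h)"
        by (rule less_imp_le, rule sharp[OF S(1) order_trans[OF N'(1) S(2)] F[OF i] k[OF i] low[OF i]])
    qed auto
    moreover have "h \<noteq> 0" using h by auto
    ultimately show "\<zeta> \<le> real (card (copies S {1..h} A F)) / fact (card S)" by (simp add: \<zeta>_def)
  qed
  \<comment> \<open>\<open>L = 1 / \<delta>\<close> bounds every \<open>k i\<close>, hence also
    \<open>n\<close>, from below. The first summand gives the reserves in size and regularity,
    \<open>2 * real c / \<epsilon>\<close> the passage to \<open>n - c\<close>, and the last three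
    \<open>\<delta> \<le> \<epsilon> / 2\<close>, \<open>\<delta> \<le> d / 2\<close> and the final
    comparison with \<open>\<zeta> / 2 ^ c\<close>.\<close>
  define L where "L = real (r + 3 * c + K + N' + 1) + 2 * real c / \<epsilon> + 2 / \<epsilon> + 2 / d + 2 ^ (c + 1) / \<zeta>"
  have nonneg: "0 \<le> real (r + 3 * c + K + N' + 1)" "0 \<le> 2 * real c / \<epsilon>" "0 \<le> 2 / \<epsilon>" "0 \<le> 2 / d" "0 \<le> 2 ^ (c + 1) / \<zeta>"
    using assms d \<zeta> by auto
  have L: "real (r + 3 * c + K + N' + 1) \<le> L" "2 * real c / \<epsilon> \<le> L" "2 / \<epsilon> \<le> L" "2 / d \<le> L" "2 ^ (c + 1) / \<zeta> \<le> L"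
    using nonneg unfolding L_def by linarith+
  have L0: "L > 0" using L(1) by simp
  define \<delta> where "\<delta> = 1 / L"
  have \<delta>: "\<delta> > 0" "1 / \<delta> = L" using L0 by (simp_all add: \<delta>_def)
  have \<delta>le: "\<delta> \<le> x / y" if "y / x \<le> L" "x > 0" "y > 0" for x y
    using that L0 by (simp add: \<delta>_def field_simps)
  have \<delta>s: "\<delta> \<le> \<epsilon> / 2" "\<delta> \<le> d / 2" "\<delta> \<le> \<zeta> / 2 ^ (c + 1)"
    by (rule \<delta>le[OF L(3) assms], simp) (rule \<delta>le[OF L(4) d(1)], simp, rule \<delta>le[OF L(5) \<zeta>], simp)
  show ?thesis
  proof (intro exI[of _ \<delta>] conjI allI impI)
    show "\<delta> > 0" by (rule \<delta>)
    fix n :: nat and k :: "nat \<Rightarrow> nat" and A :: "nat \<Rightarrow> nat set" and F :: "nat \<Rightarrow> nat set set"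
    assume k: "\<forall>i\<in>{1..h}. 1 / \<delta> \<le> real (k i) \<and> real (k i) \<le> (1 / real h - \<epsilon>) * real n"
      and A: "\<forall>i\<in>{1..h}. A i \<in> nsets {1..n} (k i)"
      and center: "card (hypergraph_center {1..h} A) \<le> c"
      and F: "\<forall>i\<in>{1..h}. F i \<subseteq> nsets {1..n} (k i)"
      and mu: "\<forall>i\<in>{1..h}. \<epsilon> \<le> mu {1..n} (k i) (F i)"
      and reg: "\<forall>i\<in>{1..h}. real (k i) / real n \<le> \<delta> \<or> regular_family {1..n} (k i) (F i) (nat \<lceil>1 / \<delta>\<rceil>) \<delta>"
    have "1 \<in> {1..h}" using h by simp
    hence "L \<le> real (k 1)" "A 1 \<in> nsets {1..n} (k 1)" using k A \<delta> by auto
    moreover have "k 1 \<le> n" using \<open>A 1 \<in> nsets {1..n} (k 1)\<close> card_mono[of "{1..n}" "A 1"] by (auto simp: nsets_def)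
    ultimately have nL: "L \<le> real n" by linarith
    hence n: "r + 3 * c + K + N' + 1 \<le> n" using L(1) by linarith
    have "\<zeta> / 2 ^ c \<le> real (card (copies {1..n} {1..h} A F)) / fact (card {1..n})"
    proof (rule lower)
      show "N' + c \<le> card {1..n}" using n by simp
      fix i assume i: "i \<in> {1..h}"
      show "A i \<in> nsets {1..n} (k i)" "F i \<subseteq> nsets {1..n} (k i)" using A F i by auto
      have "real (k i) \<le> (1 / real h - \<epsilon>) * real n" using k i by auto
      also have "\<dots> \<le> a * (real n - real c)"
      proof -
        have "2 * real c / \<epsilon> \<le> real n" using L(2) nL by linarith
        hence "real c \<le> \<epsilon> / 2 * real n" using assms by (simp add: pos_divide_le_eq mult.commute)
        moreover have "a * real c \<le> real c" using a mult_right_mono[of a 1 "real c"] by simp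
        moreover have "(1 / real h - \<epsilon>) * real n = a * real n - \<epsilon> / 2 * real n"
          by (simp add: a_def algebra_simps)
        ultimately show ?thesis by (simp add: right_diff_distrib)
      qed
      finally show "real (k i) \<le> a * (real (card {1..n}) - real c)" by simp
      show "lower_regular (r + c) (\<epsilon> / 2) {1..n} (k i) (F i) \<or>
        (K + c \<le> k i \<and> real (k i) \<le> d * (real (card {1..n}) - real c) \<and> \<epsilon> / 2 + real c * \<gamma> \<le> mu {1..n} (k i) (F i))"
      proof (cases "regular_family {1..n} (k i) (F i) (nat \<lceil>1 / \<delta>\<rceil>) \<delta>")
        case True
        have "lower_regular (r + c) (\<epsilon> / 2) {1..n} (k i) (F i)"
        proof (rule lower_regular_of_regular_family[OF True])
          show "r + c \<le> nat \<lceil>1 / \<delta>\<rceil>" using L(1) unfolding \<delta>(2) by linarith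
          show "\<epsilon> / 2 + \<delta> \<le> mu {1..n} (k i) (F i)" using mu i \<delta>s(1) by fastforce
        qed
        thus ?thesis ..
      next
        case False
        hence "real (k i) / real n \<le> \<delta>" using reg i by auto
        hence "real (k i) \<le> \<delta> * real n" using n by (simp add: pos_divide_le_eq)
        also have "\<dots> \<le> d / 2 * real n" using \<delta>s(2) by (intro mult_right_mono) auto
        also have "\<dots> = d * (real n / 2)" by simp
        also have "\<dots> \<le> d * (real n - real c)" using n d by (intro mult_left_mono) auto
        finally have "real (k i) \<le> d * (real (card {1..n}) - real c)" by simp
        moreover have "L \<le> real (k i)" using k i \<delta> by auto
        hence "K + c \<le> k i" using L(1) by linarith
        moreover have "\<epsilon> / 2 + real c * \<gamma> \<le> mu {1..n} (k i) (F i)" using mu i c\<gamma> by fastforce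
        ultimately show ?thesis by blast
      qed
    qed (use center in auto)
    moreover have "\<delta> < \<zeta> / 2 ^ c"
    proof -
      have "\<zeta> / 2 ^ (c + 1) < \<zeta> / 2 ^ c" using \<zeta> by (intro divide_strict_left_mono) auto
      thus ?thesis using \<delta>s(3) by linarith
    qed
    ultimately show "\<delta> < measure_pmf.prob (pmf_of_set {\<pi>. \<pi> permutes {1..n}}) {\<pi>. \<forall>i\<in>{1..h}. \<pi> ` A i \<in> F i}"
      unfolding prob_permutes_eq_copies[OF finite_atLeastAtMost] by linarith
  qed
qed

end
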